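(* Let $\Sigma$ be a connected finite flag complex that is triangle-free (so $\Sigma$ is a graph), and let $N$ be the number of vertices of $\Sigma$. Then for each choice of a maximal tree in $\Sigma$ and for each integer $n\ge 1$, there is an algorithm that produces an explicit presentation for $\Gamma_n$ with $N$ generators and $N-1+n(1-\chi(\Sigma))$ relations, where $\chi(\Sigma)$ is the Euler characteristic of $\Sigma$. Moreover, these presentations are efficient.
   Context: A flag complex is a simplicial complex in which every set of pairwise adjacent vertices spans a simplex; it is triangle-free if its $1$-skeleton has no cycles of length $3$. For a finite flag complex $\Sigma$ with vertices $a_1,\dots,a_N$, $G_\Sigma=\langle e_1,\dots,e_N \mid [e_i,e_j]\text{ for each edge }\{a_i,a_j\}\in\Sigma\rangle$, $\pi:G_\Sigma\to\mathbf{Z}$ is the surjection sending every $e_i$ to $1$, and $\Gamma_n=\pi^{-1}(n\mathbf{Z})$ for $n\ge1$. The deficiency of a finite presentation is the number of relations minus the number of generators (for a presentation $F/R$ with $F$ free, the minimal number of normal generators of $R$ minus the rank of $F$). For every finite presentation of a group $\Gamma$ the deficiency is at least $d(H_2(\Gamma;\mathbf{Z}))-\mathrm{rk}(H_1(\Gamma;\mathbf{Z}))$, where $d$ is the minimal number of generators and $\mathrm{rk}$ is torsion-free rank; the presentation is called efficient if its deficiency equals this lower bound. *)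

theory Defs
  imports "HOL-Algebra.Free_Abelian_Groups" "HOL-Library.Nat_Bijection"
begin

section \<open>Free groups and presentations\<close>

text \<open>The letter \<open>(x, False)\<close> stands for the generator \<open>x\<close> and \<open>(x, True)\<close> for its inverse.\<close>

type_synonym 'a word = "('a \<times> bool) list"

definition inv_letter :: "'a \<times> bool \<Rightarrow> 'a \<times> bool"
  where "inv_letter l = (fst l, \<not> snd l)"

definition inv_word :: "'a word \<Rightarrow> 'a word"
  where "inv_word w = rev (map inv_letter w)"

definition reduced :: "'a word \<Rightarrow> bool"
  where "reduced = successively (\<lambda>l m. m \<noteq> inv_letter l)"

fun cons_reduce :: "'a \<times> bool \<Rightarrow> 'a word \<Rightarrow> 'a word"
  where
    "cons_reduce l [] = [l]"
  | "cons_reduce l (m # w) = (if m = inv_letter l then w else l # m # w)"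

definition reduce :: "'a word \<Rightarrow> 'a word"
  where "reduce w = foldr cons_reduce w []"

definition words_over :: "'a set \<Rightarrow> 'a word set"
  where "words_over X = {w. fst ` set w \<subseteq> X}"

definition free_group :: "'a set \<Rightarrow> 'a word monoid"
  where "free_group X =
    \<lparr>carrier = {w \<in> words_over X. reduced w}, mult = (\<lambda>u v. reduce (u @ v)), one = []\<rparr>"

definition normal_closure :: "('g, 'm) monoid_scheme \<Rightarrow> 'g set \<Rightarrow> 'g set"
  where "normal_closure G R =
    generate G {g \<otimes>\<^bsub>G\<^esub> r \<otimes>\<^bsub>G\<^esub> inv\<^bsub>G\<^esub> g | g r. g \<in> carrier G \<and> r \<in> R}"

definition presented_group :: "'a set \<Rightarrow> 'a word set \<Rightarrow> 'a word set monoid"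
  where "presented_group X R = free_group X Mod normal_closure (free_group X) (reduce ` R)"

text \<open>Finite presentations, with generators \<open>0, \<dots>, num_gens - 1\<close> and a list of relators.\<close>

datatype presentation = Presentation (num_gens: nat) (relators: "nat word list")

definition presents :: "presentation \<Rightarrow> ('g, 'm) monoid_scheme \<Rightarrow> bool"
  where "presents P G \<longleftrightarrow>
    set (relators P) \<subseteq> words_over {..<num_gens P} \<and>
    presented_group {..<num_gens P} (set (relators P)) \<cong> G"

definition deficiency :: "presentation \<Rightarrow> int"
  where "deficiency P = int (length (relators P)) - int (num_gens P)"


section \<open>Integral group homology\<close>

text \<open>
  Homology with trivial coefficients in the integers, computed from the (inhomogeneous) bar
  complex: the list \<open>[g\<^sub>1, \<dots>, g\<^sub>k]\<close> is the basis element \<open>[g\<^sub>1|\<dots>|g\<^sub>k]\<close> in degree \<open>k\<close>.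
\<close>

definition bar_chains :: "('g, 'm) monoid_scheme \<Rightarrow> nat \<Rightarrow> ('g list \<Rightarrow>\<^sub>0 int) monoid"
  where "bar_chains G k = free_Abelian_group {gs. length gs = k \<and> set gs \<subseteq> carrier G}"

definition bar_face :: "('g, 'm) monoid_scheme \<Rightarrow> nat \<Rightarrow> 'g list \<Rightarrow> 'g list"
  where "bar_face G i gs =
    (if i = 0 then tl gs
     else if i = length gs then butlast gs
     else take (i - 1) gs @ (gs ! (i - 1) \<otimes>\<^bsub>G\<^esub> gs ! i) # drop (i + 1) gs)"

definition bar_boundary :: "('g, 'm) monoid_scheme \<Rightarrow> ('g list \<Rightarrow>\<^sub>0 int) \<Rightarrow> ('g list \<Rightarrow>\<^sub>0 int)"
  where "bar_boundary G = frag_extend (\<lambda>gs. if gs = [] then 0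
    else \<Sum>i\<le>length gs. frag_cmul ((-1) ^ i) (frag_of (bar_face G i gs)))"

definition bar_cycles :: "('g, 'm) monoid_scheme \<Rightarrow> nat \<Rightarrow> ('g list \<Rightarrow>\<^sub>0 int) set"
  where "bar_cycles G k = {c \<in> carrier (bar_chains G k). bar_boundary G c = 0}"

definition bar_boundaries :: "('g, 'm) monoid_scheme \<Rightarrow> nat \<Rightarrow> ('g list \<Rightarrow>\<^sub>0 int) set"
  where "bar_boundaries G k = bar_boundary G ` carrier (bar_chains G (Suc k))"

definition group_homology :: "nat \<Rightarrow> ('g, 'm) monoid_scheme \<Rightarrow> ('g list \<Rightarrow>\<^sub>0 int) set monoid"
  where "group_homology k G = subgroup_generated (bar_chains G k) (bar_cycles G k) Mod bar_boundaries G k"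

text \<open>
  The next two numbers are meant for finitely generated (abelian) groups; \<open>H\<^sub>1\<close> and \<open>H\<^sub>2\<close>
  of a finitely presented group are finitely generated.
\<close>

definition min_num_generators :: "('g, 'm) monoid_scheme \<Rightarrow> nat"
  where "min_num_generators A =
    (LEAST d. \<exists>S \<subseteq> carrier A. finite S \<and> card S = d \<and> generate A S = carrier A)"

definition int_independent :: "('g, 'm) monoid_scheme \<Rightarrow> 'g set \<Rightarrow> bool"
  where "int_independent A S \<longleftrightarrow>
    (\<forall>c :: 'g \<Rightarrow> int. finprod A (\<lambda>s. s [^]\<^bsub>A\<^esub> c s) S = \<one>\<^bsub>A\<^esub> \<longrightarrow> (\<forall>s\<in>S. c s = 0))"

definition torsion_free_rank :: "('g, 'm) monoid_scheme \<Rightarrow> nat"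
  where "torsion_free_rank A =
    (GREATEST r. \<exists>S \<subseteq> carrier A. finite S \<and> card S = r \<and> int_independent A S)"

definition efficient :: "presentation \<Rightarrow> ('g, 'm) monoid_scheme \<Rightarrow> bool"
  where "efficient P G \<longleftrightarrow> presents P G \<and>
    deficiency P = int (min_num_generators (group_homology 2 G)) - int (torsion_free_rank (group_homology 1 G))"


section \<open>Simplicial complexes\<close>

definition simplicial_complex :: "'a set set \<Rightarrow> bool"
  where "simplicial_complex K \<longleftrightarrow>
    (\<forall>s\<in>K. finite s \<and> s \<noteq> {} \<and> (\<forall>t. t \<subseteq> s \<and> t \<noteq> {} \<longrightarrow> t \<in> K))"

definition vertices :: "'a set set \<Rightarrow> 'a set"
  where "vertices K = \<Union>K"

definition adjacent :: "'a set set \<Rightarrow> 'a \<Rightarrow> 'a \<Rightarrow> bool"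
  where "adjacent K u v \<longleftrightarrow> u \<noteq> v \<and> {u, v} \<in> K"

definition flag_complex :: "'a set set \<Rightarrow> bool"
  where "flag_complex K \<longleftrightarrow> simplicial_complex K \<and>
    (\<forall>S \<subseteq> vertices K. finite S \<and> S \<noteq> {} \<and> (\<forall>u\<in>S. \<forall>v\<in>S. u \<noteq> v \<longrightarrow> adjacent K u v) \<longrightarrow> S \<in> K)"

definition edge_cycle :: "'a set set \<Rightarrow> 'a list \<Rightarrow> bool"
  where "edge_cycle K vs \<longleftrightarrow> length vs \<ge> 3 \<and> distinct vs \<and>
    successively (adjacent K) vs \<and> adjacent K (last vs) (hd vs)"

definition triangle_free :: "'a set set \<Rightarrow> bool"
  where "triangle_free K \<longleftrightarrow> (\<nexists>vs. edge_cycle K vs \<and> length vs = 3)"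

definition connected_complex :: "'a set set \<Rightarrow> bool"
  where "connected_complex K \<longleftrightarrow> vertices K \<noteq> {} \<and>
    (\<forall>u\<in>vertices K. \<forall>v\<in>vertices K. (adjacent K)\<^sup>*\<^sup>* u v)"

definition euler_char :: "'a set set \<Rightarrow> int"
  where "euler_char K = (\<Sum>s\<in>K. (-1) ^ (card s - 1))"

definition tree_complex :: "'a set set \<Rightarrow> bool"
  where "tree_complex T \<longleftrightarrow> simplicial_complex T \<and> (\<forall>s\<in>T. card s \<le> 2) \<and>
    connected_complex T \<and> (\<nexists>vs. edge_cycle T vs)"

definition maximal_tree :: "'a set set \<Rightarrow> 'a set set \<Rightarrow> bool"
  where "maximal_tree K T \<longleftrightarrow> T \<subseteq> K \<and> tree_complex T \<and>
    (\<forall>T'. T' \<subseteq> K \<and> tree_complex T' \<and> T \<subseteq> T' \<longrightarrow> T' = T)"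


section \<open>The groups \<open>G\<^sub>K\<close> and \<open>\<Gamma>\<^sub>n\<close>\<close>

definition commutator_word :: "'a \<Rightarrow> 'a \<Rightarrow> 'a word"
  where "commutator_word u v = [(u, False), (v, False), (u, True), (v, True)]"

definition raag :: "'a set set \<Rightarrow> 'a word set monoid"
  where "raag K = presented_group (vertices K) {commutator_word u v | u v. adjacent K u v}"

text \<open>
  The map \<open>\<pi>\<close> is induced by the exponent sum on words; \<^const>\<open>the_elem\<close> picks its common
  value on a coset.
\<close>

definition exponent_sum :: "'a word \<Rightarrow> int"
  where "exponent_sum w = (\<Sum>l\<leftarrow>w. if snd l then - 1 else 1)"

definition raag_proj :: "'a word set \<Rightarrow> int"
  where "raag_proj g = the_elem (exponent_sum ` g)"

definition Gamma :: "'a set set \<Rightarrow> nat \<Rightarrow> 'a word set monoid"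
  where "Gamma K n = (raag K)\<lparr>carrier := {g \<in> carrier (raag K). int n dvd raag_proj g}\<rparr>"


section \<open>Algorithms\<close>

text \<open>
  Total recursive functions of \<open>k\<close> arguments: the initial functions, closed under composition,
  primitive recursion and minimisation of regular functions. Only the values on argument lists of
  length \<open>k\<close> are meaningful.
\<close>

inductive recursive_fun :: "nat \<Rightarrow> (nat list \<Rightarrow> nat) \<Rightarrow> bool"
  where
    zero: "recursive_fun k (\<lambda>_. 0)"
  | succ: "recursive_fun 1 (\<lambda>xs. Suc (xs ! 0))"
  | proj: "i < k \<Longrightarrow> recursive_fun k (\<lambda>xs. xs ! i)"
  | comp: "recursive_fun (length gs) f \<Longrightarrow> (\<And>g. g \<in> set gs \<Longrightarrow> recursive_fun k g) \<Longrightarrow>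
      recursive_fun k (\<lambda>xs. f (map (\<lambda>g. g xs) gs))"
  | prim_rec: "recursive_fun k f \<Longrightarrow> recursive_fun (Suc (Suc k)) g \<Longrightarrow>
      recursive_fun (Suc k) (\<lambda>xs. rec_nat (f (tl xs)) (\<lambda>y r. g (y # r # tl xs)) (hd xs))"
  | minimise: "recursive_fun (Suc k) f \<Longrightarrow> (\<And>xs. length xs = k \<Longrightarrow> \<exists>y. f (y # xs) = 0) \<Longrightarrow>
      recursive_fun k (\<lambda>xs. LEAST y. f (y # xs) = 0)"

text \<open>
  A finite complex whose vertices have been numbered by \<open>\<nu>\<close> is coded by a number through the
  bijection \<^const>\<open>set_encode\<close> between finite sets of numbers and numbers.
\<close>

definition encode_complex :: "('a \<Rightarrow> nat) \<Rightarrow> 'a set set \<Rightarrow> nat"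
  where "encode_complex \<nu> K = set_encode ((\<lambda>s. set_encode (\<nu> ` s)) ` K)"

definition encode_word :: "nat word \<Rightarrow> nat"
  where "encode_word w = list_encode (map (\<lambda>(i, b). 2 * i + of_bool b) w)"

definition encode_presentation :: "presentation \<Rightarrow> nat"
  where "encode_presentation P =
    prod_encode (num_gens P, list_encode (map encode_word (relators P)))"


section \<open>Basic facts\<close>

lemma inv_letter_inv_letter [simp]: "inv_letter (inv_letter l) = l"
  by (simp add: inv_letter_def)

lemma fst_inv_letter [simp]: "fst (inv_letter l) = fst l"
  by (simp add: inv_letter_def)

lemma reduced_Nil [simp]: "reduced []"
  by (simp add: reduced_def)

lemma reduced_Cons: "reduced (l # w) \<longleftrightarrow> (w = [] \<or> hd w \<noteq> inv_letter l) \<and> reduced w"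
  by (cases w) (auto simp: reduced_def)

lemma reduced_cons_reduce: "reduced w \<Longrightarrow> reduced (cons_reduce l w)"
  by (cases w) (auto simp: reduced_Cons)

lemma cons_reduce_cancel: "reduced w \<Longrightarrow> cons_reduce l (cons_reduce (inv_letter l) w) = w"
  by (cases w; cases "tl w") (auto simp: reduced_Cons)

lemma reduced_foldr: "reduced w \<Longrightarrow> reduced (foldr cons_reduce u w)"
  by (induction u) (auto intro: reduced_cons_reduce)

lemma reduced_reduce: "reduced (reduce w)"
  by (simp add: reduce_def reduced_foldr)

lemma reduce_reduced: "reduced w \<Longrightarrow> reduce w = w"
proof (induction w)
  case (Cons l w)
  then have "reduce w = w" by (simp add: reduced_Cons)
  with Cons.prems show ?case
    by (cases w) (auto simp: reduce_def reduced_Cons)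
qed (simp add: reduce_def)

lemma foldr_cons_reduce: "reduced w \<Longrightarrow> foldr cons_reduce (cons_reduce l u) w = cons_reduce l (foldr cons_reduce u w)"
  by (cases u) (use cons_reduce_cancel[of _ l] reduced_foldr in fastforce)+

lemma foldr_reduce: "reduced w \<Longrightarrow> foldr cons_reduce (reduce u) w = foldr cons_reduce u w"
  by (induction u) (auto simp: reduce_def foldr_cons_reduce)

lemma reduce_append_left: "reduce (reduce u @ v) = reduce (u @ v)"
  using foldr_reduce[OF reduced_reduce, of u v] by (simp add: reduce_def)

lemma reduce_append_right: "reduce (u @ reduce v) = reduce (u @ v)"
  using reduce_reduced[OF reduced_reduce, of v] by (simp add: reduce_def)

lemma words_over_append: "u @ v \<in> words_over X \<longleftrightarrow> u \<in> words_over X \<and> v \<in> words_over X"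
  by (auto simp: words_over_def)

lemma set_cons_reduce: "set (cons_reduce l w) \<subseteq> insert l (set w)"
  by (cases w) auto

lemma set_reduce: "set (reduce w) \<subseteq> set w"
proof (induction w)
  case (Cons l w)
  then show ?case using set_cons_reduce[of l "reduce w"] by (auto simp: reduce_def)
qed (simp add: reduce_def)

lemma reduce_words_over: "w \<in> words_over X \<Longrightarrow> reduce w \<in> words_over X"
  using set_reduce[of w] by (auto simp: words_over_def)

lemma reduce_inv_word: "reduce (inv_word w @ w) = []"
proof (induction w)
  case (Cons l w)
  have "cons_reduce (inv_letter l) (cons_reduce l (reduce w)) = reduce w"
    using cons_reduce_cancel[OF reduced_reduce, of "inv_letter l" w] by simp
  with Cons show ?case
    by (simp add: reduce_def inv_word_def)
qed (simp add: reduce_def inv_word_def)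

lemma inv_word_words_over: "w \<in> words_over X \<Longrightarrow> inv_word w \<in> words_over X"
  by (auto simp: words_over_def inv_word_def)

lemma group_free_group: "group (free_group X)"
proof (rule groupI)
  fix u v w assume "u \<in> carrier (free_group X)" "v \<in> carrier (free_group X)" "w \<in> carrier (free_group X)"
  then show "u \<otimes>\<^bsub>free_group X\<^esub> v \<otimes>\<^bsub>free_group X\<^esub> w = u \<otimes>\<^bsub>free_group X\<^esub> (v \<otimes>\<^bsub>free_group X\<^esub> w)"
    by (simp add: free_group_def reduce_append_left reduce_append_right)
next
  fix w assume w: "w \<in> carrier (free_group X)"
  show "\<exists>v\<in>carrier (free_group X). v \<otimes>\<^bsub>free_group X\<^esub> w = \<one>\<^bsub>free_group X\<^esub>"
  proof (rule bexI)
    show "reduce (inv_word w) \<otimes>\<^bsub>free_group X\<^esub> w = \<one>\<^bsub>free_group X\<^esub>"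
      by (simp add: free_group_def reduce_append_left reduce_inv_word)
    show "reduce (inv_word w) \<in> carrier (free_group X)"
      using w by (simp add: free_group_def reduced_reduce reduce_words_over inv_word_words_over)
  qed
qed (auto simp: free_group_def reduced_reduce reduce_words_over words_over_append reduce_reduced,
     simp add: words_over_def)

lemma normal_closure_normal:
  assumes "group G" "R \<subseteq> carrier G"
  shows "normal_closure G R \<lhd> G"
proof -
  interpret group G by fact
  show ?thesis
    unfolding normal_closure_def
  proof (rule normal_generateI)
    fix h g
    assume "h \<in> {g \<otimes>\<^bsub>G\<^esub> r \<otimes>\<^bsub>G\<^esub> inv\<^bsub>G\<^esub> g |g r. g \<in> carrier G \<and> r \<in> R}" and g: "g \<in> carrier G"
    then obtain k r where h: "h = k \<otimes>\<^bsub>G\<^esub> r \<otimes>\<^bsub>G\<^esub> inv\<^bsub>G\<^esub> k" and k: "k \<in> carrier G" and r: "r \<in> R"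
      by blast
    have "g \<otimes>\<^bsub>G\<^esub> h \<otimes>\<^bsub>G\<^esub> inv\<^bsub>G\<^esub> g = (g \<otimes>\<^bsub>G\<^esub> k) \<otimes>\<^bsub>G\<^esub> r \<otimes>\<^bsub>G\<^esub> inv\<^bsub>G\<^esub> (g \<otimes>\<^bsub>G\<^esub> k)"
      using g k r assms(2) by (auto simp: h m_assoc inv_mult_group subset_iff)
    with g k r show "g \<otimes>\<^bsub>G\<^esub> h \<otimes>\<^bsub>G\<^esub> inv\<^bsub>G\<^esub> g \<in> {g \<otimes>\<^bsub>G\<^esub> r \<otimes>\<^bsub>G\<^esub> inv\<^bsub>G\<^esub> g |g r. g \<in> carrier G \<and> r \<in> R}"
      by blast
  qed (use assms(2) in auto)
qed

lemma normal_relators: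
  assumes "R \<subseteq> words_over X"
  shows "normal_closure (free_group X) (reduce ` R) \<lhd> free_group X"
  by (rule normal_closure_normal[OF group_free_group])
     (use assms in \<open>auto simp: free_group_def reduced_reduce intro!: reduce_words_over\<close>)

lemma group_presented_group: "R \<subseteq> words_over X \<Longrightarrow> group (presented_group X R)"
  unfolding presented_group_def by (rule normal.factorgroup_is_group[OF normal_relators])

lemma raag_relators_words_over: "{commutator_word u v | u v. adjacent K u v} \<subseteq> words_over (vertices K)"
  by (auto simp: commutator_word_def words_over_def vertices_def adjacent_def)

lemma group_raag: "group (raag K)"
  unfolding raag_def by (rule group_presented_group[OF raag_relators_words_over])

lemma exponent_sum_append: "exponent_sum (u @ v) = exponent_sum u + exponent_sum v"
  by (simp add: exponent_sum_def)

lemma exponent_sum_cons_reduce: "exponent_sum (cons_reduce l w) = exponent_sum [l] + exponent_sum w"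
  by (cases w) (auto simp: exponent_sum_def inv_letter_def)

lemma exponent_sum_reduce: "exponent_sum (reduce w) = exponent_sum w"
proof (induction w)
  case (Cons l w)
  then show ?case
    using exponent_sum_append[of "[l]" w] by (simp add: reduce_def exponent_sum_cons_reduce)
qed (simp add: reduce_def)

lemma group_hom_exponent_sum: "group_hom (free_group X) integer_group exponent_sum"
  by (simp add: group_hom_def group_hom_axioms_def group_free_group group_integer_group hom_def)
     (simp add: free_group_def exponent_sum_reduce exponent_sum_append)

lemma exponent_sum_raag_relators:
  assumes "w \<in> normal_closure (free_group (vertices K)) (reduce ` {commutator_word u v | u v. adjacent K u v})"
  shows "exponent_sum w = 0"
proof -
  let ?F = "free_group (vertices K)" and ?R = "reduce ` {commutator_word u v | u v. adjacent K u v}"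
  interpret group_hom ?F integer_group exponent_sum by (rule group_hom_exponent_sum)
  have R: "?R \<subseteq> carrier ?F"
    using raag_relators_words_over by (fastforce simp: free_group_def reduced_reduce intro!: reduce_words_over)
  have "exponent_sum r = 0" if "r \<in> ?R" for r
    using that by (auto simp: exponent_sum_reduce) (simp add: exponent_sum_def commutator_word_def)
  then have "{g \<otimes>\<^bsub>?F\<^esub> r \<otimes>\<^bsub>?F\<^esub> inv\<^bsub>?F\<^esub> g | g r. g \<in> carrier ?F \<and> r \<in> ?R} \<subseteq> kernel ?F integer_group exponent_sum"
  proof -
    have "g \<otimes>\<^bsub>?F\<^esub> r \<otimes>\<^bsub>?F\<^esub> inv\<^bsub>?F\<^esub> g \<in> kernel ?F integer_group exponent_sum"
      if "g \<in> carrier ?F" "r \<in> ?R" "exponent_sum r = 0" for g r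
    proof -
      have "r \<in> carrier ?F" using that R by blast
      with that show ?thesis by (simp add: kernel_def)
    qed
    with \<open>\<And>r. r \<in> ?R \<Longrightarrow> exponent_sum r = 0\<close> show ?thesis by blast
  qed
  from G.generate_subgroup_incl[OF this subgroup_kernel] assms
  show ?thesis by (auto simp: normal_closure_def kernel_def)
qed

lemma raag_proj_coset:
  assumes "w \<in> carrier (free_group (vertices K))"
  shows "raag_proj (normal_closure (free_group (vertices K)) (reduce ` {commutator_word u v | u v. adjacent K u v})
      #>\<^bsub>free_group (vertices K)\<^esub> w) = exponent_sum w"
proof -
  let ?F = "free_group (vertices K)"
  let ?N = "normal_closure ?F (reduce ` {commutator_word u v | u v. adjacent K u v})"
  interpret group_hom ?F integer_group exponent_sum by (rule group_hom_exponent_sum)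
  interpret normal ?N ?F by (rule normal_relators[OF raag_relators_words_over])
  have "exponent_sum ` (?N #>\<^bsub>?F\<^esub> w) = {exponent_sum w}"
  proof -
    have "w \<in> ?N #>\<^bsub>?F\<^esub> w"
      using G.rcos_self[OF assms] is_subgroup by blast
    moreover have "exponent_sum x = exponent_sum w" if "x \<in> ?N #>\<^bsub>?F\<^esub> w" for x
    proof -
      from that obtain z where z: "z \<in> ?N" "x = z \<otimes>\<^bsub>?F\<^esub> w"
        by (auto simp: r_coset_def)
      then show ?thesis
        using exponent_sum_raag_relators[of z K] assms mem_carrier[of z] by simp
    qed
    ultimately show ?thesis by blast
  qed
  then show ?thesis by (simp add: raag_proj_def)
qed

lemma raag_proj_generator:
  assumes "v \<in> vertices K"
  shows "raag_proj (normal_closure (free_group (vertices K)) (reduce ` {commutator_word u v | u v. adjacent K u v})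
      #>\<^bsub>free_group (vertices K)\<^esub> [(v, False)]) = 1"
  by (subst raag_proj_coset)
     (use assms in \<open>auto simp: free_group_def words_over_def reduced_def exponent_sum_def\<close>)

lemma raag_proj_hom: "raag_proj \<in> hom (raag K) integer_group"
proof -
  let ?F = "free_group (vertices K)"
  let ?N = "normal_closure ?F (reduce ` {commutator_word u v | u v. adjacent K u v})"
  interpret group_hom ?F integer_group exponent_sum by (rule group_hom_exponent_sum)
  interpret normal ?N ?F by (rule normal_relators[OF raag_relators_words_over])
  show ?thesis
    by (auto simp: raag_def presented_group_def hom_def carrier_FactGroup rcos_sum raag_proj_coset)
qed

end

(*
  Rewriting along the powers of a root vertex expresses Gamma_n through one power of the root and n Schreier
  generators for each of the other vertices.  Each of the N - 1 tree edges contributes n relators; all but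
  one of these eliminate a generator.  What is left are N generators, N - 1 tree relators and n relators for
  each edge outside the tree.

  Efficiency: because Sigma has no triangles, for every edge {u,v} there are unipotent matrices over
  Z[t,t^-1] that commute for all edges except {u,v}.  Their corner entry gives conjugation invariant
  homomorphisms on the relation subgroup R that are dual to the relators, so R/[F,R] is free on the
  relators.  Hopf's formula then identifies H_2 and H_1 with the kernel and the cokernel of the abelianized
  relation matrix, and rank-nullity makes d(H_2) - rk(H_1) equal to the deficiency.
*)
theory Submission imports Defs Complex_Main "HOL-Library.Function_Algebras" begin

text \<open>Eliminating generators turns each surviving relator into a long word without closed
  form, so neither the isomorphism nor the duality of relators can be checked on relators directly.
  Both are checked through actions of the free group on the vertices, with a grade that follows the
  exponent sum modulo n. The elimination uses the commutation of a tree edge only at the levels 0,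
  ..., n-2. In any graded action with that much commutation, a word that is rewritten and then
  expanded again acts on states of grade 0 as the original word framed by powers of the root. This
  is applied twice: to right multiplication in the Artin group, for the isomorphism, and to the
  matrix action dual to the relator of {u,v} at level i. There u and v fail to commute exactly at
  level i modulo n, and since a tree edge keeps a relator only at level n-1, the elimination never
  meets the failure. Triangles matter for the matrices because a diagonal matrix for a common
  neighbour of u and v would have to be scalar and could not advance the grade.\<close>

lemma words_over_Nil [simp]: "[] \<in> words_over X"
  by (simp add: words_over_def)

lemma words_over_Cons [simp]: "l # w \<in> words_over X \<longleftrightarrow> fst l \<in> X \<and> w \<in> words_over X"
  by (auto simp: words_over_def)

declare words_over_append [simp]

lemma inv_word_Nil [simp]: "inv_word [] = []"
  by (simp add: inv_word_def)

lemma inv_word_Cons: "inv_word (l # w) = inv_word w @ [inv_letter l]"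
  by (simp add: inv_word_def)

lemma inv_word_append: "inv_word (u @ v) = inv_word v @ inv_word u"
  by (simp add: inv_word_def)

lemma inv_word_inv_word [simp]: "inv_word (inv_word w) = w"
  by (simp add: inv_word_def rev_map comp_def)

lemma inv_word_words_over_iff [simp]: "inv_word w \<in> words_over X \<longleftrightarrow> w \<in> words_over X"
  using inv_word_words_over[of w X] inv_word_words_over[of "inv_word w" X] by auto

lemma reduce_Nil [simp]: "reduce [] = []"
  by (simp add: reduce_def)

lemma reduce_Cons: "reduce (l # w) = cons_reduce l (reduce w)"
  by (simp add: reduce_def)

lemma reduce_inv_word_right: "reduce (w @ inv_word w) = []"
  using reduce_inv_word[of "inv_word w"] by simp

lemma carrier_free_group: "u \<in> carrier (free_group X) \<longleftrightarrow> u \<in> words_over X \<and> reduced u"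
  by (simp add: free_group_def)

lemma reduce_in_free_group: "w \<in> words_over X \<Longrightarrow> reduce w \<in> carrier (free_group X)"
  by (simp add: carrier_free_group reduced_reduce reduce_words_over)

lemma mult_free_group: "u \<otimes>\<^bsub>free_group X\<^esub> v = reduce (u @ v)"
  by (simp add: free_group_def)

lemma one_free_group: "\<one>\<^bsub>free_group X\<^esub> = []"
  by (simp add: free_group_def)

lemma inv_free_group:
  assumes "w \<in> words_over X"
  shows "inv\<^bsub>free_group X\<^esub> (reduce w) = reduce (inv_word w)"
proof -
  interpret group "free_group X" by (rule group_free_group)
  show ?thesis
    by (rule inv_equality)
       (use assms in \<open>auto simp: reduce_in_free_group mult_free_group one_free_group
          reduce_append_left reduce_append_right reduce_inv_word\<close>)
qed

section \<open>Cosets of the normal closure, represented by unreduced words\<close>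

section \<open>Words as elements of a presented group\<close>

text \<open>The word is reduced first, so that the class is defined for arbitrary words and turns
  concatenation into the product.\<close>

definition word_class :: "'a set \<Rightarrow> 'a word set \<Rightarrow> 'a word \<Rightarrow> 'a word set"
  where "word_class X R w = normal_closure (free_group X) (reduce ` R) #>\<^bsub>free_group X\<^esub> reduce w"

locale presented =
  fixes X :: "'a set" and R :: "'a word set"
  assumes relators_over: "R \<subseteq> words_over X"
begin

abbreviation "cl \<equiv> word_class X R"
abbreviation "Q \<equiv> presented_group X R"

sublocale F: group "free_group X" by (rule group_free_group)
sublocale NC: normal "normal_closure (free_group X) (reduce ` R)" "free_group X"
  by (rule normal_relators[OF relators_over])
sublocale Q: group Q by (rule group_presented_group[OF relators_over])

lemma carrier_presented: "carrier Q = cl ` words_over X"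
proof
  show "carrier Q \<subseteq> cl ` words_over X"
  proof
    fix x assume "x \<in> carrier Q"
    then obtain w where "w \<in> carrier (free_group X)"
      "x = normal_closure (free_group X) (reduce ` R) #>\<^bsub>free_group X\<^esub> w"
      by (auto simp: presented_group_def carrier_FactGroup)
    then show "x \<in> cl ` words_over X"
      by (intro image_eqI[of _ _ w]) (auto simp: word_class_def carrier_free_group reduce_reduced)
  qed
  show "cl ` words_over X \<subseteq> carrier Q"
    using reduce_in_free_group[of _ X] by (auto simp: word_class_def presented_group_def carrier_FactGroup)
qed

lemma cl_closed [simp]: "w \<in> words_over X \<Longrightarrow> cl w \<in> carrier Q"
  by (auto simp: carrier_presented)

lemma cl_append:
  "u \<in> words_over X \<Longrightarrow> v \<in> words_over X \<Longrightarrow> cl (u @ v) = cl u \<otimes>\<^bsub>Q\<^esub> cl v"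
  using reduce_append_left[of u v] reduce_append_right[of "reduce u" v] reduce_in_free_group[of _ X]
  by (simp add: word_class_def presented_group_def NC.rcos_sum mult_free_group)

lemma cl_reduce: "cl (reduce w) = cl w"
  by (simp add: word_class_def reduce_reduced reduced_reduce)

lemma cl_eq_one_iff:
  assumes "w \<in> words_over X"
  shows "cl w = \<one>\<^bsub>Q\<^esub> \<longleftrightarrow> reduce w \<in> normal_closure (free_group X) (reduce ` R)"
  unfolding word_class_def presented_group_def
  using F.coset_join1[OF _ _ NC.is_subgroup] F.coset_join2[OF _ NC.is_subgroup]
    reduce_in_free_group[OF assms] NC.subset
  by (metis FactGroup_def monoid.simps(2))

lemma cl_Nil [simp]: "cl [] = \<one>\<^bsub>Q\<^esub>"
  using NC.one_closed by (simp add: cl_eq_one_iff one_free_group)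

lemma cl_inv_word:
  assumes "w \<in> words_over X"
  shows "cl (inv_word w) = inv\<^bsub>Q\<^esub> (cl w)"
proof (rule Q.inv_equality[symmetric])
  have "cl (inv_word w @ w) = \<one>\<^bsub>Q\<^esub>"
    using cl_reduce[of "inv_word w @ w"] by (simp add: reduce_inv_word)
  then show "cl (inv_word w) \<otimes>\<^bsub>Q\<^esub> cl w = \<one>\<^bsub>Q\<^esub>"
    using assms by (simp add: cl_append)
qed (use assms in auto)

lemma cl_relator: "r \<in> R \<Longrightarrow> cl r = \<one>\<^bsub>Q\<^esub>"
proof -
  assume r: "r \<in> R"
  then have rw: "r \<in> words_over X" using relators_over by auto
  have "reduce r \<in> normal_closure (free_group X) (reduce ` R)"
    unfolding normal_closure_def
  proof (rule generate.incl)
    have "reduce r = \<one>\<^bsub>free_group X\<^esub> \<otimes>\<^bsub>free_group X\<^esub> reduce r \<otimes>\<^bsub>free_group X\<^esub> inv\<^bsub>free_group X\<^esub> \<one>\<^bsub>free_group X\<^esub>"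
      using reduce_in_free_group[OF rw] by simp
    then show "reduce r \<in> {g \<otimes>\<^bsub>free_group X\<^esub> r \<otimes>\<^bsub>free_group X\<^esub> inv\<^bsub>free_group X\<^esub> g |g r. g \<in> carrier (free_group X) \<and> r \<in> reduce ` R}"
      using r F.one_closed by blast
  qed
  then show ?thesis by (simp add: cl_eq_one_iff rw)
qed

text \<open>The cases mirror the generation of the normal closure by conjugates of relators, but for
  unreduced words; this is why the predicate has to be invariant under \<open>reduce\<close>.
  Homomorphisms on the relation subgroup are all controlled through this rule.\<close>

lemma trivial_word_induct [consumes 2, case_names reduce Nil append relator inverse]:
  assumes "cl w = \<one>\<^bsub>Q\<^esub>" "w \<in> words_over X"
    and red: "\<And>u. u \<in> words_over X \<Longrightarrow> P (reduce u) \<longleftrightarrow> P u"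
    and nil: "P []"
    and app: "\<And>u v. u \<in> words_over X \<Longrightarrow> v \<in> words_over X \<Longrightarrow> cl u = \<one>\<^bsub>Q\<^esub> \<Longrightarrow> cl v = \<one>\<^bsub>Q\<^esub> \<Longrightarrow> P u \<Longrightarrow> P v \<Longrightarrow> P (u @ v)"
    and rel: "\<And>g r. g \<in> words_over X \<Longrightarrow> r \<in> R \<Longrightarrow> P (g @ r @ inv_word g)"
    and inv: "\<And>u. u \<in> words_over X \<Longrightarrow> cl u = \<one>\<^bsub>Q\<^esub> \<Longrightarrow> P u \<Longrightarrow> P (inv_word u)"
  shows "P w"
proof -
  let ?F = "free_group X"
  let ?C = "{g \<otimes>\<^bsub>?F\<^esub> r \<otimes>\<^bsub>?F\<^esub> inv\<^bsub>?F\<^esub> g | g r. g \<in> carrier ?F \<and> r \<in> reduce ` R}"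
  \<comment> \<open>A generator of the normal closure is the reduction of an unreduced conjugate of
    an unreduced relator. The other conjuncts are what the induction needs in order to stay among
    reduced trivial words.\<close>
  have conj: "P x \<and> x \<in> words_over X \<and> reduced x \<and> cl x = \<one>\<^bsub>Q\<^esub>" if "x \<in> ?C" for x
  proof -
    from that obtain g r where g: "g \<in> carrier ?F" and r: "r \<in> R"
      and x: "x = g \<otimes>\<^bsub>?F\<^esub> reduce r \<otimes>\<^bsub>?F\<^esub> inv\<^bsub>?F\<^esub> g" by auto
    have gw: "g \<in> words_over X" "reduce g = g" using g by (auto simp: carrier_free_group reduce_reduced)
    have rw: "r \<in> words_over X" using r relators_over by auto
    have "inv\<^bsub>?F\<^esub> g = reduce (inv_word g)" using inv_free_group[OF gw(1)] gw(2) by simp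
    then have "x = reduce (reduce (g @ reduce r) @ reduce (inv_word g))"
      by (simp add: x mult_free_group)
    then have x2: "x = reduce (g @ r @ inv_word g)"
      by (metis append.assoc reduce_append_left reduce_append_right)
    have "cl (g @ r @ inv_word g) = \<one>\<^bsub>Q\<^esub>"
      using gw rw r by (simp add: cl_append cl_relator cl_inv_word)
    then show ?thesis
      using red[of "g @ r @ inv_word g"] rel[OF gw(1) r] gw rw
      by (simp add: x2 reduced_reduce reduce_words_over cl_reduce)
  qed
  have "reduce w \<in> generate ?F ?C"
    using assms(1,2) by (simp add: cl_eq_one_iff normal_closure_def)
  then have "P (reduce w) \<and> reduce w \<in> words_over X \<and> reduced (reduce w) \<and> cl (reduce w) = \<one>\<^bsub>Q\<^esub>"
  proof (induction rule: generate.induct)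
    case one then show ?case using nil by (simp add: one_free_group)
  next
    case (incl h) then show ?case using conj by blast
  next
    case (inv h)
    then have h: "P h" "h \<in> words_over X" "reduced h" "cl h = \<one>\<^bsub>Q\<^esub>" using conj by blast+
    then have "inv\<^bsub>?F\<^esub> h = reduce (inv_word h)"
      using inv_free_group[of h X] by (simp add: reduce_reduced)
    with h show ?case
      using red[of "inv_word h"] assms(7)[of h]
      by (simp add: reduced_reduce reduce_words_over cl_reduce cl_inv_word)
  next
    case (eng h1 h2)
    then show ?case
      using red[of "h1 @ h2"] app[of h1 h2]
      by (simp add: mult_free_group reduced_reduce reduce_words_over cl_reduce cl_append)
  qed
  then show ?thesis using red assms(2) by simp
qed

end

section \<open>Free-group actions as a substitute for homomorphisms out of a presentation\<close>

section \<open>Actions of words\<close>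

text \<open>The leftmost letter of a word acts first: \<^term>\<open>fold act\<close> is a right action.\<close>

definition letter_action :: "'a set \<Rightarrow> ('a \<times> bool \<Rightarrow> 's \<Rightarrow> 's) \<Rightarrow> 's set \<Rightarrow> bool"
  where "letter_action X act S \<longleftrightarrow>
    (\<forall>l x. fst l \<in> X \<longrightarrow> x \<in> S \<longrightarrow> act l x \<in> S \<and> act (inv_letter l) (act l x) = x)"

lemma letter_action_closed:
  "letter_action X act S \<Longrightarrow> w \<in> words_over X \<Longrightarrow> x \<in> S \<Longrightarrow> fold act w x \<in> S"
  by (induction w arbitrary: x) (auto simp: letter_action_def)

lemma fold_reduce:
  assumes "letter_action X act S" "w \<in> words_over X" "x \<in> S"
  shows "fold act (reduce w) x = fold act w x"
  using assms(2,3)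
proof (induction w arbitrary: x)
  case (Cons l w)
  have cancel: "act (inv_letter l) (act l y) = y" if "y \<in> S" for y
    using assms(1) Cons.prems that by (simp add: letter_action_def del: split_paired_All)
  have *: "fold act (cons_reduce l v) y = fold act (l # v) y" if "y \<in> S" for v y
    using cancel[OF that] by (cases v) auto
  have "act l x \<in> S"
    using assms(1) Cons.prems by (simp add: letter_action_def del: split_paired_All)
  then show ?case
    using * Cons by (simp add: reduce_Cons)
qed simp

lemma fold_inv_word:
  assumes "letter_action X act S" "w \<in> words_over X" "x \<in> S"
  shows "fold act (inv_word w) (fold act w x) = x"
  using fold_reduce[OF assms(1), of "w @ inv_word w" x] assms by (simp add: reduce_inv_word_right)

lemma fold_inv_word':
  assumes "letter_action X act S" "w \<in> words_over X" "x \<in> S"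
  shows "fold act w (fold act (inv_word w) x) = x"
  using fold_inv_word[OF assms(1), of "inv_word w" x] assms by simp

text \<open>The universal property of a presentation in the form used throughout: to see that a map
  on words descends to the presented group, let words act on the target and inspect the
  relators.\<close>

lemma (in presented) trivial_word_acts_trivially:
  assumes act: "letter_action X act S"
    and rel: "\<And>r x. r \<in> R \<Longrightarrow> x \<in> S \<Longrightarrow> fold act r x = x"
    and "cl w = \<one>\<^bsub>Q\<^esub>" "w \<in> words_over X" "x \<in> S"
  shows "fold act w x = x"
proof -
  have "\<forall>x\<in>S. fold act w x = x"
    using assms(3,4)
  proof (induction rule: trivial_word_induct)
    case (reduce u) then show ?case using fold_reduce[OF act] by simp
  next
    case (relator g r) then show ?case
      using fold_inv_word[OF act] letter_action_closed[OF act] rel by simp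
  next
    case (inverse u) then show ?case using fold_inv_word[OF act] by metis
  qed simp_all
  with assms(5) show ?thesis by blast
qed

lemma reduce_cancel: "reduce (a @ inv_word w @ w @ b) = reduce (a @ b)"
  by (metis append.assoc append_Nil reduce_append_left reduce_append_right reduce_inv_word)

lemma reduce_cancel': "reduce (a @ w @ inv_word w @ b) = reduce (a @ b)"
  using reduce_cancel[of a "inv_word w" b] by simp

text \<open>On relators its values are the columns of the relation matrix \<open>D\<close>.\<close>

definition abelianize :: "'a word \<Rightarrow> ('a \<Rightarrow>\<^sub>0 int)"
  where "abelianize w = (\<Sum>l\<leftarrow>w. if snd l then - frag_of (fst l) else frag_of (fst l))"

lemma abelianize_Nil [simp]: "abelianize [] = 0"
  by (simp add: abelianize_def)

lemma abelianize_Cons: "abelianize (l # w) = abelianize [l] + abelianize w"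
  by (simp add: abelianize_def)

lemma abelianize_append: "abelianize (u @ v) = abelianize u + abelianize v"
  by (simp add: abelianize_def)

lemma abelianize_inv_word: "abelianize (inv_word w) = - abelianize w"
  by (induction w) (auto simp: abelianize_def inv_word_def inv_letter_def)

lemma abelianize_reduce: "abelianize (reduce w) = abelianize w"
proof (induction w)
  case (Cons l w)
  have "abelianize (cons_reduce l v) = abelianize [l] + abelianize v" for v
    by (cases v) (auto simp: abelianize_def inv_letter_def)
  with Cons show ?case by (simp add: reduce_Cons abelianize_Cons[of l w])
qed simp

lemma keys_abelianize: "w \<in> words_over X \<Longrightarrow> Poly_Mapping.keys (abelianize w) \<subseteq> X"
proof (induction w)
  case (Cons l w)
  have "Poly_Mapping.keys (abelianize [l]) \<subseteq> X"
    using Cons.prems by (auto simp: abelianize_def)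
  with Cons show ?case
    using keys_add[of "abelianize [l]" "abelianize w"] by (auto simp: abelianize_Cons[of l w])
qed simp

section \<open>The bar complex in degrees one to three, modulo boundaries\<close>

section \<open>Low-dimensional bar chains\<close>

context group
begin

lemma mult_inv_cancel: "x \<in> carrier G \<Longrightarrow> y \<in> carrier G \<Longrightarrow> x \<otimes> (inv x \<otimes> y) = y"
  by (simp add: m_assoc[symmetric] r_inv)

lemma inv_mult_cancel: "x \<in> carrier G \<Longrightarrow> y \<in> carrier G \<Longrightarrow> inv x \<otimes> (x \<otimes> y) = y"
  by (simp add: m_assoc[symmetric])

lemma bar_boundary_1: "bar_boundary G (frag_of [g]) = 0"
  by (simp add: bar_boundary_def bar_face_def)

lemma bar_boundary_2:
  "bar_boundary G (frag_of [g, h]) = frag_of [h] - frag_of [g \<otimes> h] + frag_of [g]"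
  by (simp add: bar_boundary_def bar_face_def atMost_Suc numeral_2_eq_2 frag_cmul_minus_one)

lemma bar_boundary_3:
  "bar_boundary G (frag_of [g, h, k]) =
    frag_of [h, k] - frag_of [g \<otimes> h, k] + frag_of [g, h \<otimes> k] - frag_of [g, h]"
  by (simp add: bar_boundary_def bar_face_def atMost_Suc eval_nat_numeral frag_cmul_minus_one)

lemma bar_boundary_add: "bar_boundary G (a + b) = bar_boundary G a + bar_boundary G b"
  by (simp add: bar_boundary_def frag_extend_add)

lemma bar_boundary_diff: "bar_boundary G (a - b) = bar_boundary G a - bar_boundary G b"
  by (simp add: bar_boundary_def frag_extend_diff)

lemma bar_boundary_minus: "bar_boundary G (- a) = - bar_boundary G a"
  by (simp add: bar_boundary_def frag_extend_minus)

lemma bar_boundary_cmul: "bar_boundary G (frag_cmul c a) = frag_cmul c (bar_boundary G a)"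
  by (simp add: bar_boundary_def frag_extend_cmul)

lemma bar_boundary_0: "bar_boundary G 0 = 0"
  by (simp add: bar_boundary_def)

lemma bar_chains_add: "a \<in> carrier (bar_chains G k) \<Longrightarrow> b \<in> carrier (bar_chains G k) \<Longrightarrow> a + b \<in> carrier (bar_chains G k)"
  using keys_add[of a b] by (simp add: bar_chains_def) blast

lemma bar_chains_diff: "a \<in> carrier (bar_chains G k) \<Longrightarrow> b \<in> carrier (bar_chains G k) \<Longrightarrow> a - b \<in> carrier (bar_chains G k)"
  using keys_diff[of a b] by (simp add: bar_chains_def) blast

lemma bar_chains_minus: "a \<in> carrier (bar_chains G k) \<Longrightarrow> - a \<in> carrier (bar_chains G k)"
  by (auto simp: bar_chains_def)

lemma bar_chains_cmul: "a \<in> carrier (bar_chains G k) \<Longrightarrow> frag_cmul c a \<in> carrier (bar_chains G k)"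
  using keys_cmul[of c a] by (auto simp: bar_chains_def)

lemma bar_chains_0: "0 \<in> carrier (bar_chains G k)"
  by (auto simp: bar_chains_def)

lemma bar_chains_frag_of: "frag_of gs \<in> carrier (bar_chains G k) \<longleftrightarrow> length gs = k \<and> set gs \<subseteq> carrier G"
  by (auto simp: bar_chains_def)

lemmas bar_chains_closed = bar_chains_add bar_chains_diff bar_chains_minus bar_chains_cmul bar_chains_0

lemma bar_boundaries_add: "a \<in> bar_boundaries G k \<Longrightarrow> b \<in> bar_boundaries G k \<Longrightarrow> a + b \<in> bar_boundaries G k"
  unfolding bar_boundaries_def image_iff by (metis bar_chains_add bar_boundary_add)

lemma bar_boundaries_diff: "a \<in> bar_boundaries G k \<Longrightarrow> b \<in> bar_boundaries G k \<Longrightarrow> a - b \<in> bar_boundaries G k"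
  unfolding bar_boundaries_def image_iff by (metis bar_chains_diff bar_boundary_diff)

lemma bar_boundaries_minus: "a \<in> bar_boundaries G k \<Longrightarrow> - a \<in> bar_boundaries G k"
  unfolding bar_boundaries_def image_iff by (metis bar_chains_minus bar_boundary_minus)

lemma bar_boundaries_cmul: "a \<in> bar_boundaries G k \<Longrightarrow> frag_cmul c a \<in> bar_boundaries G k"
  unfolding bar_boundaries_def image_iff by (metis bar_chains_cmul bar_boundary_cmul)

lemma bar_boundaries_0: "0 \<in> bar_boundaries G k"
  unfolding bar_boundaries_def image_iff by (metis bar_chains_0 bar_boundary_0)

lemmas bar_boundaries_closed = bar_boundaries_add bar_boundaries_diff bar_boundaries_minus
  bar_boundaries_cmul bar_boundaries_0

lemma bar_chain_induct [consumes 1, case_names zero one diff]: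
  assumes "c \<in> carrier (bar_chains G k)" "P 0"
    "\<And>gs. length gs = k \<Longrightarrow> set gs \<subseteq> carrier G \<Longrightarrow> P (frag_of gs)"
    "\<And>a b. P a \<Longrightarrow> P b \<Longrightarrow> P (a - b)"
  shows "P c"
  by (rule frag_induction[where S = "{gs. length gs = k \<and> set gs \<subseteq> carrier G}"])
     (use assms in \<open>auto simp: bar_chains_def\<close>)

text \<open>Modulo boundaries this is the associativity law for the symbols [g|h]. The later
  congruences between 2-chains are sums of instances of it and of the degenerate cases that
  follow.\<close>

lemma boundary3_in_boundaries:
  "g \<in> carrier G \<Longrightarrow> h \<in> carrier G \<Longrightarrow> k \<in> carrier G \<Longrightarrow>
    frag_of [h, k] - frag_of [g \<otimes> h, k] + frag_of [g, h \<otimes> k] - frag_of [g, h] \<in> bar_boundaries G 2"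
  unfolding bar_boundaries_def image_iff
  by (rule bexI[of _ "frag_of [g, h, k]"]) (auto simp: bar_boundary_3 bar_chains_frag_of)

text \<open>The bar complex is not normalised, so [1|g] does not vanish; it only agrees with [1|1]
  up to the boundary of [1|1|g]. Hence the correction terms [1|1] below.\<close>

lemma bar_one_left: "g \<in> carrier G \<Longrightarrow> frag_of [\<one>, g] - frag_of [\<one>, \<one>] \<in> bar_boundaries G 2"
  using boundary3_in_boundaries[of \<one> \<one> g] by simp

lemma bar_one_right: "g \<in> carrier G \<Longrightarrow> frag_of [g, \<one>] - frag_of [\<one>, \<one>] \<in> bar_boundaries G 2"
  using bar_boundaries_minus[OF boundary3_in_boundaries[of g \<one> \<one>]] by simp

text \<open>This is the boundary of [g|g^-1|g] after its two degenerate faces have been replaced by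
  [1|1].\<close>

lemma bar_inverses:
  assumes "g \<in> carrier G"
  shows "frag_of [inv g, g] - frag_of [g, inv g] \<in> bar_boundaries G 2"
proof -
  have "frag_of [inv g, g] - frag_of [g, inv g] =
    (frag_of [inv g, g] - frag_of [g \<otimes> inv g, g] + frag_of [g, inv g \<otimes> g] - frag_of [g, inv g])
    + (frag_of [\<one>, g] - frag_of [\<one>, \<one>]) - (frag_of [g, \<one>] - frag_of [\<one>, \<one>])"
    using assms by simp
  also have "\<dots> \<in> bar_boundaries G 2"
    by (intro bar_boundaries_closed boundary3_in_boundaries bar_one_left bar_one_right) (use assms in auto)
  finally show ?thesis .
qed

end

section \<open>Comparison of bar chains with the relation module\<close>

section \<open>A version of Hopf's formula\<close>

text \<open>The map \<open>\<rho>\<close> is a left inverse of the surjection from integer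
  combinations of relators onto the relation module R/[F,R]; it is constrained only on words that
  are trivial in G. The group is reached through \<open>h\<close> and need not be the quotient
  itself, so that homology is computed for G directly and not transported along an
  isomorphism.\<close>

locale independent_presentation = presented "{..<N}" "set rs" + group G
  for N :: nat and rs :: "nat word list" and G (structure) +
  fixes h :: "nat word \<Rightarrow> 'b" and \<rho> :: "nat word \<Rightarrow> (nat \<Rightarrow>\<^sub>0 int)"
  assumes h_append: "u \<in> words_over {..<N} \<Longrightarrow> v \<in> words_over {..<N} \<Longrightarrow> h (u @ v) = h u \<otimes> h v"
    and h_onto: "h ` words_over {..<N} = carrier G"
    and h_one_iff: "w \<in> words_over {..<N} \<Longrightarrow> h w = \<one> \<longleftrightarrow> cl w = \<one>\<^bsub>Q\<^esub>"
    and rho_reduce: "w \<in> words_over {..<N} \<Longrightarrow> h w = \<one> \<Longrightarrow> \<rho> (reduce w) = \<rho> w"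
    and rho_append: "u \<in> words_over {..<N} \<Longrightarrow> v \<in> words_over {..<N} \<Longrightarrow> h u = \<one> \<Longrightarrow> h v = \<one> \<Longrightarrow>
      \<rho> (u @ v) = \<rho> u + \<rho> v"
    and rho_conj: "w \<in> words_over {..<N} \<Longrightarrow> u \<in> words_over {..<N} \<Longrightarrow> h u = \<one> \<Longrightarrow>
      \<rho> (w @ u @ inv_word w) = \<rho> u"
    and rho_relator: "j < length rs \<Longrightarrow> \<rho> (rs ! j) = frag_of j"
begin

abbreviation "W \<equiv> words_over {..<N}"
abbreviation "B1 \<equiv> bar_boundaries G 1"
abbreviation "B2 \<equiv> bar_boundaries G 2"

lemma h_closed [simp]: "w \<in> W \<Longrightarrow> h w \<in> carrier G"
  using h_onto by auto

lemma h_Nil [simp]: "h [] = \<one>"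
  by (simp add: h_one_iff)

lemma h_inv_word: "w \<in> W \<Longrightarrow> h (inv_word w) = inv (h w)"
proof -
  assume w: "w \<in> W"
  have "cl (inv_word w @ w) = \<one>\<^bsub>Q\<^esub>" using w by (simp add: cl_append cl_inv_word)
  then have "h (inv_word w) \<otimes> h w = \<one>" using w h_one_iff[of "inv_word w @ w"] by (simp add: h_append)
  then show ?thesis using w by (intro inv_equality[symmetric]) auto
qed

lemma h_Cons: "fst l < N \<Longrightarrow> w \<in> W \<Longrightarrow> h (l # w) = h [l] \<otimes> h w"
  using h_append[of "[l]" w] by simp

lemma h_inv_letter: "fst l < N \<Longrightarrow> h [inv_letter l] = inv (h [l])"
  using h_inv_word[of "[l]"] by (simp add: inv_word_def)

lemma h_eqI:
  assumes "u \<in> W" "v \<in> W" "reduce u = reduce v"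
  shows "h u = h v"
proof -
  have "cl u = cl v" using assms cl_reduce by metis
  then have "cl (u @ inv_word v) = \<one>\<^bsub>Q\<^esub>" using assms by (simp add: cl_append cl_inv_word)
  then have "h u \<otimes> inv (h v) = \<one>" using assms h_one_iff[of "u @ inv_word v"] by (simp add: h_append h_inv_word)
  then show ?thesis using assms inv_equality[of "h u" "inv (h v)"] by simp
qed

lemma h_reduce: "w \<in> W \<Longrightarrow> h (reduce w) = h w"
  by (rule h_eqI) (auto simp: reduce_words_over reduce_reduced reduced_reduce)

lemma rho_cong:
  assumes "u \<in> W" "v \<in> W" "h u = \<one>" "reduce u = reduce v"
  shows "\<rho> u = \<rho> v"
  using rho_reduce[OF assms(1,3)] rho_reduce[OF assms(2)] h_eqI[OF assms(1,2,4)] assms(3,4) by simp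

lemma rho_Nil [simp]: "\<rho> [] = 0"
  using rho_append[of "[]" "[]"] by simp

lemma rho_inv_word:
  assumes "u \<in> W" "h u = \<one>"
  shows "\<rho> (inv_word u) = - \<rho> u"
proof -
  have "\<rho> u + \<rho> (inv_word u) = \<rho> (u @ inv_word u)"
    using assms by (simp add: rho_append h_inv_word)
  also have "\<dots> = \<rho> []"
    by (rule rho_cong) (use assms in \<open>auto simp: h_append h_inv_word reduce_inv_word_right\<close>)
  finally show ?thesis using minus_unique[of "\<rho> u" "\<rho> (inv_word u)"] by simp
qed

lemma relator_in_W: "r \<in> set rs \<Longrightarrow> r \<in> W"
  using relators_over by auto

lemma h_relator: "r \<in> set rs \<Longrightarrow> h r = \<one>"
  using cl_relator h_one_iff relator_in_W by simp

lemma trivial_induct [consumes 2, case_names reduce Nil append relator inverse]: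
  assumes "h w = \<one>" "w \<in> W"
    and red: "\<And>u. u \<in> W \<Longrightarrow> h u = \<one> \<Longrightarrow> P (reduce u) \<longleftrightarrow> P u"
    and nil: "P []"
    and app: "\<And>u v. u \<in> W \<Longrightarrow> v \<in> W \<Longrightarrow> h u = \<one> \<Longrightarrow> h v = \<one> \<Longrightarrow> P u \<Longrightarrow> P v \<Longrightarrow> P (u @ v)"
    and rel: "\<And>g j. g \<in> W \<Longrightarrow> j < length rs \<Longrightarrow> P (g @ rs ! j @ inv_word g)"
    and inv: "\<And>u. u \<in> W \<Longrightarrow> h u = \<one> \<Longrightarrow> P u \<Longrightarrow> P (inv_word u)"
  shows "P w"
proof -
  have "cl w = \<one>\<^bsub>Q\<^esub>" using assms h_one_iff by simp
  from this assms(2) have "h w = \<one> \<longrightarrow> P w"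
  proof (induction rule: trivial_word_induct)
    case (reduce u) then show ?case using red h_reduce by simp
  next
    case (append u v) then show ?case using app h_one_iff by (simp add: h_append)
  next
    case (relator g r)
    then obtain j where "j < length rs" "r = rs ! j" by (auto simp: in_set_conv_nth)
    with relator show ?case using rel by simp
  next
    case (inverse u) then show ?case using inv h_one_iff by simp
  qed (use nil in simp)
  with assms(1) show ?thesis by simp
qed

text \<open>The relation matrix, from relator coordinates to generator coordinates. Its kernel
  becomes H_2 and its cokernel H_1.\<close>

definition D :: "(nat \<Rightarrow>\<^sub>0 int) \<Rightarrow> (nat \<Rightarrow>\<^sub>0 int)"
  where "D = frag_extend (\<lambda>j. abelianize (rs ! j))"

text \<open>Both sides are additive on trivial words, ignore conjugation and agree on
  relators.\<close>

lemma D_rho: "h w = \<one> \<Longrightarrow> w \<in> W \<Longrightarrow> D (\<rho> w) = abelianize w"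
proof (induction rule: trivial_induct)
  case (reduce u) then show ?case by (simp add: rho_reduce abelianize_reduce)
next
  case (append u v) then show ?case by (simp add: rho_append abelianize_append D_def frag_extend_add)
next
  case (relator g j)
  then show ?case
    by (simp add: rho_conj relator_in_W h_relator rho_relator D_def abelianize_append abelianize_inv_word)
next
  case (inverse u) then show ?case by (simp add: rho_inv_word abelianize_inv_word D_def frag_extend_minus)
qed (simp add: D_def)

lemma keys_rho: "h w = \<one> \<Longrightarrow> w \<in> W \<Longrightarrow> Poly_Mapping.keys (\<rho> w) \<subseteq> {..<length rs}"
proof (induction rule: trivial_induct)
  case (reduce u) then show ?case by (simp add: rho_reduce)
next
  case (append u v) then show ?case using keys_add[of "\<rho> u" "\<rho> v"] by (auto simp: rho_append)
next
  case (relator g j) then show ?case by (simp add: rho_conj relator_in_W h_relator rho_relator)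
next
  case (inverse u) then show ?case by (simp add: rho_inv_word)
qed simp

text \<open>The degree-one part of the comparison from the presentation to bar chains.\<close>

definition \<Lambda> :: "(nat \<Rightarrow>\<^sub>0 int) \<Rightarrow> ('b list \<Rightarrow>\<^sub>0 int)"
  where "\<Lambda> = frag_extend (\<lambda>x. frag_of [h [(x, False)]])"

text \<open>A positive letter needs no correction. For an inverse letter the boundary of this chain
  is -[x] - [x^-1], which is the difference between \<open>\<Lambda>\<close> of the abelianised
  letter and the bar symbol of its value.\<close>

definition letter_chain :: "nat \<times> bool \<Rightarrow> ('b list \<Rightarrow>\<^sub>0 int)"
  where "letter_chain l = (if snd l
    then - frag_of [\<one>, \<one>] - frag_of [h [(fst l, False)], h [(fst l, True)]] else 0)"

text \<open>Up to boundaries, \<open>\<sigma> (u @ v) = \<sigma> u + \<sigma> v + [h u|h v]\<close>.\<close>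

primrec \<sigma> :: "nat word \<Rightarrow> ('b list \<Rightarrow>\<^sub>0 int)"
  where
    "\<sigma> [] = - frag_of [\<one>, \<one>]"
  | "\<sigma> (l # w) = letter_chain l + \<sigma> w + frag_of [h [l], h w]"

lemma letter_chain_chains: "fst l < N \<Longrightarrow> letter_chain l \<in> carrier (bar_chains G 2)"
  unfolding letter_chain_def by (auto intro!: bar_chains_closed simp: bar_chains_frag_of)

lemma sigma_chains: "w \<in> W \<Longrightarrow> \<sigma> w \<in> carrier (bar_chains G 2)"
  by (induction w) (auto intro!: bar_chains_closed letter_chain_chains simp: bar_chains_frag_of)

lemma boundary_letter_chain:
  "fst l < N \<Longrightarrow> bar_boundary G (letter_chain l) = \<Lambda> (abelianize [l]) - frag_of [h [l]]"
  using h_inv_letter[of "(fst l, False)"]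
  by (cases l) (auto simp: letter_chain_def bar_boundary_diff bar_boundary_minus bar_boundary_2 bar_boundary_0
      \<Lambda>_def abelianize_def frag_extend_minus inv_letter_def)

text \<open>So \<open>\<sigma> w\<close> is a fan of triangles between the signed letters of w and
  the single edge \<open>h w\<close>.\<close>

lemma boundary_sigma: "w \<in> W \<Longrightarrow> bar_boundary G (\<sigma> w) = \<Lambda> (abelianize w) - frag_of [h w]"
proof (induction w)
  case (Cons l w)
  then show ?case
    by (simp add: bar_boundary_add boundary_letter_chain bar_boundary_2 h_Cons[of l w] abelianize_Cons[of l w]
        \<Lambda>_def frag_extend_add)
qed (simp add: bar_boundary_minus bar_boundary_2 \<Lambda>_def)

text \<open>Putting a letter l in front of u changes the difference by the boundary of
  [h l|h u|h v].\<close>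

lemma sigma_append:
  assumes "u \<in> W" "v \<in> W"
  shows "\<sigma> (u @ v) - (\<sigma> u + \<sigma> v + frag_of [h u, h v]) \<in> B2"
  using assms(1)
proof (induction u)
  case Nil
  then show ?case using bar_boundaries_minus[OF bar_one_left[of "h v"]] assms by simp
next
  case (Cons l u)
  have "\<sigma> ((l # u) @ v) - (\<sigma> (l # u) + \<sigma> v + frag_of [h (l # u), h v]) =
    (\<sigma> (u @ v) - (\<sigma> u + \<sigma> v + frag_of [h u, h v])) +
    (frag_of [h u, h v] - frag_of [h [l] \<otimes> h u, h v] + frag_of [h [l], h u \<otimes> h v] - frag_of [h [l], h u])"
    using Cons assms by (simp add: h_Cons[of l u] h_append[of u v])
  also have "\<dots> \<in> B2"
    by (intro bar_boundaries_closed boundary3_in_boundaries Cons) (use Cons assms in auto)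
  finally show ?case .
qed

text \<open>For a positive letter the sum cancels identically. For an inverse letter the symbols
  [x|x^-1] and [x^-1|x] have to be exchanged.\<close>

lemma letter_chain_inverse:
  assumes "fst l < N"
  shows "letter_chain l + letter_chain (inv_letter l) + frag_of [h [l], h [inv_letter l]] + frag_of [\<one>, \<one>] \<in> B2"
proof (cases "snd l")
  case False
  then have "l = (fst l, False)" by (cases l) auto
  then show ?thesis
    using bar_boundaries_0[of 2] by (cases l) (simp add: letter_chain_def inv_letter_def)
next
  case True
  then obtain x where l: "l = (x, True)" by (cases l) auto
  have "h [(x, True)] = inv (h [(x, False)])"
    using h_inv_letter[of "(x, False)"] assms l by (simp add: inv_letter_def)
  then show ?thesis
    using bar_inverses[of "h [(x, False)]"] assms l
    by (simp add: letter_chain_def inv_letter_def)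
qed

lemma sigma_cancel:
  assumes "fst l < N" "w \<in> W"
  shows "\<sigma> (l # inv_letter l # w) - \<sigma> w \<in> B2"
proof -
  have hl: "h [inv_letter l] = inv (h [l])" "h [l] \<in> carrier G" "h w \<in> carrier G"
    using h_inv_letter assms by auto
  have hw: "h (inv_letter l # w) = h [inv_letter l] \<otimes> h w"
    using assms h_Cons[of "inv_letter l" w] by simp
  have "\<sigma> (l # inv_letter l # w) - \<sigma> w =
    (letter_chain l + letter_chain (inv_letter l) + frag_of [h [l], h [inv_letter l]] + frag_of [\<one>, \<one>])
    + (frag_of [h [inv_letter l], h w] - frag_of [h [l] \<otimes> h [inv_letter l], h w]
        + frag_of [h [l], h [inv_letter l] \<otimes> h w] - frag_of [h [l], h [inv_letter l]])
    + (frag_of [\<one>, h w] - frag_of [\<one>, \<one>])"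
    using hl by (simp add: hw)
  also have "\<dots> \<in> B2"
    by (intro bar_boundaries_closed boundary3_in_boundaries letter_chain_inverse bar_one_left)
       (use hl assms in auto)
  finally show ?thesis .
qed

lemma sigma_reduce: "w \<in> W \<Longrightarrow> \<sigma> (reduce w) - \<sigma> w \<in> B2"
proof (induction w)
  case (Cons l w)
  let ?v = "reduce w"
  have v: "?v \<in> W" "h ?v = h w" using Cons by (auto simp: reduce_words_over h_reduce)
  have 1: "\<sigma> (cons_reduce l ?v) - \<sigma> (l # ?v) \<in> B2"
  proof (cases ?v)
    case Nil then show ?thesis using bar_boundaries_0 by simp
  next
    case (Cons m v')
    have "m = inv_letter l \<Longrightarrow> \<sigma> v' - \<sigma> (l # m # v') \<in> B2"
      using bar_boundaries_minus[OF sigma_cancel[of l v']] Cons.prems v Cons \<open>l # w \<in> W\<close> by simp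
    then show ?thesis using Cons bar_boundaries_0[of 2] by simp
  qed
  have eq: "\<sigma> (reduce (l # w)) - \<sigma> (l # w) = (\<sigma> (cons_reduce l ?v) - \<sigma> (l # ?v)) + (\<sigma> ?v - \<sigma> w)"
    using v by (simp add: reduce_Cons)
  show ?case unfolding eq by (rule bar_boundaries_add[OF 1]) (use Cons in auto)
qed (simp add: bar_boundaries_0)

lemma sigma_inverse:
  assumes "w \<in> W"
  shows "\<sigma> w + \<sigma> (inv_word w) + frag_of [h w, h (inv_word w)] + frag_of [\<one>, \<one>] \<in> B2"
proof -
  have "\<sigma> w + \<sigma> (inv_word w) + frag_of [h w, h (inv_word w)] + frag_of [\<one>, \<one>] =
    - ((\<sigma> (w @ inv_word w) - (\<sigma> w + \<sigma> (inv_word w) + frag_of [h w, h (inv_word w)]))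
      + (\<sigma> (reduce (w @ inv_word w)) - \<sigma> (w @ inv_word w)))"
    by (simp add: reduce_inv_word_right)
  also have "\<dots> \<in> B2"
    by (intro bar_boundaries_closed sigma_append sigma_reduce) (use assms in auto)
  finally show ?thesis .
qed

text \<open>The conjugating word and its inverse cancel by \<open>sigma_inverse\<close>; as r is
  trivial in G, what remains is a symbol with first entry 1.\<close>

lemma sigma_conj:
  assumes "w \<in> W" "r \<in> W" "h r = \<one>"
  shows "\<sigma> (w @ r @ inv_word w) - \<sigma> r \<in> B2"
proof -
  have "\<sigma> (w @ r @ inv_word w) - \<sigma> r =
     (\<sigma> (w @ (r @ inv_word w)) - (\<sigma> w + \<sigma> (r @ inv_word w) + frag_of [h w, h (r @ inv_word w)]))
   + (\<sigma> (r @ inv_word w) - (\<sigma> r + \<sigma> (inv_word w) + frag_of [h r, h (inv_word w)]))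
   + (\<sigma> w + \<sigma> (inv_word w) + frag_of [h w, h (inv_word w)] + frag_of [\<one>, \<one>])
   + (frag_of [\<one>, h (inv_word w)] - frag_of [\<one>, \<one>])"
    using assms by (simp add: h_append)
  also have "\<dots> \<in> B2"
    by (intro bar_boundaries_closed sigma_append sigma_inverse bar_one_left) (use assms in auto)
  finally show ?thesis .
qed

text \<open>The chain \<open>\<sigma>\<close> of a relator has the edge [1] left over in its
  boundary. Since [1|1] has boundary [1], adding it makes \<open>\<gamma>\<close> the degree-two
  part of a chain map over \<open>\<Lambda>\<close>.\<close>

definition \<gamma> :: "(nat \<Rightarrow>\<^sub>0 int) \<Rightarrow> ('b list \<Rightarrow>\<^sub>0 int)"
  where "\<gamma> = frag_extend (\<lambda>j. \<sigma> (rs ! j) + frag_of [\<one>, \<one>])"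

text \<open>Modulo boundaries both terms are additive and conjugation invariant on trivial words,
  and they agree on relators.\<close>

lemma gamma_rho: "h r = \<one> \<Longrightarrow> r \<in> W \<Longrightarrow> \<sigma> r + frag_of [\<one>, \<one>] - \<gamma> (\<rho> r) \<in> B2"
proof (induction rule: trivial_induct)
  case (reduce u)
  have "\<sigma> (reduce u) - \<sigma> u \<in> B2" using reduce by (rule_tac sigma_reduce)
  moreover have "\<sigma> (reduce u) + frag_of [\<one>, \<one>] - \<gamma> (\<rho> u) = (\<sigma> u + frag_of [\<one>, \<one>] - \<gamma> (\<rho> u)) + (\<sigma> (reduce u) - \<sigma> u)"
    "\<sigma> u + frag_of [\<one>, \<one>] - \<gamma> (\<rho> u) = (\<sigma> (reduce u) + frag_of [\<one>, \<one>] - \<gamma> (\<rho> u)) - (\<sigma> (reduce u) - \<sigma> u)"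
    by simp_all
  ultimately show ?case using reduce by (metis rho_reduce bar_boundaries_add bar_boundaries_diff)
next
  case Nil then show ?case by (simp add: bar_boundaries_0 \<gamma>_def)
next
  case (append u v)
  have "\<sigma> (u @ v) + frag_of [\<one>, \<one>] - \<gamma> (\<rho> (u @ v)) =
    (\<sigma> (u @ v) - (\<sigma> u + \<sigma> v + frag_of [h u, h v])) + (\<sigma> u + frag_of [\<one>, \<one>] - \<gamma> (\<rho> u)) + (\<sigma> v + frag_of [\<one>, \<one>] - \<gamma> (\<rho> v))"
    using append by (simp add: rho_append \<gamma>_def frag_extend_add)
  also have "\<dots> \<in> B2" by (intro bar_boundaries_closed sigma_append append)
  finally show ?case .
next
  case (relator g j)
  then have r: "rs ! j \<in> W" "h (rs ! j) = \<one>" by (auto simp: relator_in_W h_relator)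
  have eq: "\<sigma> (g @ rs ! j @ inv_word g) + frag_of [\<one>, \<one>] - \<gamma> (\<rho> (g @ rs ! j @ inv_word g)) =
     \<sigma> (g @ rs ! j @ inv_word g) - \<sigma> (rs ! j)"
    using relator r by (simp add: rho_conj rho_relator \<gamma>_def)
  show ?case unfolding eq by (rule sigma_conj[OF relator(1) r])
next
  case (inverse u)
  have "\<sigma> (inv_word u) + frag_of [\<one>, \<one>] - \<gamma> (\<rho> (inv_word u)) =
     (\<sigma> u + \<sigma> (inv_word u) + frag_of [h u, h (inv_word u)] + frag_of [\<one>, \<one>]) - (\<sigma> u + frag_of [\<one>, \<one>] - \<gamma> (\<rho> u))"
    using inverse by (simp add: rho_inv_word \<gamma>_def frag_extend_minus h_inv_word)
  also have "\<dots> \<in> B2" by (intro bar_boundaries_closed sigma_inverse inverse)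
  finally show ?case .
qed

lemma boundary_gamma: "Poly_Mapping.keys k \<subseteq> {..<length rs} \<Longrightarrow> bar_boundary G (\<gamma> k) = \<Lambda> (D k)"
proof (induction k rule: frag_induction)
  case (one j)
  then have r: "rs ! j \<in> W" "h (rs ! j) = \<one>" by (auto simp: relator_in_W h_relator)
  then show ?case by (simp add: \<gamma>_def D_def bar_boundary_add boundary_sigma bar_boundary_2)
qed (simp_all add: \<gamma>_def \<Lambda>_def D_def bar_boundary_0 frag_extend_diff bar_boundary_diff)

lemma gamma_chains: "Poly_Mapping.keys k \<subseteq> {..<length rs} \<Longrightarrow> \<gamma> k \<in> carrier (bar_chains G 2)"
proof (induction k rule: frag_induction)
  case (one j)
  then show ?case by (auto simp: \<gamma>_def relator_in_W bar_chains_frag_of intro!: bar_chains_closed sigma_chains)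
qed (auto simp: \<gamma>_def frag_extend_diff intro: bar_chains_closed)

text \<open>A set-theoretic section of \<open>h\<close>. It is not normalised at 1, which is where
  the terms in \<open>wd \<one>\<close> below come from.\<close>

definition wd :: "'b \<Rightarrow> nat word"
  where "wd g = (SOME w. w \<in> W \<and> h w = g)"

lemma wd: "g \<in> carrier G \<Longrightarrow> wd g \<in> W" "g \<in> carrier G \<Longrightarrow> h (wd g) = g"
proof -
  assume "g \<in> carrier G"
  then have "g \<in> h ` W" using h_onto by simp
  then have "\<exists>w. w \<in> W \<and> h w = g" by auto
  from someI_ex[OF this] show "wd g \<in> W" "h (wd g) = g" by (auto simp: wd_def)
qed

text \<open>The factor set of the extension of G by the relation subgroup, read in relator
  coordinates.\<close>

definition cocycle :: "'b \<Rightarrow> 'b \<Rightarrow> (nat \<Rightarrow>\<^sub>0 int)"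
  where "cocycle g k = \<rho> (wd g @ wd k @ inv_word (wd (g \<otimes> k)))"

definition \<phi> :: "('b list \<Rightarrow>\<^sub>0 int) \<Rightarrow> (nat \<Rightarrow>\<^sub>0 int)"
  where "\<phi> = frag_extend (\<lambda>gs. cocycle (gs ! 0) (gs ! 1))"

lemma phi_frag_of [simp]: "\<phi> (frag_of [g, k]) = cocycle g k"
  by (simp add: \<phi>_def)

lemma phi_add: "\<phi> (a + b) = \<phi> a + \<phi> b" and phi_diff: "\<phi> (a - b) = \<phi> a - \<phi> b"
  and phi_minus: "\<phi> (- a) = - \<phi> a" and phi_0 [simp]: "\<phi> 0 = 0"
  by (simp_all add: \<phi>_def frag_extend_add frag_extend_diff frag_extend_minus)

lemma cocycle_word:
  "g \<in> carrier G \<Longrightarrow> k \<in> carrier G \<Longrightarrow>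
    wd g @ wd k @ inv_word (wd (g \<otimes> k)) \<in> W \<and> h (wd g @ wd k @ inv_word (wd (g \<otimes> k))) = \<one>"
  by (simp add: wd h_append h_inv_word r_inv mult_inv_cancel inv_mult_cancel m_assoc[symmetric])

text \<open>Both ways of bracketing compare \<open>wd g @ wd k @ wd l\<close> with the chosen word
  for the triple product. One of them carries a conjugation by \<open>wd g\<close>, which
  \<open>\<rho>\<close> ignores; this is why trivial coefficients suffice.\<close>

lemma cocycle_identity:
  assumes "g \<in> carrier G" "k \<in> carrier G" "l \<in> carrier G"
  shows "cocycle k l - cocycle (g \<otimes> k) l + cocycle g (k \<otimes> l) - cocycle g k = 0"
proof -
  let ?kl = "wd k @ wd l @ inv_word (wd (k \<otimes> l))"
  let ?x = "wd g @ wd k @ wd l @ inv_word (wd (g \<otimes> (k \<otimes> l)))"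
  have "cocycle k l + cocycle g (k \<otimes> l) = \<rho> (wd g @ ?kl @ inv_word (wd g)) + cocycle g (k \<otimes> l)"
    using assms cocycle_word[of k l] rho_conj[of "wd g" ?kl] by (simp add: cocycle_def wd)
  also have "\<dots> = \<rho> ((wd g @ ?kl @ inv_word (wd g)) @ (wd g @ wd (k \<otimes> l) @ inv_word (wd (g \<otimes> (k \<otimes> l)))))"
    unfolding cocycle_def
    by (rule rho_append[symmetric])
       (use assms in \<open>auto simp: wd h_append h_inv_word r_inv mult_inv_cancel inv_mult_cancel m_assoc inv_mult_group\<close>)
  also have "\<dots> = \<rho> ?x"
  proof (rule rho_cong)
    have "reduce ((wd g @ wd k @ wd l @ inv_word (wd (k \<otimes> l))) @ inv_word (wd g) @ wd g @ (wd (k \<otimes> l) @ inv_word (wd (g \<otimes> (k \<otimes> l)))))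
      = reduce ((wd g @ wd k @ wd l) @ inv_word (wd (k \<otimes> l)) @ wd (k \<otimes> l) @ inv_word (wd (g \<otimes> (k \<otimes> l))))"
      by (subst reduce_cancel) simp
    also have "\<dots> = reduce ?x" by (subst reduce_cancel) simp
    finally show "reduce ((wd g @ ?kl @ inv_word (wd g)) @ (wd g @ wd (k \<otimes> l) @ inv_word (wd (g \<otimes> (k \<otimes> l))))) = reduce ?x"
      by simp
  qed (use assms in \<open>auto simp: wd h_append h_inv_word r_inv mult_inv_cancel inv_mult_cancel m_assoc inv_mult_group\<close>)
  also have "\<dots> = \<rho> ((wd g @ wd k @ inv_word (wd (g \<otimes> k))) @ (wd (g \<otimes> k) @ wd l @ inv_word (wd (g \<otimes> k \<otimes> l))))"
  proof (rule rho_cong[symmetric])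
    have "reduce ((wd g @ wd k) @ inv_word (wd (g \<otimes> k)) @ wd (g \<otimes> k) @ wd l @ inv_word (wd (g \<otimes> k \<otimes> l))) = reduce ?x"
      using assms by (subst reduce_cancel) (simp add: m_assoc)
    then show "reduce ((wd g @ wd k @ inv_word (wd (g \<otimes> k))) @ (wd (g \<otimes> k) @ wd l @ inv_word (wd (g \<otimes> k \<otimes> l)))) = reduce ?x"
      by simp
    show "h ((wd g @ wd k @ inv_word (wd (g \<otimes> k))) @ (wd (g \<otimes> k) @ wd l @ inv_word (wd (g \<otimes> k \<otimes> l)))) = \<one>"
      using assms cocycle_word[of g k] cocycle_word[of "g \<otimes> k" l] by (subst h_append) auto
  qed (use assms in \<open>auto simp: wd\<close>)
  also have "\<dots> = cocycle g k + cocycle (g \<otimes> k) l"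
    unfolding cocycle_def
    by (rule rho_append) (use assms cocycle_word[of g k] cocycle_word[of "g \<otimes> k" l] in auto)
  finally show ?thesis by (simp add: algebra_simps)
qed

lemma phi_boundary: "b \<in> B2 \<Longrightarrow> \<phi> b = 0"
proof -
  assume "b \<in> B2"
  then obtain c where c: "c \<in> carrier (bar_chains G 3)" and b: "b = bar_boundary G c"
    by (auto simp: bar_boundaries_def eval_nat_numeral)
  have "\<phi> (bar_boundary G c) = 0" using c
  proof (induction rule: bar_chain_induct)
    case (one gs)
    then obtain g k l where gs: "gs = [g, k, l]" by (auto simp: eval_nat_numeral length_Suc_conv)
    then show ?case using one cocycle_identity[of g k l]
      by (simp add: bar_boundary_3 phi_add phi_diff)
  qed (simp_all add: bar_boundary_0 bar_boundary_diff phi_diff)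
  with b show ?thesis by simp
qed

text \<open>The relator coordinates of the discrepancy between u and the chosen word for its
  value.\<close>

definition defect :: "nat word \<Rightarrow> (nat \<Rightarrow>\<^sub>0 int)"
  where "defect u = \<rho> (u @ inv_word (wd (h u)))"

text \<open>The linear correction that makes \<open>phi_sigma\<close> hold; it depends on a word
  only through its abelianisation.\<close>

definition \<Delta> :: "(nat \<Rightarrow>\<^sub>0 int) \<Rightarrow> (nat \<Rightarrow>\<^sub>0 int)"
  where "\<Delta> = frag_extend (\<lambda>x. - defect [(x, False)])"

lemma defect_word: "u \<in> W \<Longrightarrow> u @ inv_word (wd (h u)) \<in> W \<and> h (u @ inv_word (wd (h u))) = \<one>"
  by (simp add: wd h_append h_inv_word r_inv)

text \<open>For an inverse letter everything is the image under \<open>\<rho>\<close> of explicit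
  trivial words. The term \<open>\<rho> (wd \<one>)\<close> coming from [1|1] cancels the one hidden
  in the factor set of x and x^-1.\<close>

lemma phi_letter_chain:
  assumes "fst l < N"
  shows "\<phi> (letter_chain l) = defect [l] + \<Delta> (abelianize [l])"
proof (cases "snd l")
  case False
  then show ?thesis by (cases l) (simp add: letter_chain_def \<Delta>_def abelianize_def)
next
  case True
  then obtain x where l: "l = (x, True)" by (cases l) auto
  let ?p = "[(x, False)]" and ?q = "[(x, True)]"
  let ?a = "h ?p" and ?b = "h ?q"
  have x: "x < N" using assms l by simp
  have c: "?a \<in> carrier G" "?b \<in> carrier G" using x by auto
  have ab: "?b = inv ?a" using h_inv_letter[of "(x, False)"] x by (simp add: inv_letter_def)
  have q: "?q = inv_word ?p" by (simp add: inv_word_def inv_letter_def)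
  have w1: "wd \<one> \<in> W" "h (wd \<one>) = \<one>" by (simp_all add: wd)
  have wa: "wd ?a \<in> W" "wd ?b \<in> W" "h (wd ?a) = ?a" "h (wd ?b) = ?b" using c by (simp_all add: wd)
  have 1: "cocycle \<one> \<one> = \<rho> (wd \<one>)"
    unfolding cocycle_def
    by (rule rho_cong) (use w1 reduce_cancel'[of "wd \<one>" "wd \<one>" "[]"] in \<open>auto simp: h_append h_inv_word\<close>)
  have 2: "cocycle ?a ?b + \<rho> (wd \<one>) = \<rho> (wd ?a @ wd ?b)"
  proof -
    have "cocycle ?a ?b + \<rho> (wd \<one>) = \<rho> ((wd ?a @ wd ?b @ inv_word (wd \<one>)) @ wd \<one>)"
      using c ab w1 cocycle_word[of ?a ?b] by (subst rho_append) (auto simp: cocycle_def r_inv)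
    also have "\<dots> = \<rho> (wd ?a @ wd ?b)"
      by (rule rho_cong) (use w1 wa c ab reduce_cancel[of "wd ?a @ wd ?b" "wd \<one>" "[]"] in
        \<open>auto simp: h_append h_inv_word r_inv\<close>)
    finally show ?thesis .
  qed
  have 3: "defect ?p + \<rho> (wd ?a @ wd ?b) = \<rho> (?p @ wd ?b)"
  proof -
    have "defect ?p + \<rho> (wd ?a @ wd ?b) = \<rho> ((?p @ inv_word (wd ?a)) @ (wd ?a @ wd ?b))"
      using x defect_word[of ?p] wa ab c by (subst rho_append) (auto simp: defect_def h_append r_inv)
    also have "\<dots> = \<rho> (?p @ wd ?b)"
    proof (rule rho_cong)
      show "reduce ((?p @ inv_word (wd ?a)) @ (wd ?a @ wd ?b)) = reduce (?p @ wd ?b)"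
        using reduce_cancel[of ?p "wd ?a" "wd ?b"] by simp
      show "h ((?p @ inv_word (wd ?a)) @ (wd ?a @ wd ?b)) = \<one>"
        using x defect_word[of ?p] wa ab c by (subst h_append) (auto simp: h_append r_inv)
    qed (use x wa in auto)
    finally show ?thesis .
  qed
  have 4: "defect ?q = \<rho> (inv_word (?p @ wd ?b))"
  proof -
    have "defect ?q = \<rho> (?p @ (?q @ inv_word (wd ?b)) @ inv_word ?p)"
      using x defect_word[of ?q] by (simp only: defect_def) (subst rho_conj, auto)
    also have "\<dots> = \<rho> (inv_word (?p @ wd ?b))"
    proof (rule rho_cong)
      show "reduce (?p @ (?q @ inv_word (wd ?b)) @ inv_word ?p) = reduce (inv_word (?p @ wd ?b))"
        using reduce_cancel'[of "[]" ?p "inv_word (wd ?b) @ inv_word ?p"] by (simp add: inv_word_Cons inv_letter_def)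
      show "h (?p @ (?q @ inv_word (wd ?b)) @ inv_word ?p) = \<one>"
        using x defect_word[of ?q] by (subst h_append, simp, simp, subst h_append) (auto simp: h_inv_word r_inv)
    qed (use x wa in auto)
    finally show ?thesis .
  qed
  have "h (?p @ wd ?b) = \<one>" using x wa ab c by (subst h_append) (auto simp: r_inv)
  then have 5: "defect ?q = - \<rho> (?p @ wd ?b)"
    unfolding 4 using x wa by (subst rho_inv_word) auto
  have "\<phi> (letter_chain l) = - cocycle \<one> \<one> - cocycle ?a ?b"
    by (simp add: l letter_chain_def phi_diff phi_minus)
  also have "\<dots> = - \<rho> (wd ?a @ wd ?b)" using 1 2 by (simp add: algebra_simps eq_neg_iff_add_eq_0)
  also have "\<dots> = defect ?q + defect ?p" unfolding 5 3[symmetric] by simp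
  finally show ?thesis by (simp add: l \<Delta>_def abelianize_def frag_extend_minus)
qed

text \<open>In the induction the factor set of the new triangle joins the defects of the letter and
  of the rest into the defect of the longer word.\<close>

lemma phi_sigma: "u \<in> W \<Longrightarrow> \<phi> (\<sigma> u) = defect u + \<Delta> (abelianize u)"
proof (induction u)
  case Nil
  have w1: "wd \<one> \<in> W" "h (wd \<one>) = \<one>" by (simp_all add: wd)
  have "cocycle \<one> \<one> = \<rho> (wd \<one>)"
    unfolding cocycle_def
    by (rule rho_cong) (use w1 reduce_cancel'[of "wd \<one>" "wd \<one>" "[]"] in \<open>auto simp: h_append h_inv_word\<close>)
  then show ?case using w1 by (simp add: phi_minus defect_def rho_inv_word \<Delta>_def)
next
  case (Cons l u)
  then have u: "u \<in> W" and l: "fst l < N" "[l] \<in> W" by auto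
  let ?a = "wd (h [l])" and ?b = "wd (h u)" and ?c = "wd (h [l] \<otimes> h u)"
  have w: "?a \<in> W" "?b \<in> W" "?c \<in> W" "h ?a = h [l]" "h ?b = h u" "h ?c = h [l] \<otimes> h u"
    using u l(2) by (simp_all add: wd)
  \<comment> \<open>Conjugating by \<open>?a\<close> is free of charge for \<open>\<rho>\<close> and
    makes the three words telescope.\<close>
  have "defect u = \<rho> (?a @ (u @ inv_word ?b) @ inv_word ?a)"
    using defect_word[OF u] w by (simp only: defect_def) (subst rho_conj, auto)
  then have "defect u + cocycle (h [l]) (h u) =
      \<rho> ((?a @ (u @ inv_word ?b) @ inv_word ?a) @ (?a @ ?b @ inv_word ?c))"
    unfolding cocycle_def
    by (subst rho_append) (use u l w cocycle_word[of "h [l]" "h u"] in \<open>auto simp: h_append h_inv_word r_inv mult_inv_cancel inv_mult_cancel m_assoc\<close>)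
  also have "\<dots> = \<rho> (?a @ u @ inv_word ?c)"
  proof (rule rho_cong)
    have "reduce ((?a @ (u @ inv_word ?b) @ inv_word ?a) @ (?a @ ?b @ inv_word ?c)) = reduce ((?a @ u) @ inv_word ?b @ ?b @ inv_word ?c)"
      using reduce_cancel[of "?a @ u @ inv_word ?b" ?a "?b @ inv_word ?c"] by simp
    also have "\<dots> = reduce (?a @ u @ inv_word ?c)" by (subst reduce_cancel) simp
    finally show "reduce ((?a @ (u @ inv_word ?b) @ inv_word ?a) @ (?a @ ?b @ inv_word ?c)) = reduce (?a @ u @ inv_word ?c)" .
  qed (use u l w in \<open>auto simp: h_append h_inv_word r_inv mult_inv_cancel inv_mult_cancel m_assoc inv_mult_group\<close>)
  finally have 1: "defect [l] + (defect u + cocycle (h [l]) (h u)) = \<rho> ([l] @ inv_word ?a) + \<rho> (?a @ u @ inv_word ?c)"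
    by (simp add: defect_def)
  also have "\<dots> = \<rho> (([l] @ inv_word ?a) @ (?a @ u @ inv_word ?c))"
    by (rule rho_append[symmetric]) (use u l w defect_word[OF l(2)] in \<open>auto simp: h_append h_inv_word r_inv mult_inv_cancel inv_mult_cancel m_assoc inv_mult_group\<close>)
  also have "\<dots> = \<rho> ((l # u) @ inv_word ?c)"
  proof (rule rho_cong)
    show "reduce (([l] @ inv_word ?a) @ (?a @ u @ inv_word ?c)) = reduce ((l # u) @ inv_word ?c)"
      using reduce_cancel[of "[l]" ?a "u @ inv_word ?c"] by simp
    show "h (([l] @ inv_word ?a) @ (?a @ u @ inv_word ?c)) = \<one>"
      using u l w defect_word[OF l(2)] by (subst h_append) (auto simp: h_append h_inv_word r_inv mult_inv_cancel inv_mult_cancel m_assoc inv_mult_group)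
  qed (use u l w in auto)
  also have "\<dots> = defect (l # u)" using u l by (simp add: defect_def h_Cons[of l u])
  finally have "defect [l] + (defect u + cocycle (h [l]) (h u)) = defect (l # u)" .
  then show ?case
    using Cons.IH[OF u] phi_letter_chain[OF l(1)]
    by (simp add: phi_add abelianize_Cons[of l u] \<Delta>_def frag_extend_add algebra_simps)
qed

text \<open>On the kernel of \<open>D\<close> the correction vanishes, so \<open>\<phi>\<close>
  inverts \<open>\<gamma>\<close> there. As \<open>\<phi>\<close> kills boundaries, no nonzero
  kernel element is sent to a boundary.\<close>

lemma phi_gamma: "Poly_Mapping.keys k \<subseteq> {..<length rs} \<Longrightarrow> \<phi> (\<gamma> k) = k + \<Delta> (D k)"
proof (induction k rule: frag_induction)
  case (one j)
  then have r: "rs ! j \<in> W" "h (rs ! j) = \<one>" "j < length rs" by (auto simp: relator_in_W h_relator)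
  have w1: "wd \<one> \<in> W" "h (wd \<one>) = \<one>" by (simp_all add: wd)
  have 1: "cocycle \<one> \<one> = \<rho> (wd \<one>)"
    unfolding cocycle_def
    by (rule rho_cong) (use w1 reduce_cancel'[of "wd \<one>" "wd \<one>" "[]"] in \<open>auto simp: h_append h_inv_word\<close>)
  have "defect (rs ! j) = frag_of j - \<rho> (wd \<one>)"
    using r w1 by (simp add: defect_def rho_append rho_inv_word h_inv_word rho_relator)
  then show ?case
    using r by (simp add: \<gamma>_def D_def phi_add phi_sigma 1)
next
  case (diff a b)
  then show ?case by (simp add: \<gamma>_def D_def \<Delta>_def frag_extend_diff phi_diff algebra_simps)
qed (simp add: \<gamma>_def D_def \<Delta>_def)

text \<open>The degree-one part of the comparison back to the presentation, with
  \<open>\<phi>\<close> in degree two.\<close>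

definition \<alpha> :: "('b list \<Rightarrow>\<^sub>0 int) \<Rightarrow> (nat \<Rightarrow>\<^sub>0 int)"
  where "\<alpha> = frag_extend (\<lambda>gs. abelianize (wd (gs ! 0)))"

text \<open>Up to sign, the chain homotopy in degree one between the identity and the composite of
  the two comparisons.\<close>

definition \<mu> :: "('b list \<Rightarrow>\<^sub>0 int) \<Rightarrow> ('b list \<Rightarrow>\<^sub>0 int)"
  where "\<mu> = frag_extend (\<lambda>gs. \<sigma> (wd (gs ! 0)))"

lemma D_phi: "c \<in> carrier (bar_chains G 2) \<Longrightarrow> D (\<phi> c) = \<alpha> (bar_boundary G c)"
proof (induction rule: bar_chain_induct)
  case (one gs)
  then obtain g k where gs: "gs = [g, k]" by (auto simp: eval_nat_numeral length_Suc_conv)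
  with one show ?case
    using cocycle_word[of g k]
    by (simp add: cocycle_def D_rho abelianize_append abelianize_inv_word bar_boundary_2 \<alpha>_def
        frag_extend_add frag_extend_diff)
qed (simp_all add: bar_boundary_0 bar_boundary_diff phi_diff D_def \<alpha>_def frag_extend_diff)

lemma keys_phi: "c \<in> carrier (bar_chains G 2) \<Longrightarrow> Poly_Mapping.keys (\<phi> c) \<subseteq> {..<length rs}"
proof (induction rule: bar_chain_induct)
  case (one gs)
  then obtain g k where gs: "gs = [g, k]" by (auto simp: eval_nat_numeral length_Suc_conv)
  with one show ?case using cocycle_word[of g k] by (simp add: cocycle_def keys_rho)
next
  case (diff a b) then show ?case using keys_diff[of "\<phi> a" "\<phi> b"] by (auto simp: phi_diff)
qed simp

text \<open>For a cycle the homotopy term vanishes, so each class in H_2 is \<open>\<gamma>\<close>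
  of relator coordinates; by \<open>D_phi\<close> these lie in the kernel of
  \<open>D\<close>.\<close>

lemma chain_eq_gamma_phi:
  "c \<in> carrier (bar_chains G 2) \<Longrightarrow> c + \<mu> (bar_boundary G c) - \<gamma> (\<phi> c) \<in> B2"
proof (induction rule: bar_chain_induct)
  case (one gs)
  then obtain g k where gs: "gs = [g, k]" and g: "g \<in> carrier G" "k \<in> carrier G"
    by (auto simp: eval_nat_numeral length_Suc_conv)
  let ?u = "wd g" and ?v = "wd k" and ?x = "wd (g \<otimes> k)"
  have w: "?u \<in> W" "?v \<in> W" "?x \<in> W" "h ?u = g" "h ?v = k" "h ?x = g \<otimes> k" using g by (simp_all add: wd)
  have "frag_of [g, k] + \<mu> (bar_boundary G (frag_of [g, k])) - \<gamma> (\<phi> (frag_of [g, k])) =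
     (\<sigma> (?u @ ?v @ inv_word ?x) + frag_of [\<one>, \<one>] - \<gamma> (\<rho> (?u @ ?v @ inv_word ?x)))
   - (\<sigma> ((?u @ ?v) @ inv_word ?x) - (\<sigma> (?u @ ?v) + \<sigma> (inv_word ?x) + frag_of [h (?u @ ?v), h (inv_word ?x)]))
   - (\<sigma> (?u @ ?v) - (\<sigma> ?u + \<sigma> ?v + frag_of [h ?u, h ?v]))
   - (\<sigma> ?x + \<sigma> (inv_word ?x) + frag_of [h ?x, h (inv_word ?x)] + frag_of [\<one>, \<one>])"
    using w by (simp add: h_append bar_boundary_2 \<mu>_def frag_extend_add frag_extend_diff cocycle_def)
  also have "\<dots> \<in> B2"
    by (intro bar_boundaries_closed sigma_append sigma_inverse gamma_rho)
       (use w cocycle_word[OF g] in auto)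
  finally show ?case by (simp add: gs)
next
  case (diff a b)
  have eq: "a - b + \<mu> (bar_boundary G (a - b)) - \<gamma> (\<phi> (a - b)) =
    (a + \<mu> (bar_boundary G a) - \<gamma> (\<phi> a)) - (b + \<mu> (bar_boundary G b) - \<gamma> (\<phi> b))"
    by (simp add: bar_boundary_diff \<mu>_def frag_extend_diff phi_diff \<gamma>_def)
  show ?case unfolding eq by (rule bar_boundaries_diff[OF diff])
qed (simp add: bar_boundary_0 \<mu>_def \<gamma>_def bar_boundaries_0)

end

section \<open>Lattices of integer vectors inside rational vector spaces\<close>

section \<open>Integer combinations and rational linear algebra\<close>

text \<open>Integer vectors are embedded in the rational space of all functions on the index type,
  so that the exchange theorems for vector spaces apply to them.\<close>

global_interpretation rat_fun: vector_space "\<lambda>(c::rat) f (x::'i). c * f x"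
  by unfold_locales (auto simp: fun_eq_iff algebra_simps)

definition rat_vec :: "('i \<Rightarrow>\<^sub>0 int) \<Rightarrow> 'i \<Rightarrow> rat"
  where "rat_vec x = (\<lambda>i. of_int (Poly_Mapping.lookup x i))"

definition int_comb :: "('j \<Rightarrow> int) \<Rightarrow> ('j \<Rightarrow> ('i \<Rightarrow>\<^sub>0 int)) \<Rightarrow> 'j set \<Rightarrow> ('i \<Rightarrow>\<^sub>0 int)"
  where "int_comb c f S = (\<Sum>s\<in>S. frag_cmul (c s) (f s))"

abbreviation "rat_indep S \<equiv> \<not> rat_fun.dependent (rat_vec ` S)"
abbreviation "rat_span S \<equiv> rat_fun.span (rat_vec ` S)"

lemma rat_vec_add: "rat_vec (x + y) = rat_vec x + rat_vec y"
  by (simp add: rat_vec_def fun_eq_iff lookup_add)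

lemma rat_vec_cmul: "rat_vec (frag_cmul c x) = (\<lambda>i. of_int c * rat_vec x i)"
  by (simp add: rat_vec_def fun_eq_iff)

lemma rat_vec_0 [simp]: "rat_vec 0 = 0"
  by (simp add: rat_vec_def fun_eq_iff)

lemma inj_rat_vec: "inj rat_vec"
  by (rule injI) (simp add: rat_vec_def fun_eq_iff poly_mapping_eq_iff)

lemma rat_vec_eq_iff: "rat_vec x = rat_vec y \<longleftrightarrow> x = y"
  using inj_rat_vec by (auto dest: injD)

lemma card_rat_vec_image: "card (rat_vec ` S) = card S"
  by (rule card_image[OF inj_on_subset[OF inj_rat_vec]]) simp

lemma rat_vec_int_comb: "finite S \<Longrightarrow> rat_vec (int_comb c f S) = (\<Sum>s\<in>S. (\<lambda>i. of_int (c s) * rat_vec (f s) i))"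
  by (induction S rule: finite_induct) (auto simp: int_comb_def rat_vec_add rat_vec_cmul)

lemma sum_rat_vec_image: "(\<Sum>v\<in>rat_vec ` S. (\<lambda>i. u v * v i)) = (\<Sum>s\<in>S. (\<lambda>i. u (rat_vec s) * rat_vec s i))"
  by (simp add: sum.reindex[OF inj_on_subset[OF inj_rat_vec]])

lemma common_denominator:
  fixes r :: "'j \<Rightarrow> rat"
  assumes "finite S"
  shows "\<exists>m::int. m \<noteq> 0 \<and> (\<exists>c. \<forall>s\<in>S. of_int m * r s = of_int (c s))"
  using assms
proof (induction S rule: finite_induct)
  case empty then show ?case by (intro exI[of _ 1]) simp
next
  case (insert s S)
  then obtain m c where m: "m \<noteq> 0" "\<forall>s\<in>S. of_int m * r s = of_int (c s)" by blast
  obtain a b where ab: "r s = of_int a / of_int b" "b \<noteq> 0"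
    by (metis quotient_of_div quotient_of_denom_pos surj_pair less_irrefl)
  have "\<forall>t\<in>insert s S. of_int (m * b) * r t = of_int ((\<lambda>t. if t = s then m * a else b * c t) t)"
    using m(2) ab insert.hyps by (auto simp: mult.assoc mult.left_commute)
  then show ?case using m(1) ab(2) by (intro exI[of _ "m * b"]) fastforce
qed

text \<open>Clearing denominators trades a rational combination for an integer combination of a
  nonzero multiple.\<close>

lemma rat_span_iff:
  assumes "finite S"
  shows "rat_vec x \<in> rat_span S \<longleftrightarrow> (\<exists>m c. m \<noteq> 0 \<and> frag_cmul m x = int_comb c (\<lambda>s. s) S)"
proof
  assume "rat_vec x \<in> rat_span S"
  then obtain u where "rat_vec x = (\<Sum>v\<in>rat_vec ` S. (\<lambda>i. u v * v i))"
    using rat_fun.span_finite[of "rat_vec ` S"] assms by auto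
  then have u: "rat_vec x = (\<Sum>s\<in>S. (\<lambda>i. u (rat_vec s) * rat_vec s i))" by (simp add: sum_rat_vec_image)
  obtain m c where m: "m \<noteq> 0" and c: "\<forall>s\<in>S. of_int m * u (rat_vec s) = of_int (c s)"
    using common_denominator[OF assms, of "\<lambda>s. u (rat_vec s)"] by blast
  have "rat_vec (frag_cmul m x) = (\<Sum>s\<in>S. (\<lambda>i. of_int m * (u (rat_vec s) * rat_vec s i)))"
    unfolding rat_vec_cmul u using assms
    by (induction S rule: finite_induct) (auto simp: fun_eq_iff algebra_simps)
  also have "\<dots> = rat_vec (int_comb c (\<lambda>s. s) S)"
    unfolding rat_vec_int_comb[OF assms] using c
    by (intro sum.cong) (auto simp: fun_eq_iff mult.assoc[symmetric])
  finally show "\<exists>m c. m \<noteq> 0 \<and> frag_cmul m x = int_comb c (\<lambda>s. s) S"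
    using m rat_vec_eq_iff by blast
next
  assume "\<exists>m c. m \<noteq> 0 \<and> frag_cmul m x = int_comb c (\<lambda>s. s) S"
  then obtain m c where m: "m \<noteq> 0" and c: "frag_cmul m x = int_comb c (\<lambda>s. s) S" by blast
  have "rat_vec (int_comb c (\<lambda>s. s) S) \<in> rat_span S"
    unfolding rat_vec_int_comb[OF assms]
    by (intro rat_fun.span_sum rat_fun.span_scale rat_fun.span_base) auto
  then have "rat_vec (frag_cmul m x) \<in> rat_span S" by (simp add: c)
  then have "(\<lambda>i. (1 / of_int m) * rat_vec (frag_cmul m x) i) \<in> rat_span S" by (rule rat_fun.span_scale)
  then show "rat_vec x \<in> rat_span S" using m by (simp add: rat_vec_cmul)
qed

lemma rat_indep_iff:
  assumes "finite S"
  shows "rat_indep S \<longleftrightarrow> (\<forall>c. int_comb c (\<lambda>s. s) S = 0 \<longrightarrow> (\<forall>s\<in>S. c s = 0))"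
proof -
  have "rat_fun.dependent (rat_vec ` S) \<longleftrightarrow>
      (\<exists>u. (\<exists>s\<in>S. u (rat_vec s) \<noteq> 0) \<and> (\<Sum>s\<in>S. (\<lambda>i. u (rat_vec s) * rat_vec s i)) = 0)"
    using assms by (subst rat_fun.dependent_finite) (auto simp: sum_rat_vec_image)
  also have "\<dots> \<longleftrightarrow> (\<exists>c. (\<exists>s\<in>S. c s \<noteq> 0) \<and> int_comb c (\<lambda>s. s) S = 0)"
  proof
    assume "\<exists>u. (\<exists>s\<in>S. u (rat_vec s) \<noteq> 0) \<and> (\<Sum>s\<in>S. (\<lambda>i. u (rat_vec s) * rat_vec s i)) = 0"
    then obtain u where u: "\<exists>s\<in>S. u (rat_vec s) \<noteq> 0" "(\<Sum>s\<in>S. (\<lambda>i. u (rat_vec s) * rat_vec s i)) = 0" by blast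
    obtain m c where m: "m \<noteq> 0" and c: "\<forall>s\<in>S. of_int m * u (rat_vec s) = of_int (c s)"
      using common_denominator[OF assms, of "\<lambda>s. u (rat_vec s)"] by blast
    have "rat_vec (int_comb c (\<lambda>s. s) S) = (\<Sum>s\<in>S. (\<lambda>i. of_int m * (u (rat_vec s) * rat_vec s i)))"
      unfolding rat_vec_int_comb[OF assms] using c
      by (intro sum.cong) (auto simp: fun_eq_iff mult.assoc[symmetric])
    also have "\<dots> = (\<lambda>i. of_int m * (\<Sum>s\<in>S. (\<lambda>i. u (rat_vec s) * rat_vec s i)) i)"
      using assms by (induction S rule: finite_induct) (auto simp: fun_eq_iff algebra_simps)
    also have "\<dots> = rat_vec 0" by (simp add: u(2) fun_eq_iff)
    finally have "int_comb c (\<lambda>s. s) S = 0" by (simp only: rat_vec_eq_iff)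
    moreover have "\<exists>s\<in>S. c s \<noteq> 0"
    proof -
      from u(1) obtain s where s: "s \<in> S" "u (rat_vec s) \<noteq> 0" by blast
      with c m have "(of_int (c s) :: rat) \<noteq> 0" by (metis mult_eq_0_iff of_int_eq_0_iff)
      with s show ?thesis by auto
    qed
    ultimately show "\<exists>c. (\<exists>s\<in>S. c s \<noteq> 0) \<and> int_comb c (\<lambda>s. s) S = 0" by blast
  next
    assume "\<exists>c. (\<exists>s\<in>S. c s \<noteq> 0) \<and> int_comb c (\<lambda>s. s) S = 0"
    then obtain c where c: "\<exists>s\<in>S. c s \<noteq> 0" "int_comb c (\<lambda>s. s) S = 0" by blast
    let ?u = "\<lambda>v. of_int (c (inv_into UNIV rat_vec v)) :: rat"
    have "(\<Sum>s\<in>S. (\<lambda>i. ?u (rat_vec s) * rat_vec s i)) = rat_vec (int_comb c (\<lambda>s. s) S)"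
      by (simp add: rat_vec_int_comb[OF assms] inv_f_f[OF inj_rat_vec])
    with c show "\<exists>u. (\<exists>s\<in>S. u (rat_vec s) \<noteq> 0) \<and> (\<Sum>s\<in>S. (\<lambda>i. u (rat_vec s) * rat_vec s i)) = 0"
      by (intro exI[of _ ?u]) (auto simp: inv_f_f[OF inj_rat_vec])
  qed
  finally show ?thesis by blast
qed

lemma int_comb_closed:
  assumes "finite S" "0 \<in> K" "\<And>x y. x \<in> K \<Longrightarrow> y \<in> K \<Longrightarrow> x + y \<in> K" "\<And>c x. x \<in> K \<Longrightarrow> frag_cmul c x \<in> K"
    "\<And>s. s \<in> S \<Longrightarrow> f s \<in> K"
  shows "int_comb c f S \<in> K"
  using assms(1,5) by (induction S rule: finite_induct) (auto simp: int_comb_def assms)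

lemma int_comb_cong: "(\<And>s. s \<in> S \<Longrightarrow> c s = c' s) \<Longrightarrow> (\<And>s. s \<in> S \<Longrightarrow> f s = f' s) \<Longrightarrow> int_comb c f S = int_comb c' f' S"
  by (simp add: int_comb_def)

lemma int_comb_insert:
  "finite S \<Longrightarrow> s \<notin> S \<Longrightarrow> int_comb c f (insert s S) = frag_cmul (c s) (f s) + int_comb c f S"
  by (simp add: int_comb_def)

lemma int_comb_union:
  "finite S \<Longrightarrow> finite T \<Longrightarrow> S \<inter> T = {} \<Longrightarrow> int_comb c f (S \<union> T) = int_comb c f S + int_comb c f T"
  by (simp add: int_comb_def sum.union_disjoint)

lemma int_comb_reindex: "inj_on g S \<Longrightarrow> int_comb c f (g ` S) = int_comb (c \<circ> g) (f \<circ> g) S"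
  by (simp add: int_comb_def sum.reindex)

lemma frag_extend_int_comb: "frag_extend d (int_comb c f S) = int_comb c (frag_extend d \<circ> f) S"
  by (cases "finite S") (auto simp: int_comb_def frag_extend_sum frag_extend_cmul comp_def)

abbreviation (input) int_vecs :: "nat \<Rightarrow> (nat \<Rightarrow>\<^sub>0 int) set"
  where "int_vecs M \<equiv> {x. Poly_Mapping.keys x \<subseteq> {..<M}}"

lemma int_vecs_closed:
  "0 \<in> int_vecs M" "x \<in> int_vecs M \<Longrightarrow> y \<in> int_vecs M \<Longrightarrow> x + y \<in> int_vecs M"
  "x \<in> int_vecs M \<Longrightarrow> y \<in> int_vecs M \<Longrightarrow> x - y \<in> int_vecs M"
  "x \<in> int_vecs M \<Longrightarrow> frag_cmul c x \<in> int_vecs M"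
  using keys_add[of x y] keys_diff[of x y] keys_cmul[of c x] by auto

text \<open>Generation is over the integers while independence is over the rationals; for integer
  vectors the two kinds of independence agree by \<open>rat_indep_iff\<close>.\<close>

definition int_basis :: "(nat \<Rightarrow>\<^sub>0 int) set \<Rightarrow> (nat \<Rightarrow>\<^sub>0 int) set \<Rightarrow> bool"
  where "int_basis B K \<longleftrightarrow> finite B \<and> B \<subseteq> K \<and> rat_indep B \<and> (\<forall>x\<in>K. \<exists>c. x = int_comb c (\<lambda>b. b) B)"

lemma int_ideal_principal:
  fixes I :: "int set"
  assumes "0 \<in> I" "\<And>x y. x \<in> I \<Longrightarrow> y \<in> I \<Longrightarrow> x - y \<in> I" "\<And>c x. x \<in> I \<Longrightarrow> c * x \<in> I"
  shows "\<exists>g\<in>I. \<forall>x\<in>I. g dvd x"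
proof (cases "I = {0}")
  case False
  then obtain y where y: "y \<in> I" "y \<noteq> 0" using assms(1) by blast
  define P where "P n \<longleftrightarrow> n > 0 \<and> int n \<in> I" for n
  have "\<bar>y\<bar> \<in> I" using assms(3)[OF y(1), of "sgn y"] abs_sgn[of y] by (metis mult.commute)
  then have "P (nat \<bar>y\<bar>)" using y by (simp add: P_def)
  then have P: "P (Least P)" by (rule LeastI)
  have least: "\<And>m. P m \<Longrightarrow> Least P \<le> m" by (rule Least_le)
  let ?n = "int (Least P)"
  have "?n dvd x" if x: "x \<in> I" for x
  proof (rule ccontr)
    assume "\<not> ?n dvd x"
    moreover have n: "?n > 0" "?n \<in> I" using P by (simp_all add: P_def)
    ultimately have pos: "x mod ?n > 0" by (metis dvd_eq_mod_eq_0 order_le_less pos_mod_sign)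
    have "x mod ?n \<in> I"
      using assms(2)[OF x assms(3)[OF n(2), of "x div ?n"]] by (simp add: minus_div_mult_eq_mod)
    then have "P (nat (x mod ?n))" using pos by (simp add: P_def)
    then have "Least P \<le> nat (x mod ?n)" by (rule least)
    moreover have "x mod ?n < ?n" using n(1) by simp
    ultimately show False using pos by linarith
  qed
  then show ?thesis using P by (auto simp: P_def)
qed simp

text \<open>Induction on the number of coordinates. The last coordinates of the elements form an
  ideal of the integers; an element that realises its generator completes a basis of the elements
  whose last coordinate is zero.\<close>

lemma subgroup_int_basis:
  assumes "K \<subseteq> int_vecs M" "0 \<in> K" "\<And>x y. x \<in> K \<Longrightarrow> y \<in> K \<Longrightarrow> x - y \<in> K" "\<And>c x. x \<in> K \<Longrightarrow> frag_cmul c x \<in> K"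
  shows "\<exists>B. int_basis B K"
  using assms
proof (induction M arbitrary: K)
  case 0
  then have "K = {0}" by auto
  then show ?case
    using rat_fun.independent_empty by (intro exI[of _ "{}"]) (auto simp: int_basis_def int_comb_def)
next
  case (Suc M)
  let ?K = "{x \<in> K. Poly_Mapping.lookup x M = 0}"
  have "\<exists>B. int_basis B ?K"
  proof (rule Suc.IH)
    show "?K \<subseteq> int_vecs M"
    proof (rule subsetI, rule CollectI, rule subsetI)
      fix x i assume x: "x \<in> ?K" and i: "i \<in> Poly_Mapping.keys x"
      have "i < Suc M" using x i Suc.prems(1) by auto
      moreover have "i \<noteq> M" using x i by (auto simp: in_keys_iff)
      ultimately show "i \<in> {..<M}" by simp
    qed
  qed (use Suc.prems in \<open>auto simp: lookup_minus\<close>)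
  then obtain B where B: "int_basis B ?K" by blast
  show ?case
  proof (cases "?K = K")
    case True with B show ?thesis by auto
  next
    case False
    let ?I = "(\<lambda>x. Poly_Mapping.lookup x M) ` K"
    have "\<exists>g\<in>?I. \<forall>x\<in>?I. g dvd x"
    proof (rule int_ideal_principal)
      show "0 \<in> ?I" using Suc.prems(2) by (rule image_eqI[rotated]) simp
      show "x - y \<in> ?I" if xy: "x \<in> ?I" "y \<in> ?I" for x y
      proof -
        obtain v w where "v \<in> K" "x = Poly_Mapping.lookup v M" "w \<in> K" "y = Poly_Mapping.lookup w M" using xy by auto
        then show ?thesis using Suc.prems(3)[of v w] by (intro image_eqI[of _ _ "v - w"]) (auto simp: lookup_minus)
      qed
      show "c * x \<in> ?I" if x: "x \<in> ?I" for c x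
      proof -
        obtain v where "v \<in> K" "x = Poly_Mapping.lookup v M" using x by auto
        then show ?thesis using Suc.prems(4)[of v c] by (intro image_eqI[of _ _ "frag_cmul c v"]) auto
      qed
    qed
    then obtain b where b: "b \<in> K" and dvd: "\<And>x. x \<in> K \<Longrightarrow> Poly_Mapping.lookup b M dvd Poly_Mapping.lookup x M"
      by auto
    let ?n = "Poly_Mapping.lookup b M"
    have n0: "?n \<noteq> 0" using False dvd by auto
    have red: "x - frag_cmul (Poly_Mapping.lookup x M div ?n) b \<in> ?K" if "x \<in> K" for x
      using Suc.prems(3)[OF that Suc.prems(4)[OF b, of "Poly_Mapping.lookup x M div ?n"]] dvd[OF that]
      by (simp add: lookup_minus)
    have addK: "x + y \<in> K" if "x \<in> K" "y \<in> K" for x y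
      using Suc.prems(3)[of x "frag_cmul (-1) y"] Suc.prems(4)[of y "-1"] that by simp
    have bB: "b \<notin> B" using B n0 by (auto simp: int_basis_def)
    have "int_basis (insert b B) K"
      unfolding int_basis_def
    proof (intro conjI ballI)
      show "finite (insert b B)" using B by (simp add: int_basis_def)
      show "insert b B \<subseteq> K" using B b by (auto simp: int_basis_def)
      have fB: "finite B" and iB: "rat_indep B" using B by (simp_all add: int_basis_def)
      show "rat_indep (insert b B)"
        unfolding rat_indep_iff[OF finite.insertI[OF fB]]
      proof (intro allI impI)
        fix c assume c: "int_comb c (\<lambda>s. s) (insert b B) = 0"
        have "int_comb c (\<lambda>s. s) B \<in> ?K"
          by (rule int_comb_closed[OF fB]) (use B Suc.prems addK in \<open>auto simp: int_basis_def lookup_add\<close>)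
        moreover have "Poly_Mapping.lookup (int_comb c (\<lambda>s. s) (insert b B)) M =
            c b * ?n + Poly_Mapping.lookup (int_comb c (\<lambda>s. s) B) M"
          using b bB fB by (simp add: int_comb_insert lookup_add)
        ultimately have "c b * ?n = 0" using c by simp
        then have cb: "c b = 0" using n0 by simp
        with c have "int_comb c (\<lambda>s. s) B = 0" using bB fB by (simp add: int_comb_insert)
        with iB have "\<forall>s\<in>B. c s = 0" unfolding rat_indep_iff[OF fB] by blast
        with cb show "\<forall>s\<in>insert b B. c s = 0" by blast
      qed
      fix x assume x: "x \<in> K"
      obtain c where c: "x - frag_cmul (Poly_Mapping.lookup x M div ?n) b = int_comb c (\<lambda>b. b) B"
        using red[OF x] B by (auto simp: int_basis_def)
      have "int_comb c (\<lambda>b. b) B = int_comb (c(b := Poly_Mapping.lookup x M div ?n)) (\<lambda>b. b) B"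
        by (rule int_comb_cong) (use bB in auto)
      with c have "x = int_comb (c(b := Poly_Mapping.lookup x M div ?n)) (\<lambda>b. b) (insert b B)"
        using bB fB by (simp add: int_comb_insert algebra_simps)
      then show "\<exists>c. x = int_comb c (\<lambda>b. b) (insert b B)" by blast
    qed
    then show ?thesis by blast
  qed
qed

lemma int_comb_units: "finite J \<Longrightarrow> Poly_Mapping.lookup (int_comb c frag_of J) i = (if i \<in> J then c i else 0)"
  by (induction J rule: finite_induct) (auto simp: int_comb_def lookup_add)

lemma rat_indep_units: "finite J \<Longrightarrow> rat_indep (frag_of ` J)"
proof -
  assume J: "finite J"
  have inj: "inj_on frag_of J" by (auto intro: inj_onI simp: frag_of_eq)
  have "\<forall>j\<in>J. c (frag_of j) = 0" if "int_comb c (\<lambda>s. s) (frag_of ` J) = 0" for c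
    using that int_comb_units[OF J, of "c \<circ> frag_of"]
    by (metis (no_types, lifting) comp_apply comp_def inj int_comb_cong int_comb_reindex lookup_zero)
  then show ?thesis using J by (subst rat_indep_iff) auto
qed

lemma int_vecs_in_span: "x \<in> int_vecs M \<Longrightarrow> rat_vec x \<in> rat_span (frag_of ` {..<M})"
proof -
  assume x: "x \<in> int_vecs M"
  have inj: "inj_on frag_of {..<M}" by (auto intro: inj_onI simp: frag_of_eq)
  have "x = int_comb (Poly_Mapping.lookup x) frag_of {..<M}"
    using x by (intro poly_mapping_eqI) (auto simp: int_comb_units in_keys_iff)
  also have "\<dots> = int_comb (Poly_Mapping.lookup x \<circ> inv_into {..<M} frag_of) (\<lambda>s. s) (frag_of ` {..<M})"
    unfolding int_comb_reindex[OF inj]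
    by (rule int_comb_cong) (auto simp: inv_into_f_f[OF inj])
  finally show ?thesis by (subst rat_span_iff) (simp, metis frag_cmul_one one_neq_zero)
qed

lemma rat_indep_card_le:
  assumes "finite S" "rat_indep S" "\<And>s. s \<in> S \<Longrightarrow> rat_vec s \<in> rat_span T" "finite T"
  shows "card S \<le> card T"
  using rat_fun.independent_span_bound[of "rat_vec ` T" "rat_vec ` S"] assms
  by (auto simp: card_rat_vec_image)

text \<open>The exchange lemma with unit vectors as supply. The third conclusion is the independence
  of the chosen units modulo the span of \<open>C\<close>.\<close>

lemma extend_by_units:
  assumes "finite C" "C \<subseteq> int_vecs M" "rat_indep C"
  obtains J where "J \<subseteq> {..<M}" "card C + card J = M"
    "\<And>c. rat_vec (int_comb c frag_of J) \<in> rat_span C \<Longrightarrow> \<forall>j\<in>J. c j = 0"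
    "\<And>x. x \<in> int_vecs M \<Longrightarrow> rat_vec x \<in> rat_span (C \<union> frag_of ` J)"
proof -
  let ?U = "frag_of ` {..<M} :: (nat \<Rightarrow>\<^sub>0 int) set"
  obtain B where B: "rat_vec ` C \<subseteq> B" "B \<subseteq> rat_vec ` (C \<union> ?U)" "\<not> rat_fun.dependent B" "rat_vec ` (C \<union> ?U) \<subseteq> rat_fun.span B"
    using rat_fun.maximal_independent_subset_extend[of "rat_vec ` C" "rat_vec ` (C \<union> ?U)"] assms(3) by blast
  define J where "J = {j. j < M \<and> frag_of j \<notin> C \<and> rat_vec (frag_of j) \<in> B}"
  have J: "J \<subseteq> {..<M}" "finite J" by (auto simp: J_def)
  have inj: "inj_on frag_of J" by (auto intro: inj_onI simp: frag_of_eq)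
  have disj: "C \<inter> frag_of ` J = {}" by (auto simp: J_def)
  have BCJ: "B = rat_vec ` (C \<union> frag_of ` J)"
  proof (intro equalityI subsetI)
    fix x assume x: "x \<in> B"
    then obtain y where y: "x = rat_vec y" "y \<in> C \<union> ?U" using B(2) by auto
    show "x \<in> rat_vec ` (C \<union> frag_of ` J)"
      using x y by (cases "y \<in> C") (auto simp: J_def)
  qed (use B(1) in \<open>auto simp: J_def\<close>)
  have fin: "finite (C \<union> frag_of ` J)" using assms J by simp
  have ind: "rat_indep (C \<union> frag_of ` J)" using B(3) BCJ by simp
  have units: "rat_vec u \<in> rat_span (C \<union> frag_of ` J)" if "u \<in> ?U" for u
    using B(4) BCJ that by auto
  have span: "rat_vec x \<in> rat_span (C \<union> frag_of ` J)" if "x \<in> int_vecs M" for x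
    using int_vecs_in_span[OF that] rat_fun.span_minimal[of "rat_vec ` ?U" "rat_span (C \<union> frag_of ` J)"] units
    by (auto simp: rat_fun.subspace_span)
  have "card (C \<union> frag_of ` J) \<le> card ?U"
    by (rule rat_indep_card_le[OF fin ind]) (use assms(2) J in \<open>auto intro!: int_vecs_in_span\<close>)
  moreover have "card ?U \<le> card (C \<union> frag_of ` J)"
    by (rule rat_indep_card_le[OF _ rat_indep_units _ fin]) (use units in auto)
  moreover have "card ?U = M" by (subst card_image) (auto intro: inj_onI simp: frag_of_eq)
  ultimately have "card C + card J = M"
    using card_Un_disjoint[OF assms(1) _ disj] J card_image[OF inj] by simp
  moreover have "\<forall>j\<in>J. c j = 0" if sp: "rat_vec (int_comb c frag_of J) \<in> rat_span C" for c
  proof -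
    obtain m d where m: "m \<noteq> 0" and d: "frag_cmul m (int_comb c frag_of J) = int_comb d (\<lambda>s. s) C"
      using sp unfolding rat_span_iff[OF assms(1)] by blast
    \<comment> \<open>A multiple of the unit combination equals a combination of \<open>C\<close>;
      moved to one side, this is a dependence of the whole independent set.\<close>
    let ?e = "\<lambda>s. if s \<in> C then d s else - m * c (inv_into J frag_of s)"
    have "int_comb ?e (\<lambda>s. s) (frag_of ` J) = int_comb (\<lambda>j. - m * c j) frag_of J"
      unfolding int_comb_reindex[OF inj] using disj by (intro int_comb_cong) (auto simp: inv_into_f_f[OF inj])
    also have "\<dots> = - frag_cmul m (int_comb c frag_of J)"
      by (simp add: int_comb_def frag_cmul_sum sum_negf[symmetric])
    finally have 1: "int_comb ?e (\<lambda>s. s) (frag_of ` J) = - int_comb d (\<lambda>s. s) C" by (simp only: d)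
    have 2: "int_comb ?e (\<lambda>s. s) C = int_comb d (\<lambda>s. s) C" by (rule int_comb_cong) auto
    have "int_comb ?e (\<lambda>s. s) (C \<union> frag_of ` J) = 0"
      using int_comb_union[OF assms(1) _ disj, of ?e "\<lambda>s. s"] J 1 2 by simp
    then have *: "\<forall>s\<in>C \<union> frag_of ` J. ?e s = 0" using ind unfolding rat_indep_iff[OF fin] by blast
    show ?thesis
    proof
      fix j assume j: "j \<in> J"
      then have "?e (frag_of j) = 0" "frag_of j \<notin> C" using * disj by auto
      then show "c j = 0" using m j by (simp add: inv_into_f_f[OF inj])
    qed
  qed
  ultimately show ?thesis using that[of J] J span by blast
qed

text \<open>Units that complete a kernel basis map to a rational basis of the image. Choosing units,
  and not arbitrary vectors, makes that basis consist of values of \<open>d\<close>.\<close>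

theorem rank_nullity_int:
  assumes "\<And>j. j < M \<Longrightarrow> d j \<in> int_vecs N"
  shows "\<exists>B J. int_basis B {x \<in> int_vecs M. frag_extend d x = 0} \<and> J \<subseteq> {..<M} \<and> card B + card J = M \<and>
    (\<forall>c. int_comb c d J = 0 \<longrightarrow> (\<forall>j\<in>J. c j = 0)) \<and>
    (\<forall>x\<in>int_vecs M. \<exists>m c. m \<noteq> 0 \<and> frag_cmul m (frag_extend d x) = int_comb c d J)"
proof -
  let ?K = "{x \<in> int_vecs M. frag_extend d x = 0}"
  have "\<exists>B. int_basis B ?K"
    by (rule subgroup_int_basis[of _ M]) (use int_vecs_closed in \<open>auto simp: frag_extend_diff frag_extend_cmul\<close>)
  then obtain B where B: "int_basis B ?K" by blast
  then have fB: "finite B" and subB: "B \<subseteq> int_vecs M" and iB: "rat_indep B" by (auto simp: int_basis_def)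
  obtain J where J: "J \<subseteq> {..<M}" "card B + card J = M"
    and indJ: "\<And>c. rat_vec (int_comb c frag_of J) \<in> rat_span B \<Longrightarrow> \<forall>j\<in>J. c j = 0"
    and span: "\<And>x. x \<in> int_vecs M \<Longrightarrow> rat_vec x \<in> rat_span (B \<union> frag_of ` J)"
    using extend_by_units[OF fB subB iB] by metis
  have fJ: "finite J" using J(1) finite_subset by auto
  have inj: "inj_on frag_of J" by (auto intro: inj_onI simp: frag_of_eq)
  have comp: "frag_extend d \<circ> frag_of = d" by (simp add: fun_eq_iff)
  show ?thesis
  proof (intro exI[of _ B] exI[of _ J] conjI allI impI)
    fix c assume c: "int_comb c d J = 0"
    have "int_comb c frag_of J \<in> int_vecs M"
      by (rule int_comb_closed[OF fJ]) (use J int_vecs_closed in auto)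
    then have "int_comb c frag_of J \<in> ?K"
      using c by (simp add: frag_extend_int_comb comp)
    then obtain e where "int_comb c frag_of J = int_comb e (\<lambda>b. b) B" using B by (auto simp: int_basis_def)
    then have "rat_vec (int_comb c frag_of J) \<in> rat_span B"
      unfolding rat_span_iff[OF fB] by (intro exI[of _ "1::int"] exI[of _ e]) simp
    then show "\<forall>j\<in>J. c j = 0" by (rule indJ)
  next
    show "\<forall>x\<in>int_vecs M. \<exists>m c. m \<noteq> 0 \<and> frag_cmul m (frag_extend d x) = int_comb c d J"
    proof
    fix x assume x: "x \<in> int_vecs M"
    have finU: "finite (B \<union> frag_of ` J)" using fB fJ by simp
    obtain m c where m: "m \<noteq> 0" and c: "frag_cmul m x = int_comb c (\<lambda>s. s) (B \<union> frag_of ` J)"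
      using span[OF x] unfolding rat_span_iff[OF finU] by blast
    have disj: "B \<inter> frag_of ` J = {}"
    proof (rule ccontr)
      assume "B \<inter> frag_of ` J \<noteq> {}"
      then obtain j where j: "j \<in> J" "frag_of j \<in> B" by auto
      have "int_comb (\<lambda>i. if i = j then 1 else 0) frag_of J = frag_of j"
        using j fJ by (intro poly_mapping_eqI) (auto simp: int_comb_units)
      then have "rat_vec (int_comb (\<lambda>i. if i = j then 1 else 0) frag_of J) \<in> rat_span B"
        using j by (auto intro: rat_fun.span_base)
      from indJ[OF this] j show False by auto
    qed
    have "frag_cmul m (frag_extend d x) = frag_extend d (frag_cmul m x)" by (simp add: frag_extend_cmul)
    also have "\<dots> = int_comb c (frag_extend d) B + int_comb c (frag_extend d) (frag_of ` J)"
      using int_comb_union[OF fB _ disj] fJ by (simp add: c frag_extend_int_comb comp_def)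
    also have "int_comb c (frag_extend d) B = 0"
      using B by (auto simp: int_comb_def int_basis_def intro!: sum.neutral)
    also have "int_comb c (frag_extend d) (frag_of ` J) = int_comb (c \<circ> frag_of) d J"
      by (simp add: int_comb_reindex[OF inj] comp)
    finally show "\<exists>m c. m \<noteq> 0 \<and> frag_cmul m (frag_extend d x) = int_comb c d J"
      using m by auto
    qed
  qed (use B J in auto)
qed

section \<open>Generator number and rank of quotients of lattices\<close>

section \<open>Invariants of finitely generated abelian groups\<close>

text \<open>The two uses are the kernel of \<open>D\<close> mapping onto H_2 and the lattice of all
  generator vectors mapping onto H_1.\<close>

locale additive_map = comm_group A for A (structure) +
  fixes K :: "(nat \<Rightarrow>\<^sub>0 int) set" and \<phi> :: "(nat \<Rightarrow>\<^sub>0 int) \<Rightarrow> 'a"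
  assumes zero_mem: "0 \<in> K" and diff_mem: "x \<in> K \<Longrightarrow> y \<in> K \<Longrightarrow> x - y \<in> K"
    and add_mem: "x \<in> K \<Longrightarrow> y \<in> K \<Longrightarrow> x + y \<in> K"
    and cmul_mem: "x \<in> K \<Longrightarrow> frag_cmul c x \<in> K"
    and phi_onto: "\<phi> ` K = carrier A"
    and phi_add: "x \<in> K \<Longrightarrow> y \<in> K \<Longrightarrow> \<phi> (x + y) = \<phi> x \<otimes> \<phi> y"
begin

lemma phi_closed [simp]: "x \<in> K \<Longrightarrow> \<phi> x \<in> carrier A"
  using phi_onto by auto

lemma phi_0 [simp]: "\<phi> 0 = \<one>"
  using phi_add[of 0 0] zero_mem by (metis add.right_neutral phi_closed r_cancel_one')

lemma minus_mem: "x \<in> K \<Longrightarrow> - x \<in> K"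
  using cmul_mem[of x "-1"] by simp

lemma phi_minus: "x \<in> K \<Longrightarrow> \<phi> (- x) = inv \<phi> x"
  using phi_add[of "- x" x] by (intro inv_equality[symmetric]) (auto simp: minus_mem)

lemma phi_cmul_nat: "x \<in> K \<Longrightarrow> \<phi> (frag_cmul (int n) x) = \<phi> x [^] n"
  by (induction n) (auto simp: frag_cmul_distrib phi_add cmul_mem m_comm)

lemma phi_cmul: "x \<in> K \<Longrightarrow> \<phi> (frag_cmul c x) = \<phi> x [^] c"
proof (cases c)
  case (nonneg n) then show "x \<in> K \<Longrightarrow> ?thesis" by (simp add: phi_cmul_nat int_pow_int)
next
  case (neg n)
  assume x: "x \<in> K"
  have "frag_cmul c x = - frag_cmul (int (Suc n)) x" by (simp add: neg)
  then show ?thesis using x by (simp only: phi_minus cmul_mem phi_cmul_nat) (simp only: neg int_pow_neg_int phi_closed)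
qed

lemma int_comb_mem: "finite S \<Longrightarrow> (\<And>s. s \<in> S \<Longrightarrow> f s \<in> K) \<Longrightarrow> int_comb c f S \<in> K"
  by (rule int_comb_closed) (auto simp: zero_mem add_mem cmul_mem)

lemma phi_int_comb:
  assumes "finite S" "\<And>s. s \<in> S \<Longrightarrow> f s \<in> K"
  shows "\<phi> (int_comb c f S) = finprod A (\<lambda>s. \<phi> (f s) [^] c s) S"
  using assms
proof (induction S rule: finite_induct)
  case (insert s S)
  have "finprod A (\<lambda>s. \<phi> (f s) [^] c s) (insert s S) = \<phi> (f s) [^] c s \<otimes> finprod A (\<lambda>s. \<phi> (f s) [^] c s) S"
    by (rule finprod_insert) (use insert in auto)
  with insert show ?case by (simp add: int_comb_insert phi_add cmul_mem int_comb_mem phi_cmul)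
qed (simp add: int_comb_def)

text \<open>Lifts of any generating set span the lattice rationally, so there are at least as many
  of them as elements of a basis.\<close>

lemma min_num_generators_eq:
  assumes inj: "\<And>x. x \<in> K \<Longrightarrow> \<phi> x = \<one> \<Longrightarrow> x = 0" and B: "int_basis B K"
  shows "min_num_generators A = card B"
  unfolding min_num_generators_def
proof (rule Least_equality)
  have fB: "finite B" and BK: "B \<subseteq> K" and iB: "rat_indep B" using B by (auto simp: int_basis_def)
  have inj': "x = y" if "x \<in> K" "y \<in> K" "\<phi> x = \<phi> y" for x y
  proof -
    have "\<phi> (x + - y) = \<one>" using that by (subst phi_add) (auto simp: minus_mem phi_minus r_inv)
    then have "x + - y = 0" using inj[of "x + - y"] that add_mem minus_mem by blast
    then show ?thesis by simp
  qed
  have "generate A (\<phi> ` B) = carrier A"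
  proof
    show "generate A (\<phi> ` B) \<subseteq> carrier A" by (rule generate_incl) (use BK in auto)
    interpret S: subgroup "generate A (\<phi> ` B)" A by (rule generate_is_subgroup) (use BK in auto)
    have gen: "\<phi> (int_comb c (\<lambda>b. b) S) \<in> generate A (\<phi> ` B)" if "S \<subseteq> B" for c S
      using finite_subset[OF that fB] that
    proof (induction S rule: finite_induct)
      case (insert s S)
      have "\<phi> s \<in> generate A (\<phi> ` B)" using insert by (auto intro: generate.incl)
      then have "\<phi> s [^] c s \<in> generate A (\<phi> ` B)" using subgroup_int_pow_closed[OF S.subgroup_axioms] by blast
      moreover have "\<phi> (int_comb c (\<lambda>b. b) (insert s S)) = \<phi> s [^] c s \<otimes> \<phi> (int_comb c (\<lambda>b. b) S)"
        using insert BK finite_subset[OF _ fB] by (subst int_comb_insert) (auto simp: phi_add cmul_mem int_comb_mem phi_cmul subset_iff)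
      ultimately show ?case using insert by (auto intro: generate.eng)
    qed (simp add: int_comb_def generate.one)
    show "carrier A \<subseteq> generate A (\<phi> ` B)"
    proof
      fix a assume "a \<in> carrier A"
      then obtain x where x: "x \<in> K" "a = \<phi> x" using phi_onto by auto
      then obtain c where "x = int_comb c (\<lambda>b. b) B" using B by (auto simp: int_basis_def)
      then show "a \<in> generate A (\<phi> ` B)" using gen[of B c] x by simp
    qed
  qed
  moreover have "card (\<phi> ` B) = card B"
    by (rule card_image) (use inj' BK in \<open>auto intro!: inj_onI\<close>)
  ultimately show "\<exists>S\<subseteq>carrier A. finite S \<and> card S = card B \<and> generate A S = carrier A"
    using fB BK by (intro exI[of _ "\<phi> ` B"]) auto
  fix d assume "\<exists>S\<subseteq>carrier A. finite S \<and> card S = d \<and> generate A S = carrier A"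
  then obtain S where S: "S \<subseteq> carrier A" "finite S" "card S = d" "generate A S = carrier A" by blast
  define p where "p = inv_into K \<phi>"
  have p: "p s \<in> K" "\<phi> (p s) = s" if "s \<in> S" for s
    using that S(1) phi_onto by (auto simp: p_def inv_into_into f_inv_into_f)
  have gen: "\<exists>x\<in>K. \<phi> x = a \<and> rat_vec x \<in> rat_span (p ` S)" if "a \<in> generate A S" for a
    using that
  proof (induction rule: generate.induct)
    case one then show ?case
      by (intro bexI[of _ 0] conjI) (simp_all only: phi_0 rat_vec_0 zero_mem rat_fun.span_zero)
  next
    case (incl s) then show ?case using p by (intro bexI[of _ "p s"]) (auto intro: rat_fun.span_base)
  next
    case (inv s)
    have neg: "rat_vec (- p s) = - rat_vec (p s)" by (simp add: rat_vec_def fun_eq_iff)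
    have "rat_vec (- p s) \<in> rat_span (p ` S)"
      unfolding neg by (intro rat_fun.span_neg rat_fun.span_base) (use inv in auto)
    with inv p show ?case by (intro bexI[of _ "- p s"]) (auto simp: phi_minus minus_mem)
  next
    case (eng a b)
    then obtain x y where "x \<in> K" "\<phi> x = a" "rat_vec x \<in> rat_span (p ` S)" "y \<in> K" "\<phi> y = b" "rat_vec y \<in> rat_span (p ` S)" by blast
    then show ?case
      using rat_fun.span_add[of "rat_vec x" "rat_vec ` p ` S" "rat_vec y"]
      by (intro bexI[of _ "x + y"] conjI) (simp_all only: phi_add add_mem rat_vec_add)
  qed
  have "rat_vec b \<in> rat_span (p ` S)" if b: "b \<in> B" for b
  proof -
    have "\<phi> b \<in> generate A S" using b BK S(4) by auto
    then obtain x where "x \<in> K" "\<phi> x = \<phi> b" "rat_vec x \<in> rat_span (p ` S)" using gen by blast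
    then show ?thesis using inj'[of x b] b BK by auto
  qed
  then have "card B \<le> card (p ` S)" using fB iB S(2) by (intro rat_indep_card_le) auto
  also have "\<dots> \<le> d" using card_image_le[OF S(2), of p] S(3) by simp
  finally show "card B \<le> d" .
qed

text \<open>Units complementary to \<open>C\<close> stay independent in the quotient. Conversely,
  lifts of an independent set of the quotient are independent together with \<open>C\<close>, which
  bounds their number.\<close>

lemma torsion_free_rank_eq:
  assumes K: "K = int_vecs N"
    and C: "finite C" "C \<subseteq> L" "L \<subseteq> K" "rat_indep C" "\<And>x. x \<in> L \<Longrightarrow> rat_vec x \<in> rat_span C"
    and L: "\<And>x y. x \<in> L \<Longrightarrow> y \<in> L \<Longrightarrow> x + y \<in> L" "0 \<in> L" "\<And>c x. x \<in> L \<Longrightarrow> frag_cmul c x \<in> L"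
    and ker: "\<And>x. x \<in> K \<Longrightarrow> \<phi> x = \<one> \<longleftrightarrow> x \<in> L"
  shows "card C \<le> N \<and> torsion_free_rank A = N - card C"
proof -
  have CK: "C \<subseteq> int_vecs N" using C K by auto
  obtain J where J: "J \<subseteq> {..<N}" "card C + card J = N"
    and indJ: "\<And>c. rat_vec (int_comb c frag_of J) \<in> rat_span C \<Longrightarrow> \<forall>j\<in>J. c j = 0"
    by (rule extend_by_units[OF C(1) CK C(4)], rule that) blast+
  have fJ: "finite J" using J(1) finite_subset by auto
  have JK: "frag_of j \<in> K" if "j \<in> J" for j using that J(1) K by auto
  let ?e = "\<lambda>j. \<phi> (frag_of j)"
  have inj: "inj_on ?e J"
  proof (rule inj_onI, rule ccontr)
    fix i j assume ij: "i \<in> J" "j \<in> J" "?e i = ?e j" "i \<noteq> j"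
    have "\<phi> (frag_of i + - frag_of j) = \<one>"
      using ij JK by (subst phi_add) (auto simp: phi_minus minus_mem r_inv)
    moreover have "frag_of i + - frag_of j \<in> K" by (intro add_mem minus_mem JK ij)
    ultimately have "frag_of i + - frag_of j \<in> L" using ker by simp
    then have "rat_vec (frag_of i + - frag_of j) \<in> rat_span C" by (rule C(5))
    moreover have "frag_of i + - frag_of j = int_comb (\<lambda>k. if k = i then 1 else if k = j then -1 else 0) frag_of J"
      using ij fJ by (intro poly_mapping_eqI) (auto simp: int_comb_units lookup_minus)
    ultimately have "\<forall>k\<in>J. (if k = i then 1 else if k = j then -1 else 0 :: int) = 0"
      by (intro indJ) simp
    then show False using ij(1) by auto
  qed
  have "torsion_free_rank A = card J"
    unfolding torsion_free_rank_def
  proof (rule Greatest_equality)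
    have "int_independent A (?e ` J)"
      unfolding int_independent_def
    proof (intro allI impI)
      fix c :: "'a \<Rightarrow> int"
      assume "finprod A (\<lambda>s. s [^] c s) (?e ` J) = \<one>"
      then have "finprod A (\<lambda>j. ?e j [^] c (?e j)) J = \<one>"
        by (subst (asm) finprod_reindex[OF _ inj]) (use JK in auto)
      then have "\<phi> (int_comb (\<lambda>j. c (?e j)) frag_of J) = \<one>" using fJ JK by (subst phi_int_comb) auto
      moreover have "int_comb (\<lambda>j. c (?e j)) frag_of J \<in> K" by (rule int_comb_mem[OF fJ JK])
      ultimately have "int_comb (\<lambda>j. c (?e j)) frag_of J \<in> L" using ker by simp
      from indJ[OF C(5)[OF this]] show "\<forall>s\<in>?e ` J. c s = 0" by auto
    qed
    then show "\<exists>S\<subseteq>carrier A. finite S \<and> card S = card J \<and> int_independent A S"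
      using fJ JK card_image[OF inj] by (intro exI[of _ "?e ` J"]) auto
    fix r assume "\<exists>S\<subseteq>carrier A. finite S \<and> card S = r \<and> int_independent A S"
    then obtain S where S: "S \<subseteq> carrier A" "finite S" "card S = r" "int_independent A S" by blast
    define p where "p = inv_into K \<phi>"
    have p: "p s \<in> K" "\<phi> (p s) = s" if "s \<in> S" for s
      using that S(1) phi_onto by (auto simp: p_def inv_into_into f_inv_into_f)
    have injp: "inj_on p S" using p by (metis inj_onI)
    \<comment> \<open>The coefficient function that is 1 at the identity and 0 elsewhere has trivial
      product, so it would contradict independence.\<close>
    have one: "\<one> \<notin> S"
    proof
      assume 1: "\<one> \<in> S"
      have "finprod A (\<lambda>s. s [^] (if s = \<one> then 1 else 0 :: int)) S = finprod A (\<lambda>s. \<one>) S"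
        by (rule finprod_cong') (use S in auto)
      then have "(if \<one> = \<one> then 1 else 0 :: int) = 0"
        using S(4)[unfolded int_independent_def, rule_format, of "\<lambda>s. if s = \<one> then 1 else 0" \<one>] 1 by simp
      then show False by simp
    qed
    have disj: "C \<inter> p ` S = {}"
    proof (rule ccontr)
      assume "C \<inter> p ` S \<noteq> {}"
      then obtain s where s: "s \<in> S" "p s \<in> L" using C(2) by auto
      then have "\<phi> (p s) = \<one>" using ker p by blast
      then show False using one s p by auto
    qed
    have fin: "finite (C \<union> p ` S)" using C S by simp
    have "rat_indep (C \<union> p ` S)"
      unfolding rat_indep_iff[OF fin]
    proof (intro allI impI)
      fix c assume c: "int_comb c (\<lambda>s. s) (C \<union> p ` S) = 0"
      have CL: "int_comb c (\<lambda>s. s) C \<in> L" by (rule int_comb_closed[OF C(1)]) (use L C in auto)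
      have pS: "int_comb c (\<lambda>s. s) (p ` S) = int_comb (c \<circ> p) p S"
        by (simp add: int_comb_reindex[OF injp] comp_def)
      have "int_comb c (\<lambda>s. s) C + int_comb (c \<circ> p) p S = 0"
        using c int_comb_union[OF C(1) _ disj, of c "\<lambda>s. s"] S(2) pS by simp
      then have eq: "int_comb (c \<circ> p) p S = frag_cmul (-1) (int_comb c (\<lambda>s. s) C)"
        by (simp add: eq_neg_iff_add_eq_0 add.commute)
      have "int_comb (c \<circ> p) p S \<in> L" unfolding eq by (rule L(3)[OF CL])
      then have "\<phi> (int_comb (c \<circ> p) p S) = \<one>" using ker C(3) by blast
      then have "finprod A (\<lambda>s. \<phi> (p s) [^] (c \<circ> p) s) S = \<one>" using phi_int_comb[OF S(2)] p by simp
      moreover have "finprod A (\<lambda>s. \<phi> (p s) [^] (c \<circ> p) s) S = finprod A (\<lambda>s. s [^] (c \<circ> p) s) S"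
        by (rule finprod_cong') (use p S in auto)
      ultimately have z: "\<forall>s\<in>S. (c \<circ> p) s = 0"
        using S(4)[unfolded int_independent_def, rule_format, of "c \<circ> p"] by simp
      then have "int_comb (c \<circ> p) p S = 0" by (simp add: int_comb_def)
      with eq have "int_comb c (\<lambda>s. s) C = 0" by simp
      then have "\<forall>s\<in>C. c s = 0" using C(4) unfolding rat_indep_iff[OF C(1)] by blast
      with z show "\<forall>s\<in>C \<union> p ` S. c s = 0" by auto
    qed
    then have "card (C \<union> p ` S) \<le> card (frag_of ` {..<N} :: (nat \<Rightarrow>\<^sub>0 int) set)"
      by (intro rat_indep_card_le[OF fin]) (use CK p K in \<open>auto intro!: int_vecs_in_span\<close>)
    also have "\<dots> = N" by (subst card_image) (auto intro: inj_onI simp: frag_of_eq)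
    finally have "card C + r \<le> N"
      using card_Un_disjoint[OF C(1) _ disj] S card_image[OF injp] by simp
    then show "r \<le> card J" using J(2) by simp
  qed
  then show ?thesis using J(2) by simp
qed

end

section \<open>H_1 and H_2 as cokernel and kernel of the relation matrix\<close>

section \<open>Homology of a group with an independent presentation\<close>

context group
begin

lemma bar_chains_group: "comm_group (bar_chains G k)"
  by (simp add: bar_chains_def abelian_free_Abelian_group)

lemma bar_chains_simps [simp]: "\<one>\<^bsub>bar_chains G k\<^esub> = 0" "x \<otimes>\<^bsub>bar_chains G k\<^esub> y = x + y"
  by (simp_all add: bar_chains_def)

lemma bar_chains_inv: "x \<in> carrier (bar_chains G k) \<Longrightarrow> inv\<^bsub>bar_chains G k\<^esub> x = - x"
  by (simp add: bar_chains_def)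

lemma bar_cycles_subgroup: "subgroup (bar_cycles G k) (bar_chains G k)"
proof -
  interpret C: comm_group "bar_chains G k" by (rule bar_chains_group)
  show ?thesis
    by (rule C.subgroupI)
       (auto simp: bar_cycles_def bar_chains_inv bar_boundary_minus bar_boundary_add bar_chains_closed
          bar_boundary_0 intro!: exI[of _ 0])
qed

definition (in group) bar_cycle_group :: "nat \<Rightarrow> ('a list \<Rightarrow>\<^sub>0 int) monoid"
  where "bar_cycle_group k = subgroup_generated (bar_chains G k) (bar_cycles G k)"

lemma bar_cycle_group:
  "comm_group (bar_cycle_group k)" "carrier (bar_cycle_group k) = bar_cycles G k"
  "\<one>\<^bsub>bar_cycle_group k\<^esub> = 0" "x \<otimes>\<^bsub>bar_cycle_group k\<^esub> y = x + y"
proof -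
  interpret C: comm_group "bar_chains G k" by (rule bar_chains_group)
  show "comm_group (bar_cycle_group k)" unfolding bar_cycle_group_def
    by (rule C.abelian_subgroup_generated[OF bar_chains_group])
  show "carrier (bar_cycle_group k) = bar_cycles G k" unfolding bar_cycle_group_def
    by (rule subgroup.carrier_subgroup_generated_subgroup[OF bar_cycles_subgroup])
qed (simp_all add: bar_cycle_group_def)

text \<open>An additive parametrisation of cycles that is onto modulo boundaries is put into the
  form required by the counting lemmas, together with its kernel.\<close>

lemma homology_additive_map:
  assumes B: "bar_boundaries G k \<subseteq> bar_cycles G k"
    and K: "0 \<in> K" "\<And>x y. x \<in> K \<Longrightarrow> y \<in> K \<Longrightarrow> x - y \<in> K" "\<And>x y. x \<in> K \<Longrightarrow> y \<in> K \<Longrightarrow> x + y \<in> K"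
      "\<And>c x. x \<in> K \<Longrightarrow> frag_cmul c x \<in> K"
    and g: "\<And>x. x \<in> K \<Longrightarrow> g x \<in> bar_cycles G k" "\<And>x y. x \<in> K \<Longrightarrow> y \<in> K \<Longrightarrow> g (x + y) = g x + g y"
    and onto: "\<And>z. z \<in> bar_cycles G k \<Longrightarrow> \<exists>x\<in>K. z - g x \<in> bar_boundaries G k"
  defines "\<phi> \<equiv> \<lambda>x. bar_boundaries G k #>\<^bsub>bar_cycle_group k\<^esub> g x"
  shows "additive_map (group_homology k G) K \<phi>"
    and "\<And>x. x \<in> K \<Longrightarrow> \<phi> x = \<one>\<^bsub>group_homology k G\<^esub> \<longleftrightarrow> g x \<in> bar_boundaries G k"
proof -
  let ?Z = "bar_cycle_group k"
  interpret Z: comm_group ?Z by (rule bar_cycle_group)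
  have inv: "inv\<^bsub>?Z\<^esub> x = - x" if "x \<in> bar_cycles G k" for x
    using that bar_boundary_minus[of x]
    by (intro Z.inv_equality) (auto simp: bar_cycle_group bar_cycles_def bar_chains_closed)
  have sub: "subgroup (bar_boundaries G k) ?Z"
    by (rule Z.subgroupI)
       (use B inv in \<open>auto simp: bar_cycle_group bar_boundaries_closed subset_iff intro: bar_boundaries_0\<close>)
  interpret N: normal "bar_boundaries G k" ?Z by (rule Z.subgroup_imp_normal[OF sub])
  have H: "group_homology k G = ?Z Mod bar_boundaries G k"
    by (simp add: group_homology_def bar_cycle_group_def)
  have coset: "\<phi> x = bar_boundaries G k \<longleftrightarrow> g x \<in> bar_boundaries G k" if "x \<in> K" for x
    unfolding \<phi>_def
    using Z.coset_join1[OF _ _ sub, of "g x"] Z.coset_join2[OF _ sub, of "g x"] g(1)[OF that]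
    by (auto simp: bar_cycle_group N.subset)
  show "\<And>x. x \<in> K \<Longrightarrow> \<phi> x = \<one>\<^bsub>group_homology k G\<^esub> \<longleftrightarrow> g x \<in> bar_boundaries G k"
    using coset by (simp add: H FactGroup_def)
  interpret A: comm_group "group_homology k G"
    unfolding H by (rule Z.abelian_FactGroup[OF sub])
  show "additive_map (group_homology k G) K \<phi>"
  proof (unfold_locales)
    show "\<phi> ` K = carrier (group_homology k G)"
    proof
      show "\<phi> ` K \<subseteq> carrier (group_homology k G)"
        using g(1) by (auto simp: H carrier_FactGroup \<phi>_def bar_cycle_group)
      show "carrier (group_homology k G) \<subseteq> \<phi> ` K"
      proof
        fix a assume "a \<in> carrier (group_homology k G)"
        then obtain z where z: "z \<in> bar_cycles G k" "a = bar_boundaries G k #>\<^bsub>?Z\<^esub> z"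
          by (auto simp: H carrier_FactGroup bar_cycle_group)
        obtain x where x: "x \<in> K" "z - g x \<in> bar_boundaries G k" using onto[OF z(1)] by blast
        have "z \<in> bar_boundaries G k #>\<^bsub>?Z\<^esub> g x"
          using x by (auto simp: r_coset_def bar_cycle_group intro!: bexI[of _ "z - g x"])
        then have "a = \<phi> x" unfolding z(2) \<phi>_def
          using Z.repr_independence[OF _ _ sub, of z "g x"] g(1)[OF x(1)] by (simp add: bar_cycle_group)
        with x show "a \<in> \<phi> ` K" by blast
      qed
    qed
    show "\<phi> (x + y) = \<phi> x \<otimes>\<^bsub>group_homology k G\<^esub> \<phi> y" if "x \<in> K" "y \<in> K" for x y
      using N.rcos_sum[of "g x" "g y"] g that by (simp add: H \<phi>_def bar_cycle_group)
  qed (use K in auto)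
qed

lemma boundary_boundary_2: "c \<in> carrier (bar_chains G 2) \<Longrightarrow> bar_boundary G (bar_boundary G c) = 0"
proof (induction rule: bar_chain_induct)
  case (one gs)
  then obtain g k where "gs = [g, k]" by (auto simp: eval_nat_numeral length_Suc_conv)
  then show ?case by (simp add: bar_boundary_2 bar_boundary_add bar_boundary_diff bar_boundary_1)
qed (simp_all add: bar_boundary_0 bar_boundary_diff)

lemma boundary_boundary_3: "c \<in> carrier (bar_chains G 3) \<Longrightarrow> bar_boundary G (bar_boundary G c) = 0"
proof (induction rule: bar_chain_induct)
  case (one gs)
  then obtain g k l where "gs = [g, k, l]" by (auto simp: eval_nat_numeral length_Suc_conv)
  with one show ?case by (simp add: bar_boundary_3 bar_boundary_2 bar_boundary_add bar_boundary_diff m_assoc)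
qed (simp_all add: bar_boundary_0 bar_boundary_diff)

lemma boundary_chains_2: "c \<in> carrier (bar_chains G 2) \<Longrightarrow> bar_boundary G c \<in> carrier (bar_chains G 1)"
proof (induction rule: bar_chain_induct)
  case (one gs)
  then obtain g k where "gs = [g, k]" by (auto simp: eval_nat_numeral length_Suc_conv)
  with one show ?case by (auto simp: bar_boundary_2 bar_chains_frag_of intro!: bar_chains_closed)
qed (auto simp: bar_boundary_0 bar_boundary_diff bar_chains_closed)

lemma boundary_chains_3: "c \<in> carrier (bar_chains G 3) \<Longrightarrow> bar_boundary G c \<in> carrier (bar_chains G 2)"
proof (induction rule: bar_chain_induct)
  case (one gs)
  then obtain g k l where "gs = [g, k, l]" by (auto simp: eval_nat_numeral length_Suc_conv)
  with one show ?case by (auto simp: bar_boundary_3 bar_chains_frag_of intro!: bar_chains_closed)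
qed (auto simp: bar_boundary_0 bar_boundary_diff bar_chains_closed)

lemma bar_boundaries_subset_cycles:
  "bar_boundaries G 1 \<subseteq> bar_cycles G 1" "bar_boundaries G 2 \<subseteq> bar_cycles G 2"
  using boundary_boundary_2 boundary_chains_2 boundary_boundary_3 boundary_chains_3
  by (auto simp: bar_boundaries_def bar_cycles_def eval_nat_numeral)

lemma bar_cycles_1: "bar_cycles G 1 = carrier (bar_chains G 1)"
proof -
  have "bar_boundary G c = 0" if "c \<in> carrier (bar_chains G 1)" for c
    using that
  proof (induction rule: bar_chain_induct)
    case (one gs)
    then obtain g where "gs = [g]" by (auto simp: length_Suc_conv)
    then show ?case by (simp add: bar_boundary_1)
  qed (simp_all add: bar_boundary_0 bar_boundary_diff)
  then show ?thesis by (auto simp: bar_cycles_def)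
qed

end

context independent_presentation
begin

lemma Lambda_chains: "x \<in> int_vecs N \<Longrightarrow> \<Lambda> x \<in> carrier (bar_chains G 1)"
proof -
  assume "x \<in> int_vecs N"
  then have "Poly_Mapping.keys x \<subseteq> {..<N}" by simp
  then show ?thesis
    by (induction x rule: frag_induction)
       (auto simp: \<Lambda>_def frag_extend_diff bar_chains_frag_of intro: bar_chains_closed)
qed

lemma D_int_vecs: "k \<in> int_vecs (length rs) \<Longrightarrow> D k \<in> int_vecs N"
proof -
  assume "k \<in> int_vecs (length rs)"
  then have "Poly_Mapping.keys k \<subseteq> {..<length rs}" by simp
  then show ?thesis
  proof (induction k rule: frag_induction)
    case (one j)
    then show ?case using keys_abelianize[OF relator_in_W, of "rs ! j"] by (simp add: D_def)
  next
    case (diff a b)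
    then show ?case using int_vecs_closed(3)[OF diff] by (simp add: D_def frag_extend_diff)
  qed (simp add: D_def)
qed

text \<open>A generator and the chosen word for its value differ by a trivial word, whose
  abelianisation lies in the image of \<open>D\<close>.\<close>

lemma Lambda_alpha:
  assumes "x \<in> int_vecs N"
  shows "\<exists>k \<in> int_vecs (length rs). \<alpha> (\<Lambda> x) = x + D k"
proof -
  have "Poly_Mapping.keys x \<subseteq> {..<N}" using assms by simp
  then show ?thesis
  proof (induction x rule: frag_induction)
    case zero then show ?case by (intro bexI[of _ 0]) (auto simp: \<alpha>_def \<Lambda>_def D_def)
  next
    case (one i)
    let ?p = "[(i, False)]"
    let ?r = "inv_word ?p @ wd (h ?p)"
    have "?p \<in> W" using one by simp
    then have r: "?r \<in> W" "h ?r = \<one>" by (auto simp: wd h_append h_inv_word)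
    then have "D (\<rho> ?r) = abelianize ?r" by (rule_tac D_rho)
    then have "\<alpha> (\<Lambda> (frag_of i)) = frag_of i + D (\<rho> ?r)"
      by (simp add: \<alpha>_def \<Lambda>_def abelianize_append abelianize_inv_word) (simp add: abelianize_def)
    with keys_rho[OF r(2,1)] show ?case by auto
  next
    case (diff a b)
    then obtain k l where "k \<in> int_vecs (length rs)" "\<alpha> (\<Lambda> a) = a + D k" "l \<in> int_vecs (length rs)" "\<alpha> (\<Lambda> b) = b + D l" by blast
    then show ?case using int_vecs_closed(3)[of k "length rs" l]
      by (intro bexI[of _ "k - l"]) (auto simp: \<alpha>_def \<Lambda>_def D_def frag_extend_diff)
  qed
qed

lemma alpha_boundaries: "b \<in> B1 \<Longrightarrow> \<exists>k \<in> int_vecs (length rs). \<alpha> b = D k"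
proof -
  assume "b \<in> B1"
  then obtain c where c: "c \<in> carrier (bar_chains G 2)" "b = bar_boundary G c"
    by (auto simp: bar_boundaries_def eval_nat_numeral)
  then show ?thesis using D_phi[OF c(1)] keys_phi[OF c(1)] by (intro bexI[of _ "\<phi> c"]) auto
qed

text \<open>The map \<open>\<alpha>\<close> sends boundaries into the image of \<open>D\<close> and
  returns \<open>\<Lambda> x\<close> to x modulo that image; conversely \<open>\<gamma>\<close>
  bounds every \<open>\<Lambda> (D k)\<close>.\<close>

lemma Lambda_in_B1_iff:
  assumes "x \<in> int_vecs N"
  shows "\<Lambda> x \<in> B1 \<longleftrightarrow> x \<in> D ` int_vecs (length rs)"
proof
  assume "\<Lambda> x \<in> B1"
  then obtain k where k: "k \<in> int_vecs (length rs)" "\<alpha> (\<Lambda> x) = D k" using alpha_boundaries by blast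
  obtain l where l: "l \<in> int_vecs (length rs)" "\<alpha> (\<Lambda> x) = x + D l" using Lambda_alpha[OF assms] by blast
  have "x = D k - D l" using k(2) l(2) by (simp add: eq_diff_eq)
  then have "x = D (k - l)" by (simp add: D_def frag_extend_diff)
  then show "x \<in> D ` int_vecs (length rs)" using int_vecs_closed(3)[OF k(1) l(1)] by blast
next
  assume "x \<in> D ` int_vecs (length rs)"
  then obtain k where k: "Poly_Mapping.keys k \<subseteq> {..<length rs}" "x = D k" by auto
  then have "\<Lambda> x = bar_boundary G (\<gamma> k)" using boundary_gamma by simp
  then show "\<Lambda> x \<in> B1" using gamma_chains[OF k(1)] by (auto simp: bar_boundaries_def eval_nat_numeral)
qed

lemma chain_eq_Lambda:
  "c \<in> carrier (bar_chains G 1) \<Longrightarrow> \<exists>x\<in>int_vecs N. c - \<Lambda> x \<in> B1"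
proof (induction rule: bar_chain_induct)
  case zero then show ?case using bar_boundaries_0 by (intro bexI[of _ 0]) (auto simp: \<Lambda>_def)
next
  case (one gs)
  then obtain g where gs: "gs = [g]" and g: "g \<in> carrier G" by (auto simp: length_Suc_conv)
  have "- bar_boundary G (\<sigma> (wd g)) \<in> B1"
    by (rule bar_boundaries_minus) (use sigma_chains[OF wd(1)[OF g]] in \<open>auto simp: bar_boundaries_def eval_nat_numeral\<close>)
  then have "frag_of [g] - \<Lambda> (abelianize (wd g)) \<in> B1"
    using g by (simp add: boundary_sigma wd)
  then show ?case using keys_abelianize[OF wd(1)[OF g]] gs by auto
next
  case (diff a b)
  then obtain x y where xy: "x \<in> int_vecs N" "a - \<Lambda> x \<in> B1" "y \<in> int_vecs N" "b - \<Lambda> y \<in> B1" by blast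
  have "a - b - \<Lambda> (x - y) = (a - \<Lambda> x) - (b - \<Lambda> y)" by (simp add: \<Lambda>_def frag_extend_diff)
  then have "a - b - \<Lambda> (x - y) \<in> B1" using bar_boundaries_diff[OF xy(2,4)] by metis
  then show ?case using int_vecs_closed(3)[OF xy(1,3)] by blast
qed

text \<open>With m relators and a relation matrix of rank |J|, the two invariants are m - |J| and N
  - |J|, so the rank cancels in the difference.\<close>

theorem deficiency_homology:
  "int (min_num_generators (group_homology 2 G)) - int (torsion_free_rank (group_homology 1 G)) = int (length rs) - int N"
proof -
  let ?d = "\<lambda>j. abelianize (rs ! j)"
  let ?K = "{x \<in> int_vecs (length rs). D x = 0}" and ?L = "D ` int_vecs (length rs)"
  have d: "?d j \<in> int_vecs N" if "j < length rs" for j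
    using keys_abelianize[OF relator_in_W] that by simp
  obtain B J where B: "int_basis B {x \<in> int_vecs (length rs). frag_extend ?d x = 0}"
    and J: "J \<subseteq> {..<length rs}" "card B + card J = length rs"
    and indJ0: "\<forall>c. int_comb c ?d J = 0 \<longrightarrow> (\<forall>j\<in>J. c j = 0)"
    and spanJ0: "\<forall>x\<in>int_vecs (length rs). \<exists>m c. m \<noteq> 0 \<and> frag_cmul m (frag_extend ?d x) = int_comb c ?d J"
    by (atomize_elim, rule rank_nullity_int[of "length rs" ?d N], rule d)
  note indJ = indJ0[THEN spec, THEN mp] and spanJ = spanJ0[THEN bspec]
  have fJ: "finite J" by (rule finite_subset[OF J(1)]) simp
  have injd: "inj_on ?d J"
  proof (rule inj_onI, rule ccontr)
    fix i j assume i: "i \<in> J" and j: "j \<in> J" and eq: "?d i = ?d j" and ne: "i \<noteq> j"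
    define c :: "nat \<Rightarrow> int" where "c k = (if k = i then 1 else if k = j then -1 else 0)" for k
    have "int_comb c ?d J = int_comb c ?d {i, j}"
      unfolding int_comb_def by (rule sum.mono_neutral_right[OF fJ]) (auto simp: c_def i j)
    also have "\<dots> = 0" using ne by (simp add: int_comb_def c_def eq)
    finally have "\<forall>k\<in>J. c k = 0" by (rule indJ)
    from bspec[OF this i] show False by (simp add: c_def)
  qed
  have K: "0 \<in> ?K" "\<And>x y. x \<in> ?K \<Longrightarrow> y \<in> ?K \<Longrightarrow> x - y \<in> ?K" "\<And>x y. x \<in> ?K \<Longrightarrow> y \<in> ?K \<Longrightarrow> x + y \<in> ?K"
    "\<And>c x. x \<in> ?K \<Longrightarrow> frag_cmul c x \<in> ?K"
    using int_vecs_closed by (auto simp: D_def frag_extend_diff frag_extend_add frag_extend_cmul)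
  have g: "\<gamma> x \<in> bar_cycles G 2" if "x \<in> ?K" for x
    using that gamma_chains boundary_gamma by (simp add: bar_cycles_def \<Lambda>_def)
  have onto: "\<exists>x\<in>?K. z - \<gamma> x \<in> B2" if z: "z \<in> bar_cycles G 2" for z
  proof (rule bexI)
    have zc: "z \<in> carrier (bar_chains G 2)" "bar_boundary G z = 0" using z by (auto simp: bar_cycles_def)
    show "z - \<gamma> (\<phi> z) \<in> B2" using chain_eq_gamma_phi[OF zc(1)] zc(2) by (simp add: \<mu>_def)
    show "\<phi> z \<in> ?K" using keys_phi[OF zc(1)] D_phi[OF zc(1)] zc(2) by (simp add: \<alpha>_def)
  qed
  have add2: "\<gamma> (x + y) = \<gamma> x + \<gamma> y" for x y by (simp add: \<gamma>_def frag_extend_add)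
  have H2: "additive_map (group_homology 2 G) ?K (\<lambda>x. bar_boundaries G 2 #>\<^bsub>bar_cycle_group 2\<^esub> \<gamma> x)"
    by (rule homology_additive_map(1)[OF bar_boundaries_subset_cycles(2) K g add2 onto]; assumption)
  have ker2: "bar_boundaries G 2 #>\<^bsub>bar_cycle_group 2\<^esub> \<gamma> x = \<one>\<^bsub>group_homology 2 G\<^esub> \<longleftrightarrow> \<gamma> x \<in> B2" if "x \<in> ?K" for x
    by (rule homology_additive_map(2)[OF bar_boundaries_subset_cycles(2) K g add2 onto]; (rule that | assumption))
  have "min_num_generators (group_homology 2 G) = card B"
  proof (rule additive_map.min_num_generators_eq[OF H2])
    show "int_basis B ?K" using B by (simp add: D_def)
    fix x assume x: "x \<in> ?K" "bar_boundaries G 2 #>\<^bsub>bar_cycle_group 2\<^esub> \<gamma> x = \<one>\<^bsub>group_homology 2 G\<^esub>"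
    have "\<gamma> x \<in> B2" using ker2[OF x(1)] x(2) by (rule iffD1)
    then have "\<phi> (\<gamma> x) = 0" by (rule phi_boundary)
    then show "x = 0" using phi_gamma[of x] x(1) by (simp add: \<Delta>_def)
  qed
  have K1: "0 \<in> int_vecs N" "\<And>x y. x \<in> int_vecs N \<Longrightarrow> y \<in> int_vecs N \<Longrightarrow> x - y \<in> int_vecs N"
    "\<And>x y. x \<in> int_vecs N \<Longrightarrow> y \<in> int_vecs N \<Longrightarrow> x + y \<in> int_vecs N" "\<And>c x. x \<in> int_vecs N \<Longrightarrow> frag_cmul c x \<in> int_vecs N"
    by (fact int_vecs_closed)+
  have g1: "\<Lambda> x \<in> bar_cycles G 1" if "x \<in> int_vecs N" for x
    using Lambda_chains[OF that] by (simp only: bar_cycles_1)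
  have onto1: "\<exists>x\<in>int_vecs N. z - \<Lambda> x \<in> B1" if "z \<in> bar_cycles G 1" for z
    using chain_eq_Lambda that by (simp only: bar_cycles_1)
  have add1: "\<Lambda> (x + y) = \<Lambda> x + \<Lambda> y" for x y by (simp add: \<Lambda>_def frag_extend_add)
  have H1: "additive_map (group_homology 1 G) (int_vecs N) (\<lambda>x. bar_boundaries G 1 #>\<^bsub>bar_cycle_group 1\<^esub> \<Lambda> x)"
    by (rule homology_additive_map(1)[OF bar_boundaries_subset_cycles(1) K1 g1 add1 onto1]; assumption)
  have ker1: "bar_boundaries G 1 #>\<^bsub>bar_cycle_group 1\<^esub> \<Lambda> x = \<one>\<^bsub>group_homology 1 G\<^esub> \<longleftrightarrow> \<Lambda> x \<in> B1" if "x \<in> int_vecs N" for x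
    by (rule homology_additive_map(2)[OF bar_boundaries_subset_cycles(1) K1 g1 add1 onto1]; (rule that | assumption))
  note ker1 = trans[OF ker1 Lambda_in_B1_iff]
  have "card (?d ` J) \<le> N \<and> torsion_free_rank (group_homology 1 G) = N - card (?d ` J)"
  proof (rule additive_map.torsion_free_rank_eq[OF H1])
    show "?d ` J \<subseteq> ?L"
    proof
      fix x assume "x \<in> ?d ` J"
      then obtain j where j: "j \<in> J" "x = ?d j" by blast
      then have "x = D (frag_of j)" by (simp add: D_def)
      then show "x \<in> ?L" using j J(1) by auto
    qed
    show "rat_indep (?d ` J)"
      unfolding rat_indep_iff[OF finite_imageI[OF fJ]]
    proof (intro allI impI)
      fix c assume "int_comb c (\<lambda>s. s) (?d ` J) = 0"
      then have "int_comb (c \<circ> ?d) ?d J = 0" by (simp add: int_comb_reindex[OF injd] comp_def)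
      from indJ[OF this] show "\<forall>s\<in>?d ` J. c s = 0" by auto
    qed
    show "rat_vec x \<in> rat_span (?d ` J)" if x: "x \<in> ?L" for x
    proof -
      from x obtain k where k: "k \<in> int_vecs (length rs)" "x = D k" by blast
      obtain m c where m: "m \<noteq> 0" "frag_cmul m x = int_comb c ?d J" using spanJ[OF k(1)] k(2) by (auto simp: D_def)
      have "int_comb c ?d J = int_comb (c \<circ> inv_into J ?d) (\<lambda>s. s) (?d ` J)"
        unfolding int_comb_reindex[OF injd] by (rule int_comb_cong) (auto simp: inv_into_f_f[OF injd])
      with m have "frag_cmul m x = int_comb (c \<circ> inv_into J ?d) (\<lambda>s. s) (?d ` J)" by (rule_tac trans)
      with m(1) show ?thesis unfolding rat_span_iff[OF finite_imageI[OF fJ]] by blast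
    qed
    show "?L \<subseteq> int_vecs N" using D_int_vecs by blast
    show "x + y \<in> ?L" if "x \<in> ?L" "y \<in> ?L" for x y
    proof -
      from that obtain k l where "k \<in> int_vecs (length rs)" "x = D k" "l \<in> int_vecs (length rs)" "y = D l" by blast
      then show ?thesis using int_vecs_closed(2)[of k "length rs" l]
        by (intro image_eqI[of _ _ "k + l"]) (auto simp: D_def frag_extend_add)
    qed
    show "frag_cmul c x \<in> ?L" if "x \<in> ?L" for c x
    proof -
      from that obtain k where "k \<in> int_vecs (length rs)" "x = D k" by blast
      then show ?thesis using int_vecs_closed(4)[of k "length rs" c]
        by (intro image_eqI[of _ _ "frag_cmul c k"]) (auto simp: D_def frag_extend_cmul)
    qed
    show "0 \<in> ?L" by (rule image_eqI[of _ _ 0]) (auto simp: D_def)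
  qed (use fJ ker1 in auto)
  then have "card J \<le> N" "torsion_free_rank (group_homology 1 G) = N - card J" by (simp_all add: card_image[OF injd])
  then show ?thesis using \<open>min_num_generators (group_homology 2 G) = card B\<close> J(2) by simp
qed

end

section \<open>Rooted trees in growing order\<close>

section \<open>Spanning trees as lists of edges\<close>

definition visited :: "(nat \<times> nat) list \<Rightarrow> nat set"
  where "visited L = insert 0 (snd ` set L)"

text \<open>Edges are pairs of parent and child, in an order in which a tree rooted at 0 can grow; a
  recursion along the list always finds the parent already treated.\<close>

inductive tree_list :: "(nat \<Rightarrow> nat \<Rightarrow> bool) \<Rightarrow> (nat \<times> nat) list \<Rightarrow> bool" for A
  where
    Nil: "tree_list A []"
  | snoc: "tree_list A L \<Longrightarrow> p \<in> visited L \<Longrightarrow> c \<notin> visited L \<Longrightarrow> A p c \<Longrightarrow> tree_list A (L @ [(p, c)])"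

lemma tree_list_vertex_induct:
  assumes "tree_list A L" "v \<in> visited L" "P 0"
    "\<And>p c. (p, c) \<in> set L \<Longrightarrow> A p c \<Longrightarrow> P p \<Longrightarrow> P c"
  shows "P v"
proof -
  have "\<forall>v\<in>visited M. P v" if "tree_list A M" "set M \<subseteq> set L" for M
    using that
  proof (induction rule: tree_list.induct)
    case Nil then show ?case using assms(3) by (simp add: visited_def)
  next
    case (snoc M p c)
    then have "\<forall>v\<in>visited M. P v" by simp
    moreover have "P c" using assms(4)[of p c] snoc calculation by simp
    ultimately show ?case by (auto simp: visited_def)
  qed
  then show ?thesis using assms(1,2) by blast
qed

lemma tree_list_edge: "tree_list A L \<Longrightarrow> (p, c) \<in> set L \<Longrightarrow> A p c"
  by (induction rule: tree_list.induct) auto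

section \<open>Reidemeister-Schreier rewriting for the powers of the root\<close>

section \<open>The finite-index subgroups\<close>

definition index_adj :: "'a set set \<Rightarrow> (nat \<Rightarrow> 'a) \<Rightarrow> nat \<Rightarrow> nat \<Rightarrow> nat \<Rightarrow> bool"
  where "index_adj K \<mu> N i j \<longleftrightarrow> i < N \<and> j < N \<and> adjacent K (\<mu> i) (\<mu> j)"

text \<open>The word \<open>Y i v\<close> expresses the Schreier generator x_0^i x_v x_0^-j, with j
  the residue of i + 1 modulo n, in the N surviving generators: generator v > 0 is the one at level
  0, and generator 0 is x_0^n. The list \<open>Jl\<close> holds the remaining relators, each an
  oriented edge with a level. By \<open>J_cover\<close> a lifted commutator is listed in one of its
  orientations or has been spent on an instance of \<open>Y_step\<close>.\<close>

locale cyclic_cover =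
  fixes K :: "'a set set" and \<mu> :: "nat \<Rightarrow> 'a" and N n :: nat
    and L :: "(nat \<times> nat) list" and Jl :: "((nat \<times> nat) \<times> nat) list" and Y :: "nat \<Rightarrow> nat \<Rightarrow> nat word"
  assumes bij_mu: "bij_betw \<mu> {..<N} (vertices K)"
    and N_pos: "0 < N" and n_pos: "0 < n"
    and no_triangle: "\<And>u v x. index_adj K \<mu> N u v \<Longrightarrow> index_adj K \<mu> N u x \<Longrightarrow> \<not> index_adj K \<mu> N v x"
    and tree: "tree_list (index_adj K \<mu> N) L" and spanning: "visited L = {..<N}"
    and J_distinct: "distinct Jl"
    and J_adj: "\<And>u v i. ((u, v), i) \<in> set Jl \<Longrightarrow> index_adj K \<mu> N u v \<and> i < n"
    and J_tree: "\<And>u v i. ((u, v), i) \<in> set Jl \<Longrightarrow> (u, v) \<in> set L \<or> (v, u) \<in> set L \<Longrightarrow> i = n - 1"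
    and J_asym: "\<And>u v i j. ((u, v), i) \<in> set Jl \<Longrightarrow> ((v, u), j) \<notin> set Jl"
    and J_cover: "\<And>u v i. index_adj K \<mu> N u v \<Longrightarrow> i < n \<Longrightarrow> ((u, v), i) \<in> set Jl \<or> ((v, u), i) \<in> set Jl \<or>
      ((u, v) \<in> set L \<or> (v, u) \<in> set L) \<and> Suc i < n"
    and Y_init: "\<And>v. 0 < v \<Longrightarrow> v < N \<Longrightarrow> Y 0 v = [(v, False)]"
    and Y_root: "\<And>i. i < n \<Longrightarrow> Y i 0 = (if i = n - 1 then [(0, False)] else [])"
    and Y_step: "\<And>p c i. (p, c) \<in> set L \<Longrightarrow> Suc i < n \<Longrightarrow>
      Y (Suc i) c = inv_word (Y i p) @ Y i c @ Y (Suc i) p"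
begin

abbreviation "adj \<equiv> index_adj K \<mu> N"
abbreviation "V \<equiv> vertices K"
abbreviation "RG \<equiv> {commutator_word u v | u v. adjacent K u v}"
abbreviation "X \<equiv> {..<N}"

definition \<nu> :: "'a \<Rightarrow> nat" where "\<nu> = inv_into {..<N} \<mu>"

lemma nu_less [simp]: "v \<in> V \<Longrightarrow> \<nu> v < N"
  using bij_mu inv_into_into[of v \<mu> "{..<N}"] by (auto simp: \<nu>_def bij_betw_def)

lemma mu_nu [simp]: "v \<in> V \<Longrightarrow> \<mu> (\<nu> v) = v"
  using bij_mu by (auto simp: \<nu>_def bij_betw_def f_inv_into_f)

lemma nu_mu [simp]: "k < N \<Longrightarrow> \<nu> (\<mu> k) = k"
  using bij_mu by (auto simp: \<nu>_def bij_betw_def inv_into_f_f)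

lemma mu_V [simp]: "k < N \<Longrightarrow> \<mu> k \<in> V"
  using bij_mu by (auto simp: bij_betw_def)

lemma mu_eq_iff: "j < N \<Longrightarrow> k < N \<Longrightarrow> \<mu> j = \<mu> k \<longleftrightarrow> j = k"
  using nu_mu by metis

lemma adjacent_nu: "adjacent K u v \<Longrightarrow> u \<in> V \<and> v \<in> V \<and> adj (\<nu> u) (\<nu> v)"
proof -
  assume uv: "adjacent K u v"
  then have "u \<in> V" "v \<in> V" by (auto simp: adjacent_def vertices_def)
  with uv show ?thesis by (simp add: index_adj_def)
qed

text \<open>The lift to level i of the commutator of u and v. For a tree edge from u to v below the
  top level, solving it for \<open>Y (Suc i) v\<close> gives \<open>Y_step\<close>.\<close>

definition rel :: "nat \<Rightarrow> nat \<Rightarrow> nat \<Rightarrow> nat word"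
  where "rel u v i = Y i u @ Y (Suc i mod n) v @ inv_word (Y (Suc i mod n) u) @ inv_word (Y i v)"

definition rels :: "nat word list"
  where "rels = map (\<lambda>((u, v), i). rel u v i) Jl"

lemma Y_words: "i < n \<Longrightarrow> k < N \<Longrightarrow> Y i k \<in> words_over X"
proof (induction i arbitrary: k)
  case 0
  then show ?case using Y_init[of k] Y_root[of 0] N_pos by (cases "k = 0") auto
next
  case (Suc i)
  have "k \<in> visited L" using Suc.prems spanning by simp
  with tree show ?case
  proof (rule tree_list_vertex_induct)
    show "Y (Suc i) 0 \<in> words_over X" using Y_root[of "Suc i"] Suc.prems N_pos by simp
    fix p c assume "(p, c) \<in> set L" "adj p c" "Y (Suc i) p \<in> words_over X"
    then show "Y (Suc i) c \<in> words_over X"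
      using Y_step[of p c i] Suc by (simp add: index_adj_def)
  qed
qed

lemma rel_words: "u < N \<Longrightarrow> v < N \<Longrightarrow> i < n \<Longrightarrow> rel u v i \<in> words_over X"
  using n_pos by (simp add: rel_def Y_words)

lemma rels_words: "set rels \<subseteq> words_over X"
  using J_adj by (fastforce simp: rels_def index_adj_def intro!: rel_words)

sublocale G: presented V RG by unfold_locales (rule raag_relators_words_over)
sublocale P: presented X "set rels" by unfold_locales (rule rels_words)

lemma G_raag: "G.Q = raag K"
  by (simp add: raag_def)

text \<open>Levels are residues below n. The predecessor is formed as i + n - 1 so that truncated
  subtraction does no harm at 0.\<close>

definition nxt :: "bool \<Rightarrow> nat \<Rightarrow> nat"
  where "nxt b i = (if b then (i + n - 1) mod n else Suc i mod n)"

lemma nxt_less [simp]: "nxt b i < n"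
  using n_pos by (simp add: nxt_def)

lemma nxt_inverse [simp]: "i < n \<Longrightarrow> nxt (\<not> b) (nxt b i) = i"
proof -
  assume i: "i < n"
  show ?thesis
  proof (cases b)
    case True
    then show ?thesis using i by (cases i) (auto simp: nxt_def mod_Suc)
  next
    case False
    then show ?thesis using i by (cases "Suc i = n") (auto simp: nxt_def)
  qed
qed

definition state :: "nat \<Rightarrow> 'a word \<Rightarrow> nat"
  where "state i w = fold (\<lambda>l. nxt (snd l)) w i"

lemma state_simps [simp]: "state i [] = i" "state i (l # w) = state (nxt (snd l) i) w"
  by (simp_all add: state_def)

lemma state_append [simp]: "state i (u @ v) = state (state i u) v"
  by (simp add: state_def)

lemma state_less [simp]: "i < n \<Longrightarrow> state i w < n"
  by (induction w arbitrary: i) auto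

lemma state_inv_word: "i < n \<Longrightarrow> state (state i w) (inv_word w) = i"
  by (induction w arbitrary: i) (auto simp: inv_word_Cons inv_letter_def)

lemma state_exponent_sum: "i < n \<Longrightarrow> int (state i w) = (int i + exponent_sum w) mod int n"
proof (induction w arbitrary: i)
  case (Cons l w)
  have 1: "int (nxt (snd l) i) = (int i + exponent_sum [l]) mod int n"
  proof -
    have "(int i + int n - 1) mod int n = (int i - 1) mod int n"
      using mod_add_self2[of "int i - 1" "int n"] by (simp add: algebra_simps)
    then show ?thesis
      using Cons.prems by (simp add: nxt_def exponent_sum_def zmod_int of_nat_diff add.commute)
  qed
  have "exponent_sum (l # w) = exponent_sum [l] + exponent_sum w" by (simp add: exponent_sum_def)
  then show ?case using Cons.IH[of "nxt (snd l) i"] 1 by (simp add: mod_simps add.assoc)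
qed (simp add: exponent_sum_def)

text \<open>The rewriting process started in the coset of level i. An inverse letter contributes the
  inverse of the Schreier generator that begins at the preceding level.\<close>

primrec \<tau> :: "nat \<Rightarrow> 'a word \<Rightarrow> nat word"
  where
    "\<tau> i [] = []"
  | "\<tau> i (l # w) = (if snd l then inv_word (Y (nxt True i) (\<nu> (fst l))) else Y i (\<nu> (fst l))) @ \<tau> (nxt (snd l) i) w"

lemma tau_append: "\<tau> i (u @ v) = \<tau> i u @ \<tau> (state i u) v"
  by (induction u arbitrary: i) auto

lemma tau_words: "w \<in> words_over V \<Longrightarrow> i < n \<Longrightarrow> \<tau> i w \<in> words_over X"
  by (induction w arbitrary: i) (auto simp: Y_words)

lemma tau_inv_word: "w \<in> words_over V \<Longrightarrow> i < n \<Longrightarrow> \<tau> (state i w) (inv_word w) = inv_word (\<tau> i w)"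
proof (induction w arbitrary: i)
  case (Cons l w)
  have "nxt True (nxt False i) = i" using nxt_inverse[of i False] Cons.prems by simp
  with Cons show ?case
    using state_inv_word[of "nxt (snd l) i" w]
    by (auto simp: inv_word_Cons tau_append inv_letter_def inv_word_append)
qed simp

lemma tau_commutator: "i < n \<Longrightarrow> \<tau> i (commutator_word u v) = rel (\<nu> u) (\<nu> v) i"
  using nxt_inverse[of i False] nxt_inverse[of "nxt False i" False]
  by (simp add: commutator_word_def rel_def) (simp add: nxt_def)

lemma state_commutator: "i < n \<Longrightarrow> state i (commutator_word u v) = i"
  using nxt_inverse[of i False] nxt_inverse[of "nxt False i" False]
  by (simp add: commutator_word_def)

definition pw :: "nat \<Rightarrow> 'a word"
  where "pw i = replicate i (\<mu> 0, False)"

text \<open>The Schreier generators of \<open>\<Gamma>\<^sub>n\<close> for the transversal of powers of the root.\<close>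

definition schreier :: "nat \<Rightarrow> nat \<Rightarrow> 'a word"
  where "schreier k i = pw i @ [(\<mu> k, False)] @ inv_word (pw (Suc i mod n))"

definition gen_word :: "nat \<times> bool \<Rightarrow> 'a word"
  where "gen_word l = (let w = if fst l = 0 then schreier 0 (n - 1) else schreier (fst l) 0
    in if snd l then inv_word w else w)"

definition subst :: "nat word \<Rightarrow> 'a word"
  where "subst w = concat (map gen_word w)"

lemma pw_words [simp]: "pw i \<in> words_over V"
  using N_pos by (auto simp: pw_def words_over_def)

lemma schreier_words [simp]: "k < N \<Longrightarrow> schreier k i \<in> words_over V"
  by (simp add: schreier_def)

lemma gen_word_words [simp]: "fst l < N \<Longrightarrow> gen_word l \<in> words_over V"
  using N_pos by (auto simp: gen_word_def Let_def)

lemma subst_simps [simp]: "subst [] = []" "subst (l # w) = gen_word l @ subst w" "subst (u @ v) = subst u @ subst v"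
  by (simp_all add: subst_def)

lemma subst_words [simp]: "w \<in> words_over X \<Longrightarrow> subst w \<in> words_over V"
  by (induction w) auto

lemma gen_word_inv: "gen_word (inv_letter l) = inv_word (gen_word l)"
  by (simp add: gen_word_def inv_letter_def Let_def)

lemma subst_inv_word: "subst (inv_word w) = inv_word (subst w)"
  by (induction w) (auto simp: inv_word_Cons inv_word_append gen_word_inv)

lemma state_pw: "i < n \<Longrightarrow> state 0 (pw i) = i"
proof (induction i)
  case (Suc i)
  have "pw (Suc i) = pw i @ [(\<mu> 0, False)]" by (simp add: pw_def replicate_append_same)
  with Suc show ?case by (simp add: nxt_def)
qed (simp add: pw_def)

lemma tau_pw: "i < n \<Longrightarrow> \<tau> 0 (pw i) = []"
proof (induction i)
  case (Suc i)
  have "pw (Suc i) = pw i @ [(\<mu> 0, False)]" by (simp add: pw_def replicate_append_same)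
  with Suc show ?case using Y_root[of i] N_pos by (simp add: tau_append state_pw)
qed (simp add: pw_def)

lemma state_schreier: "i < n \<Longrightarrow> state 0 (schreier k i) = 0"
  using state_inv_word[of 0 "pw (Suc i mod n)"] state_pw[of "Suc i mod n"] n_pos
  by (simp add: schreier_def state_pw nxt_def)

lemma tau_schreier: "k < N \<Longrightarrow> i < n \<Longrightarrow> \<tau> 0 (schreier k i) = Y i k"
  using tau_inv_word[of "pw (Suc i mod n)" 0] state_pw[of "Suc i mod n"] n_pos
  by (simp add: schreier_def tau_append state_pw tau_pw nxt_def)

lemma state_gen_word: "state 0 (gen_word l) = 0"
proof -
  have "state 0 (inv_word w) = 0" if "state 0 w = 0" for w
    using state_inv_word[of 0 w] that n_pos by simp
  then show ?thesis using state_schreier n_pos by (simp add: gen_word_def Let_def)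
qed

lemma state_subst: "state 0 (subst w) = 0"
  by (induction w) (auto simp: state_gen_word)

lemma tau_gen_word: "fst l < N \<Longrightarrow> \<tau> 0 (gen_word l) = [l]"
proof -
  assume l: "fst l < N"
  have 1: "\<tau> 0 (inv_word (schreier k i)) = inv_word (Y i k)" if "k < N" "i < n" for k i
    using tau_inv_word[of "schreier k i" 0] that state_schreier[of i k] tau_schreier[of k i] n_pos by simp
  show ?thesis
    using l 1 tau_schreier Y_root[of "n - 1"] Y_init[of "fst l"] n_pos
    by (cases l) (auto simp: gen_word_def Let_def inv_word_def inv_letter_def)
qed

text \<open>The equality holds letter by letter, before any reduction. Together with
  \<open>cl_tau_trivial\<close> it makes expansion injective on the presented group.\<close>

lemma tau_subst: "w \<in> words_over X \<Longrightarrow> \<tau> 0 (subst w) = w"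
  by (induction w) (auto simp: tau_append state_gen_word tau_gen_word)

section \<open>Rewriting in an arbitrary graded action\<close>

subsection \<open>Graded actions\<close>

definition graded_action :: "('a \<times> bool \<Rightarrow> 's \<Rightarrow> 's) \<Rightarrow> 's set \<Rightarrow> ('s \<Rightarrow> nat) \<Rightarrow> bool"
  where "graded_action act S d \<longleftrightarrow> letter_action V act S \<and>
    (\<forall>x\<in>S. d x < n \<and> (\<forall>l. fst l \<in> V \<longrightarrow> d (act l x) = nxt (snd l) (d x)))"

lemma graded_action_fold:
  "graded_action act S d \<Longrightarrow> w \<in> words_over V \<Longrightarrow> x \<in> S \<Longrightarrow> d (fold act w x) = state (d x) w \<and> fold act w x \<in> S"
proof (induction w arbitrary: x)
  case (Cons l w)
  then have "act l x \<in> S"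
    unfolding graded_action_def letter_action_def by (cases l) simp
  moreover have "d (act l x) = nxt (snd l) (d x)"
    using Cons.prems unfolding graded_action_def by (cases l) simp
  ultimately show ?case using Cons by simp
qed simp

text \<open>Commutation is assumed for tree edges at grades below n - 1 only, the instances behind
  \<open>Y_step\<close>. This weak form is what the matrix action of an edge can still provide,
  whereas right multiplication in the Artin group provides all of it.\<close>

context
  fixes act :: "'a \<times> bool \<Rightarrow> 's \<Rightarrow> 's" and S d
  assumes act: "graded_action act S d"
    and commute: "\<And>p c x. (p, c) \<in> set L \<Longrightarrow> x \<in> S \<Longrightarrow> Suc (d x) < n \<Longrightarrow>
      act (\<mu> c, False) (act (\<mu> p, False) x) = act (\<mu> p, False) (act (\<mu> c, False) x)"
begin

lemma la: "letter_action V act S"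
  using act by (simp add: graded_action_def)

lemma act_inverse: "v \<in> V \<Longrightarrow> x \<in> S \<Longrightarrow> act (v, False) (act (v, True) x) = x"
  using la[unfolded letter_action_def, rule_format, of "(v, True)" x] by (simp add: inv_letter_def)

lemma fold_subst_root:
  assumes "i < n" "x \<in> S"
  shows "fold act (subst (Y i 0)) x = fold act (schreier 0 i) x"
proof (cases "i = n - 1")
  case True
  then have "subst (Y i 0) = schreier 0 i" using Y_root[OF assms(1)] by (simp add: gen_word_def)
  then show ?thesis by simp
next
  case False
  then have i: "Suc i mod n = Suc i" using assms by simp
  have "schreier 0 i = pw (Suc i) @ inv_word (pw (Suc i))"
    unfolding schreier_def i by (simp add: pw_def replicate_append_same)
  then show ?thesis
    using Y_root[OF assms(1)] False fold_inv_word[OF la pw_words assms(2), of "Suc i"] by simp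
qed

text \<open>Induction on the level, and within a level along the tree from the root. The word of
  \<open>Y_step\<close> goes back along p, across c and forward along p; commutation of p and c at
  grade i turns this detour into the direct step along c.\<close>

lemma fold_subst_Y:
  "i < n \<Longrightarrow> k < N \<Longrightarrow> x \<in> S \<Longrightarrow> d x = 0 \<Longrightarrow> fold act (subst (Y i k)) x = fold act (schreier k i) x"
proof (induction i arbitrary: k x)
  case 0
  show ?case
  proof (cases "k = 0")
    case False
    then show ?thesis using 0 Y_init[of k] by (simp add: gen_word_def)
  qed (use fold_subst_root 0 in simp)
next
  case (Suc i)
  have "k \<in> visited L" using Suc.prems spanning by simp
  from tree this
  have "\<forall>x\<in>S. d x = 0 \<longrightarrow> fold act (subst (Y (Suc i) k)) x = fold act (schreier k (Suc i)) x"
  proof (rule tree_list_vertex_induct)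
    show "\<forall>x\<in>S. d x = 0 \<longrightarrow> fold act (subst (Y (Suc i) 0)) x = fold act (schreier 0 (Suc i)) x"
      using fold_subst_root Suc.prems by simp
    fix p c assume pc: "(p, c) \<in> set L" "adj p c"
      and IHp: "\<forall>x\<in>S. d x = 0 \<longrightarrow> fold act (subst (Y (Suc i) p)) x = fold act (schreier p (Suc i)) x"
    have lt: "p < N" "c < N" using pc by (auto simp: index_adj_def)
    show "\<forall>x\<in>S. d x = 0 \<longrightarrow> fold act (subst (Y (Suc i) c)) x = fold act (schreier c (Suc i)) x"
    proof (intro ballI impI)
      fix x assume x: "x \<in> S" "d x = 0"
      have i: "i < n" "Suc i mod n = Suc i" using Suc.prems by auto
      let ?z = "fold act (pw (Suc i)) x"
      \<comment> \<open>One p-step below \<open>?z\<close>: here the grade is i, so the commutation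
        hypothesis for p and c applies.\<close>
      let ?u = "act (\<mu> p, True) ?z"
      have z: "?z \<in> S" "d ?z = Suc i"
        using graded_action_fold[OF act, of "pw (Suc i)" x] x state_pw[of "Suc i"] Suc.prems by auto
      have u: "?u \<in> S" "d ?u = i"
        using graded_action_fold[OF act, of "[(\<mu> p, True)]" ?z] z lt nxt_inverse[of i False] i
        by (auto simp: nxt_def)
      let ?y = "fold act (inv_word (pw i)) ?u"
      have yi: "?y = fold act (inv_word (schreier p i)) x"
        using i by (simp add: schreier_def inv_word_append inv_word_Cons inv_letter_def)
      have wS: "schreier p i \<in> words_over V" "subst (Y i p) \<in> words_over V" using lt Y_words i by auto
      have y: "?y \<in> S" "d ?y = 0"
        using graded_action_fold[OF act, of "inv_word (schreier p i)" x] x lt yi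
          state_inv_word[of 0 "schreier p i"] state_schreier[of i p] i n_pos by auto
      have "fold act (subst (Y i p)) ?y = fold act (schreier p i) ?y"
        using Suc.IH[of p ?y] i lt y by simp
      also have "\<dots> = x" unfolding yi by (rule fold_inv_word'[OF la wS(1) x(1)])
      finally have 1: "fold act (inv_word (subst (Y i p))) x = ?y"
        using fold_inv_word[OF la wS(2) y(1)] by simp
      have 2: "fold act (subst (Y i c)) ?y = fold act (inv_word (pw (Suc i))) (act (\<mu> c, False) ?u)"
      proof -
        have "fold act (subst (Y i c)) ?y = fold act (schreier c i) ?y"
          using Suc.IH[of c ?y] i lt y by simp
        moreover have "fold act (pw i) ?y = ?u" using fold_inv_word'[OF la _ u(1)] by simp
        ultimately show ?thesis using i by (simp add: schreier_def)
      qed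
      let ?v = "act (\<mu> c, False) ?u"
      have v: "?v \<in> S" "d ?v = Suc i"
        using graded_action_fold[OF act, of "[(\<mu> c, False)]" ?u] u lt i by (auto simp: nxt_def)
      let ?y' = "fold act (inv_word (pw (Suc i))) ?v"
      have y': "?y' \<in> S" "d ?y' = 0"
        using graded_action_fold[OF act, of "inv_word (pw (Suc i))" ?v] v
          state_inv_word[of 0 "pw (Suc i)"] state_pw[of "Suc i"] Suc.prems n_pos by auto
      have pv: "act (\<mu> p, False) ?v = act (\<mu> c, False) ?z"
        using commute[OF pc(1) u(1)] u(2) Suc.prems act_inverse[of "\<mu> p" ?z] lt z by simp
      have "fold act (subst (Y (Suc i) c)) x = fold act (subst (Y (Suc i) p)) ?y'"
        using Y_step[OF pc(1)] Suc.prems by (simp add: subst_inv_word 1 2)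
      also have "\<dots> = fold act (schreier p (Suc i)) ?y'" using IHp y' by simp
      also have "\<dots> = fold act (inv_word (pw (Suc (Suc i) mod n))) (act (\<mu> p, False) ?v)"
        using fold_inv_word'[OF la _ v(1), of "pw (Suc i)"] by (simp add: schreier_def)
      also have "\<dots> = fold act (schreier c (Suc i)) x" by (simp add: pv schreier_def)
      finally show "fold act (subst (Y (Suc i) c)) x = fold act (schreier c (Suc i)) x" .
    qed
  qed
  then show ?case using Suc.prems by blast
qed

text \<open>Each letter becomes a Schreier generator, and the powers of the root between consecutive
  letters cancel, which leaves only the outer two.\<close>

lemma fold_subst_tau:
  "w \<in> words_over V \<Longrightarrow> i < n \<Longrightarrow> x \<in> S \<Longrightarrow> d x = 0 \<Longrightarrow>
    fold act (subst (\<tau> i w)) x = fold act (pw i @ w @ inv_word (pw (state i w))) x"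
proof (induction w arbitrary: i x)
  case Nil
  then show ?case using fold_inv_word[OF la] by simp
next
  case (Cons l w)
  obtain v b where l: "l = (v, b)" by (cases l)
  let ?i = "nxt b i"
  have v: "v \<in> V" using Cons.prems l by simp
  let ?t = "if b then inv_word (Y (nxt True i) (\<nu> v)) else Y i (\<nu> v)"
  let ?x = "fold act (inv_word (pw ?i)) (act l (fold act (pw i) x))"
  have P: "fold act (pw i) x \<in> S" "d (fold act (pw i) x) = i"
    using graded_action_fold[OF act, of "pw i" x] Cons.prems state_pw[of i] by auto
  have aP: "act l (fold act (pw i) x) \<in> S" "d (act l (fold act (pw i) x)) = ?i"
    using graded_action_fold[OF act, of "[l]" "fold act (pw i) x"] P v l by auto
  have x': "?x \<in> S" "d ?x = 0"
    using graded_action_fold[OF act, of "inv_word (pw ?i)", OF _ aP(1)] aP(2)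
      state_inv_word[of 0 "pw ?i"] state_pw[of ?i] n_pos by auto
  have 1: "fold act (subst ?t) x = ?x"
  proof (cases b)
    case False
    then show ?thesis
      using fold_subst_Y[of i "\<nu> v" x] Cons.prems v l by (simp add: schreier_def nxt_def)
  next
    case True
    let ?Y = "Y ?i (\<nu> v)"
    have wS: "subst ?Y \<in> words_over V" using Y_words[of ?i "\<nu> v"] v by simp
    have i: "Suc ?i mod n = i" using nxt_inverse[of i True] Cons.prems True by (simp add: nxt_def)
    have sch: "inv_word (schreier (\<nu> v) ?i) = pw i @ [(v, True)] @ inv_word (pw ?i)"
      using v by (simp add: schreier_def inv_word_append inv_word_Cons inv_letter_def i)
    have x2: "?x = fold act (inv_word (schreier (\<nu> v) ?i)) x" unfolding sch using True l by simp
    have "fold act (subst ?Y) ?x = fold act (schreier (\<nu> v) ?i) ?x"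
      using fold_subst_Y[of ?i "\<nu> v" ?x] x' v by simp
    also have "\<dots> = x" unfolding x2 by (rule fold_inv_word'[OF la]) (use v Cons.prems in auto)
    finally have "fold act (inv_word (subst ?Y)) x = ?x" using fold_inv_word[OF la wS x'(1)] by simp
    then show ?thesis using True by (simp add: subst_inv_word)
  qed
  have "fold act (subst (\<tau> i (l # w))) x = fold act (subst (\<tau> ?i w)) (fold act (subst ?t) x)"
    by (simp add: l)
  also have "\<dots> = fold act (pw ?i @ w @ inv_word (pw (state ?i w))) ?x"
    unfolding 1 by (rule Cons.IH) (use Cons.prems x' in auto)
  also have "\<dots> = fold act (w @ inv_word (pw (state ?i w))) (act l (fold act (pw i) x))"
    using fold_inv_word'[OF la _ aP(1), of "pw ?i"] by simp
  finally show ?case by (simp add: l)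
qed

end

end

lemma (in presented) cl_commute:
  assumes "commutator_word u v \<in> R" "u \<in> X" "v \<in> X"
  shows "cl [(u, False)] \<otimes>\<^bsub>Q\<^esub> cl [(v, False)] = cl [(v, False)] \<otimes>\<^bsub>Q\<^esub> cl [(u, False)]"
proof -
  let ?a = "cl [(u, False)]" and ?b = "cl [(v, False)]"
  have c: "?a \<in> carrier Q" "?b \<in> carrier Q" using assms by auto
  have "commutator_word u v = ([(u, False)] @ [(v, False)]) @ inv_word ([(v, False)] @ [(u, False)])"
    by (simp add: commutator_word_def inv_word_def inv_letter_def)
  then have "(?a \<otimes>\<^bsub>Q\<^esub> ?b) \<otimes>\<^bsub>Q\<^esub> inv\<^bsub>Q\<^esub> (?b \<otimes>\<^bsub>Q\<^esub> ?a) = \<one>\<^bsub>Q\<^esub>"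
    using cl_relator[OF assms(1)] assms
      cl_append[of "[(u, False)] @ [(v, False)]" "inv_word ([(v, False)] @ [(u, False)])"]
      cl_append[of "[(u, False)]" "[(v, False)]"] cl_append[of "[(v, False)]" "[(u, False)]"]
      cl_inv_word[of "[(v, False)] @ [(u, False)]"]
    by simp
  then show ?thesis using Q.inv_equality[of "?a \<otimes>\<^bsub>Q\<^esub> ?b" "inv\<^bsub>Q\<^esub> (?b \<otimes>\<^bsub>Q\<^esub> ?a)"] c by simp
qed

lemma (in presented) cl_Cons: "fst l \<in> X \<Longrightarrow> w \<in> words_over X \<Longrightarrow> cl (l # w) = cl [l] \<otimes>\<^bsub>Q\<^esub> cl w"
  using cl_append[of "[l]" w] by simp

lemma (in presented) cl_cancel:
  assumes "fst l \<in> X" "g \<in> carrier Q"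
  shows "g \<otimes>\<^bsub>Q\<^esub> cl [l] \<otimes>\<^bsub>Q\<^esub> cl [inv_letter l] = g"
  using cl_inv_word[of "[l]"] assms by (simp add: inv_word_def Q.m_assoc Q.r_inv)

lemma (in presented) cl_eq_iff:
  assumes "u \<in> words_over X" "v \<in> words_over X"
  shows "cl u = cl v \<longleftrightarrow> cl (u @ inv_word v) = \<one>\<^bsub>Q\<^esub>"
proof
  assume "cl (u @ inv_word v) = \<one>\<^bsub>Q\<^esub>"
  then have "cl u \<otimes>\<^bsub>Q\<^esub> inv\<^bsub>Q\<^esub> (cl v) = \<one>\<^bsub>Q\<^esub>" using assms by (simp add: cl_append cl_inv_word)
  then show "cl u = cl v" using Q.inv_equality[of "cl u" "inv\<^bsub>Q\<^esub> (cl v)"] assms by simp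
qed (use assms in \<open>simp add: cl_append cl_inv_word Q.r_inv\<close>)

context cyclic_cover
begin

section \<open>The presented group is the finite-index subgroup\<close>

subsection \<open>The isomorphism\<close>

text \<open>Right multiplication. The level is carried along as a second component, so that a grade
  is at hand without passing the exponent sum to cosets.\<close>

definition group_act :: "'a \<times> bool \<Rightarrow> 'a word set \<times> nat \<Rightarrow> 'a word set \<times> nat"
  where "group_act l x = (fst x \<otimes>\<^bsub>G.Q\<^esub> G.cl [l], nxt (snd l) (snd x))"

lemma fold_group_act:
  "w \<in> words_over V \<Longrightarrow> g \<in> carrier G.Q \<Longrightarrow> fold group_act w (g, i) = (g \<otimes>\<^bsub>G.Q\<^esub> G.cl w, state i w)"
proof (induction w arbitrary: g i)
  case (Cons l w)
  then have "G.cl (l # w) = G.cl [l] \<otimes>\<^bsub>G.Q\<^esub> G.cl w" by (intro G.cl_Cons) auto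
  with Cons show ?case by (simp add: group_act_def G.Q.m_assoc)
qed (simp add: group_act_def)

lemma graded_group_act: "graded_action group_act (carrier G.Q \<times> {..<n}) snd"
  unfolding graded_action_def letter_action_def
proof (intro conjI allI impI ballI)
  fix l :: "'a \<times> bool" and x :: "'a word set \<times> nat"
  assume l: "fst l \<in> V" and x: "x \<in> carrier G.Q \<times> {..<n}"
  obtain g i where gi: "x = (g, i)" "g \<in> carrier G.Q" "i < n" using x by auto
  show "group_act l x \<in> carrier G.Q \<times> {..<n}" using l gi by (simp add: group_act_def)
  show "group_act (inv_letter l) (group_act l x) = x"
    using G.cl_cancel[OF l gi(2)] gi by (simp add: group_act_def inv_letter_def)
qed (auto simp: group_act_def)

lemma cl_subst_tau:
  assumes "w \<in> words_over V" "i < n"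
  shows "G.cl (subst (\<tau> i w)) = G.cl (pw i @ w @ inv_word (pw (state i w)))"
proof -
  have "fold group_act (subst (\<tau> i w)) (\<one>\<^bsub>G.Q\<^esub>, 0) =
      fold group_act (pw i @ w @ inv_word (pw (state i w))) (\<one>\<^bsub>G.Q\<^esub>, 0)"
  proof (rule fold_subst_tau[OF graded_group_act _ assms])
    fix p c x assume pc: "(p, c) \<in> set L" and x: "x \<in> carrier G.Q \<times> {..<n}"
    have a: "adj p c" using tree_list_edge[OF tree pc] .
    then have "commutator_word (\<mu> p) (\<mu> c) \<in> RG" "p < N" "c < N" by (auto simp: index_adj_def)
    then show "group_act (\<mu> c, False) (group_act (\<mu> p, False) x) = group_act (\<mu> p, False) (group_act (\<mu> c, False) x)"
      using G.cl_commute[of "\<mu> p" "\<mu> c"] x by (auto simp: group_act_def G.Q.m_assoc)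
  qed (use n_pos in auto)
  moreover have "subst (\<tau> i w) \<in> words_over V" using tau_words[OF assms] by simp
  ultimately show ?thesis
    using assms by (simp add: fold_group_act del: fold_append)
qed

lemma cl_subst_rel:
  assumes "adj u v" "i < n"
  shows "G.cl (subst (rel u v i)) = \<one>\<^bsub>G.Q\<^esub>"
proof -
  have uv: "u < N" "v < N" "adjacent K (\<mu> u) (\<mu> v)" using assms by (auto simp: index_adj_def)
  let ?c = "commutator_word (\<mu> u) (\<mu> v)"
  have c: "?c \<in> words_over V" "?c \<in> RG" using uv G.relators_over by auto
  have "G.cl (subst (rel u v i)) = G.cl (pw i @ ?c @ inv_word (pw i))"
    using cl_subst_tau[OF c(1) assms(2)] uv by (simp add: tau_commutator assms state_commutator)
  also have "\<dots> = \<one>\<^bsub>G.Q\<^esub>"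
    using c G.cl_relator[OF c(2)] by (simp add: G.cl_append G.cl_inv_word G.Q.r_inv)
  finally show ?thesis .
qed

lemma inv_word_rel: "inv_word (rel u v i) = rel v u i"
  by (simp add: rel_def inv_word_append)

text \<open>A tree relator below the top level reduces freely to the empty word by
  \<open>Y_step\<close>, and reversing the orientation of an edge inverts its relator.\<close>

lemma cl_rel:
  assumes "adj u v" "i < n"
  shows "P.cl (rel u v i) = \<one>\<^bsub>P.Q\<^esub>"
proof -
  have in_J: "P.cl (rel u v i) = \<one>\<^bsub>P.Q\<^esub>" if "((u, v), i) \<in> set Jl" for u v
    using that by (intro P.cl_relator) (force simp: rels_def)
  have in_L: "P.cl (rel p c i) = \<one>\<^bsub>P.Q\<^esub>" if pc: "(p, c) \<in> set L" and i: "Suc i < n" for p c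
  proof -
    have "reduce (rel p c i) = []"
      using Y_step[OF pc i] i reduce_cancel'[of "[]" "Y i p" "Y i c @ Y (Suc i) p @ inv_word (Y (Suc i) p) @ inv_word (Y i c)"]
        reduce_cancel'[of "Y i c" "Y (Suc i) p" "inv_word (Y i c)"] reduce_inv_word_right[of "Y i c"]
      by (simp add: rel_def)
    then show ?thesis using P.cl_reduce[of "rel p c i"] by simp
  qed
  have uv: "u < N" "v < N" using assms by (auto simp: index_adj_def)
  have flip: "P.cl (rel u v i) = \<one>\<^bsub>P.Q\<^esub>" if "P.cl (rel v u i) = \<one>\<^bsub>P.Q\<^esub>"
    using P.cl_inv_word[OF rel_words[of v u i]] that uv assms(2) by (simp add: inv_word_rel)
  from J_cover[OF assms] show ?thesis using in_J in_L flip by blast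
qed

text \<open>The action induced from the presented group on n copies of it: a letter moves the coset
  and multiplies by its rewritten form.\<close>

definition cover_act :: "'a \<times> bool \<Rightarrow> nat word set \<times> nat \<Rightarrow> nat word set \<times> nat"
  where "cover_act l x = (fst x \<otimes>\<^bsub>P.Q\<^esub> P.cl (\<tau> (snd x) [l]), nxt (snd l) (snd x))"

lemma fold_cover_act:
  "w \<in> words_over V \<Longrightarrow> q \<in> carrier P.Q \<Longrightarrow> i < n \<Longrightarrow>
    fold cover_act w (q, i) = (q \<otimes>\<^bsub>P.Q\<^esub> P.cl (\<tau> i w), state i w)"
proof (induction w arbitrary: q i)
  case (Cons l w)
  have "\<tau> i (l # w) = \<tau> i [l] @ \<tau> (nxt (snd l) i) w" by simp
  moreover have "\<tau> i [l] \<in> words_over X" "\<tau> (nxt (snd l) i) w \<in> words_over X"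
    using Cons.prems by (auto intro!: tau_words simp del: \<tau>.simps)
  ultimately show ?case
    using Cons by (simp add: cover_act_def P.cl_append P.Q.m_assoc del: \<tau>.simps)
qed (simp add: P.Q.r_one)

lemma letter_action_cover: "letter_action V cover_act (carrier P.Q \<times> {..<n})"
  unfolding letter_action_def
proof (intro allI impI)
  fix l :: "'a \<times> bool" and x :: "nat word set \<times> nat"
  assume l: "fst l \<in> V" and x: "x \<in> carrier P.Q \<times> {..<n}"
  obtain q i where qi: "x = (q, i)" "q \<in> carrier P.Q" "i < n" using x by auto
  have 1: "cover_act l x = (q \<otimes>\<^bsub>P.Q\<^esub> P.cl (\<tau> i [l]), state i [l])"
    using fold_cover_act[of "[l]" q i] qi l by simp
  have t: "\<tau> i [l] \<in> words_over X" using tau_words[of "[l]" i] l qi by simp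
  let ?w = "[l] @ inv_word [l]"
  have w: "?w \<in> words_over V" using l by simp
  have tw: "\<tau> i ?w = \<tau> i [l] @ inv_word (\<tau> i [l])"
    using tau_append[of i "[l]" "inv_word [l]"] tau_inv_word[of "[l]" i] l qi(3) by simp
  have sw: "state i ?w = i"
    using state_append[of i "[l]" "inv_word [l]"] state_inv_word[of i "[l]"] qi(3) by simp
  have "cover_act (inv_letter l) (cover_act l x) = fold cover_act ?w (q, i)"
    by (simp add: qi inv_word_def)
  also have "\<dots> = (q \<otimes>\<^bsub>P.Q\<^esub> P.cl (\<tau> i [l] @ inv_word (\<tau> i [l])), i)"
    unfolding fold_cover_act[OF w qi(2,3)] tw sw ..
  also have "\<dots> = x"
    using t qi by (simp add: P.cl_append P.cl_inv_word P.Q.r_inv P.Q.r_one del: \<tau>.simps)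
  finally have "cover_act (inv_letter l) (cover_act l x) = x" .
  moreover have "cover_act l x \<in> carrier P.Q \<times> {..<n}"
    unfolding 1 using t qi state_less[of i "[l]"] by (auto simp del: \<tau>.simps state_simps)
  ultimately show "cover_act l x \<in> carrier P.Q \<times> {..<n} \<and> cover_act (inv_letter l) (cover_act l x) = x" by simp
qed

text \<open>Rewriting descends to the Artin group because a defining commutator acts at each level
  by its lift, which is trivial by \<open>cl_rel\<close>.\<close>

lemma cl_tau_trivial:
  assumes "w \<in> words_over V" "G.cl w = \<one>\<^bsub>G.Q\<^esub>" "i < n"
  shows "P.cl (\<tau> i w) = \<one>\<^bsub>P.Q\<^esub>"
proof -
  have "fold cover_act w (\<one>\<^bsub>P.Q\<^esub>, i) = (\<one>\<^bsub>P.Q\<^esub>, i)"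
  proof (rule G.trivial_word_acts_trivially[OF letter_action_cover _ assms(2,1)])
    fix r x assume r: "r \<in> RG" and x: "x \<in> carrier P.Q \<times> {..<n}"
    obtain q j where qj: "x = (q, j)" "q \<in> carrier P.Q" "j < n" using x by auto
    from r obtain u v where uv: "r = commutator_word u v" "adjacent K u v" by blast
    have "r \<in> words_over V" using r G.relators_over by blast
    then show "fold cover_act r x = x"
      using qj uv adjacent_nu[OF uv(2)] fold_cover_act[of r q j]
      by (simp add: tau_commutator state_commutator cl_rel P.Q.r_one)
  qed (use assms n_pos in auto)
  then show ?thesis
    using fold_cover_act[OF assms(1) _ assms(3), of "\<one>\<^bsub>P.Q\<^esub>"] tau_words[OF assms(1,3)] by (simp add: P.Q.l_one)
qed

text \<open>In one direction the expanded relators are trivial in the Artin group; in the other,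
  rewriting undoes expansion.\<close>

lemma cl_subst_iff:
  assumes w: "w \<in> words_over X"
  shows "P.cl w = \<one>\<^bsub>P.Q\<^esub> \<longleftrightarrow> G.cl (subst w) = \<one>\<^bsub>G.Q\<^esub>"
proof
  assume "G.cl (subst w) = \<one>\<^bsub>G.Q\<^esub>"
  then have "P.cl (\<tau> 0 (subst w)) = \<one>\<^bsub>P.Q\<^esub>" by (rule cl_tau_trivial[rotated]) (use w n_pos in auto)
  then show "P.cl w = \<one>\<^bsub>P.Q\<^esub>" by (simp add: tau_subst w)
next
  assume triv: "P.cl w = \<one>\<^bsub>P.Q\<^esub>"
  define act where "act l g = g \<otimes>\<^bsub>G.Q\<^esub> G.cl (gen_word l)" for l g
  have fold: "fold act u g = g \<otimes>\<^bsub>G.Q\<^esub> G.cl (subst u)" if "u \<in> words_over X" "g \<in> carrier G.Q" for u g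
    using that by (induction u arbitrary: g) (auto simp: act_def G.cl_append G.Q.m_assoc G.Q.r_one)
  have "fold act w \<one>\<^bsub>G.Q\<^esub> = \<one>\<^bsub>G.Q\<^esub>"
  proof (rule P.trivial_word_acts_trivially[OF _ _ triv w])
    show "letter_action X act (carrier G.Q)"
      by (auto simp: letter_action_def act_def gen_word_inv G.cl_inv_word G.Q.m_assoc G.Q.r_inv G.Q.r_one)
    fix r g assume r: "r \<in> set rels" and g: "g \<in> carrier G.Q"
    from r obtain u v i where "((u, v), i) \<in> set Jl" "r = rel u v i" by (auto simp: rels_def)
    then show "fold act r g = g"
      using fold[of r g] g r rels_words cl_subst_rel[of u v i] J_adj[of u v i] by (auto simp: G.Q.r_one)
  qed simp
  then show "G.cl (subst w) = \<one>\<^bsub>G.Q\<^esub>" using fold[OF w, of "\<one>\<^bsub>G.Q\<^esub>"] w by (simp add: G.Q.l_one)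
qed

lemma raag_proj_cl: "w \<in> words_over V \<Longrightarrow> raag_proj (G.cl w) = exponent_sum w"
  using raag_proj_coset[OF reduce_in_free_group, of w K] by (simp add: word_class_def exponent_sum_reduce)

lemma state_0_iff: "state 0 w = 0 \<longleftrightarrow> int n dvd exponent_sum w"
  using state_exponent_sum[of 0 w] n_pos by (simp add: dvd_eq_mod_eq_0 flip: of_nat_eq_0_iff[where 'a = int])

lemma carrier_Gamma: "carrier (Gamma K n) = {G.cl w | w. w \<in> words_over V \<and> state 0 w = 0}"
  using G.carrier_presented by (auto simp: Gamma_def G_raag[symmetric] raag_proj_cl state_0_iff)

lemma Gamma_simps: "mult (Gamma K n) = mult G.Q" "one (Gamma K n) = one G.Q"
  by (simp_all add: Gamma_def raag_def)

lemma subst_onto: "(\<lambda>w. G.cl (subst w)) ` words_over X = carrier (Gamma K n)"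
proof
  show "(\<lambda>w. G.cl (subst w)) ` words_over X \<subseteq> carrier (Gamma K n)"
    using state_subst by (auto simp: carrier_Gamma)
  show "carrier (Gamma K n) \<subseteq> (\<lambda>w. G.cl (subst w)) ` words_over X"
  proof
    fix g assume "g \<in> carrier (Gamma K n)"
    then obtain w where w: "w \<in> words_over V" "state 0 w = 0" "g = G.cl w" by (auto simp: carrier_Gamma)
    then have "g = G.cl (subst (\<tau> 0 w))" using cl_subst_tau[of w 0] n_pos by (simp add: pw_def)
    then show "g \<in> (\<lambda>w. G.cl (subst w)) ` words_over X" using tau_words[OF w(1), of 0] n_pos by blast
  qed
qed

lemma group_Gamma: "group (Gamma K n)"
proof -
  have "subgroup (carrier (Gamma K n)) G.Q"
  proof (rule G.Q.subgroupI)
    show "carrier (Gamma K n) \<subseteq> carrier G.Q" by (auto simp: carrier_Gamma)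
    show "carrier (Gamma K n) \<noteq> {}" unfolding subst_onto[symmetric] using words_over_Nil by blast
    show "inv\<^bsub>G.Q\<^esub> g \<in> carrier (Gamma K n)" if "g \<in> carrier (Gamma K n)" for g
    proof -
      from that obtain w where w: "w \<in> words_over X" "g = G.cl (subst w)" unfolding subst_onto[symmetric] by blast
      have "inv\<^bsub>G.Q\<^esub> g = G.cl (subst (inv_word w))" using w by (simp add: subst_inv_word G.cl_inv_word)
      then show ?thesis unfolding subst_onto[symmetric] using w by auto
    qed
    show "g \<otimes>\<^bsub>G.Q\<^esub> h \<in> carrier (Gamma K n)" if "g \<in> carrier (Gamma K n)" "h \<in> carrier (Gamma K n)" for g h
    proof -
      from that obtain u w where w: "w \<in> words_over X" "g = G.cl (subst w)" "u \<in> words_over X" "h = G.cl (subst u)"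
        unfolding subst_onto[symmetric] by blast
      have "g \<otimes>\<^bsub>G.Q\<^esub> h = G.cl (subst (w @ u))" using w by (simp add: G.cl_append)
      then show ?thesis unfolding subst_onto[symmetric] using w by (intro image_eqI[of _ _ "w @ u"]) auto
    qed
  qed
  then have "group (G.Q\<lparr>carrier := carrier (Gamma K n)\<rparr>)" by (rule G.Q.subgroup_imp_group)
  then show ?thesis by (simp add: Gamma_def raag_def)
qed

theorem presents_Gamma: "presents (Presentation N rels) (Gamma K n)"
proof -
  have same: "P.cl u = P.cl v \<longleftrightarrow> G.cl (subst u) = G.cl (subst v)" if "u \<in> words_over X" "v \<in> words_over X" for u v
    using cl_subst_iff[of "u @ inv_word v"] P.cl_eq_iff[OF that] G.cl_eq_iff[of "subst u" "subst v"] that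
    by (simp add: subst_inv_word)
  define rep where "rep q = (SOME w. w \<in> words_over X \<and> P.cl w = q)" for q
  have rep: "rep q \<in> words_over X \<and> P.cl (rep q) = q" if "q \<in> carrier P.Q" for q
    unfolding rep_def by (rule someI_ex) (use that P.carrier_presented in auto)
  define f where "f q = G.cl (subst (rep q))" for q
  have f: "f (P.cl w) = G.cl (subst w)" if "w \<in> words_over X" for w
    using same[of "rep (P.cl w)" w] rep[of "P.cl w"] that by (simp add: f_def)
  have "f \<in> iso P.Q (Gamma K n)"
  proof (rule isoI)
    show "f \<in> hom P.Q (Gamma K n)"
    proof (rule homI)
      fix x y assume "x \<in> carrier P.Q" "y \<in> carrier P.Q"
      then obtain u v where "u \<in> words_over X" "v \<in> words_over X" "x = P.cl u" "y = P.cl v"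
        using P.carrier_presented by auto
      then show "f (x \<otimes>\<^bsub>P.Q\<^esub> y) = f x \<otimes>\<^bsub>Gamma K n\<^esub> f y"
        using f[of "u @ v"] f[of u] f[of v] by (simp add: P.cl_append G.cl_append Gamma_simps)
    next
      fix x assume "x \<in> carrier P.Q"
      then show "f x \<in> carrier (Gamma K n)"
        using rep[of x] unfolding f_def subst_onto[symmetric] by blast
    qed
    show "bij_betw f (carrier P.Q) (carrier (Gamma K n))"
      unfolding bij_betw_def
    proof
      show "inj_on f (carrier P.Q)"
      proof (rule inj_onI)
        fix x y assume xy: "x \<in> carrier P.Q" "y \<in> carrier P.Q" "f x = f y"
        then have "P.cl (rep x) = P.cl (rep y)" using same[of "rep x" "rep y"] rep by (simp add: f_def)
        then show "x = y" using rep xy by simp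
      qed
      show "f ` carrier P.Q = carrier (Gamma K n)"
        unfolding subst_onto[symmetric] P.carrier_presented image_image using f by (intro image_cong) auto
    qed
  qed
  then show ?thesis using rels_words by (auto simp: presents_def is_iso_def)
qed

end

context cyclic_cover
begin

section \<open>Dual homomorphisms from the matrix actions of edges\<close>

subsection \<open>Independence of the relators\<close>

text \<open>The fact is read off from a one-letter word. An arbitrary vertex serves as its letter,
  since levels depend only on the sign.\<close>

lemma int_nxt: "i < n \<Longrightarrow> int (nxt b i) = (int i + (if b then -1 else 1)) mod int n"
  using state_exponent_sum[of i "[(undefined, b)]"] by (auto simp: exponent_sum_def)

text \<open>As a function of k, \<open>delta (k - l)\<close> is the monomial t^l in the Laurent
  polynomials with t^n = 1.\<close>

definition delta :: "int \<Rightarrow> int"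
  where "delta k = of_bool (int n dvd k)"

text \<open>
  For an edge \<open>{u, v}\<close> without common neighbours, the unipotent matrices over \<open>\<int>[t, t\<inverse>]\<close>
  with diagonals \<open>(t, 1, 1)\<close> for \<open>u\<close> and the neighbours of \<open>v\<close>, and \<open>(1, 1, t\<inverse>)\<close> for \<open>v\<close> and all
  other vertices, satisfy every commutation relation except that of \<open>u\<close> and \<open>v\<close>. The state
  \<open>(l, a, p, m)\<close> records the first row of such a product: \<open>t\<^sup>l\<close> and \<open>t\<^sup>-\<^sup>a\<close> are the diagonal
  entries, \<open>p\<close> is the middle entry and \<open>m\<close> is the coefficient with index \<open>i\<close> of the
  normalised corner entry, exponents being taken modulo \<open>n\<close>.
\<close>

type_synonym edge_state = "int \<times> int \<times> (int \<Rightarrow> int) \<times> int"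

fun edge_act :: "nat \<Rightarrow> nat \<Rightarrow> nat \<Rightarrow> 'a \<times> bool \<Rightarrow> edge_state \<Rightarrow> edge_state"
  where "edge_act u v i (x, b) (l, a, p, m) =
    (if x = \<mu> u then (if b then (l - 1, a, (\<lambda>k. p k - delta (k - (l - 1))), m)
                          else (l + 1, a, (\<lambda>k. p k + delta (k - l)), m))
     else if x = \<mu> v then (if b then (l, a - 1, p, m - p (int i - (a - 1)))
                               else (l, a + 1, p, m + p (int i - a)))
     else if adjacent K (\<mu> v) x then (l + (if b then -1 else 1), a, p, m)
     else (l, a + (if b then -1 else 1), p, m))"

definition shift :: "int \<Rightarrow> edge_state \<Rightarrow> edge_state"
  where "shift t s = (case s of (l, a, p, m) \<Rightarrow> (l, a, p, m + t))"

text \<open>Every positive letter raises exactly one of the two diagonal exponents by one, so their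
  sum follows the exponent sum.\<close>

definition level :: "edge_state \<Rightarrow> int"
  where "level s = (case s of (l, a, p, m) \<Rightarrow> l + a)"

lemma letter_action_edge: "letter_action V (edge_act u v i) UNIV"
  by (auto simp: letter_action_def inv_letter_def)

lemma level_edge_act: "level (edge_act u v i l s) = level s + exponent_sum [l]"
  by (cases l; cases s) (auto simp: level_def exponent_sum_def)

lemma level_fold: "level (fold (edge_act u v i) w s) = level s + exponent_sum w"
proof (induction w arbitrary: s)
  case (Cons l w)
  have "exponent_sum (l # w) = exponent_sum [l] + exponent_sum w" by (simp add: exponent_sum_def)
  with Cons show ?case by (simp add: level_edge_act)
qed (simp add: exponent_sum_def)

lemma level_shift [simp]: "level (shift t s) = level s"
  by (cases s) (simp add: level_def shift_def)

lemma edge_act_shift: "edge_act u v i l (shift t s) = shift t (edge_act u v i l s)"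
  by (cases l; cases s) (auto simp: shift_def)

lemma fold_shift: "fold (edge_act u v i) w (shift t s) = shift t (fold (edge_act u v i) w s)"
  by (induction w arbitrary: s) (auto simp: edge_act_shift)

lemma shift_0 [simp]: "shift 0 s = s" and shift_shift [simp]: "shift t (shift r s) = shift (t + r) s"
  by (cases s, simp add: shift_def)+

definition grade :: "edge_state \<Rightarrow> nat"
  where "grade s = nat (level s mod int n)"

lemma grade_less [simp]: "grade s < n"
  using n_pos by (simp add: grade_def nat_less_iff)

lemma graded_edge_act: "graded_action (edge_act u v i) UNIV grade"
proof -
  have "grade (edge_act u v i l s) = nxt (snd l) (grade s)" for l s
  proof -
    have "int (nxt (snd l) (grade s)) = (int (grade s) + (if snd l then -1 else 1)) mod int n"
      by (rule int_nxt) simp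
    also have "\<dots> = (level s + exponent_sum [l]) mod int n"
      using n_pos by (simp add: grade_def mod_simps exponent_sum_def)
    also have "\<dots> = int (grade (edge_act u v i l s))"
      using n_pos by (simp add: grade_def level_edge_act)
    finally show ?thesis by simp
  qed
  then show ?thesis using letter_action_edge by (simp add: graded_action_def)
qed

definition edge_sign :: "nat \<Rightarrow> nat \<Rightarrow> 'a \<Rightarrow> 'a \<Rightarrow> int"
  where "edge_sign u v x y = of_bool (x = \<mu> u \<and> y = \<mu> v) - of_bool (x = \<mu> v \<and> y = \<mu> u)"

text \<open>If u acts before v, then v reads at index \<open>int i - a\<close> the monomial that u
  has just added at l; its coefficient there is 1 exactly when the level l + a is i modulo n. For
  every other edge the two letters touch independent components: a further neighbour of u is no
  neighbour of v and moves only the second exponent, and a further neighbour of v moves only the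
  first.\<close>

lemma edge_act_swap:
  assumes "adj u v" "adjacent K x y"
  shows "edge_act u v i (y, False) (edge_act u v i (x, False) s) =
    shift (edge_sign u v x y * delta (int i - level s)) (edge_act u v i (x, False) (edge_act u v i (y, False) s))"
proof -
  have uv: "\<mu> u \<noteq> \<mu> v" "adjacent K (\<mu> u) (\<mu> v)" "adjacent K (\<mu> v) (\<mu> u)"
    using assms(1) by (auto simp: index_adj_def adjacent_def insert_commute)
  have xy: "x \<noteq> y" "adjacent K y x" "x \<in> V" "y \<in> V"
    using assms(2) adjacent_nu by (auto simp: adjacent_def insert_commute)
  have tri: False if "adjacent K (\<mu> u) z" "adjacent K (\<mu> v) z" for z
    using no_triangle[OF assms(1), of "\<nu> z"] that assms(1) adjacent_nu[OF that(1)] by (auto simp: index_adj_def)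
  obtain l a p m where s: "s = (l, a, p, m)" by (cases s)
  have e: "int i - a - l = int i - (l + a)" by simp
  show ?thesis
    using uv xy assms(2) tri[of x] tri[of y]
    by (auto simp: s shift_def level_def edge_sign_def e)
qed

lemma fold_commutator:
  assumes "adj u v" "adjacent K x y"
  shows "fold (edge_act u v i) (commutator_word x y) s = shift (edge_sign u v x y * delta (int i - level s)) s"
proof -
  let ?E = "edge_act u v i"
  have V: "x \<in> V" "y \<in> V" using adjacent_nu[OF assms(2)] by auto
  have inv: "?E (z, True) (?E (z, False) r) = r" if "z \<in> V" for z r
    using letter_action_edge[of u v i, unfolded letter_action_def, rule_format, of "(z, False)" r] that
    by (simp add: inv_letter_def)
  show ?thesis
    by (simp add: commutator_word_def edge_act_swap[OF assms] edge_act_shift inv V del: edge_act.simps)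
qed

text \<open>The amount may depend on the level, but only modulo n. Periodicity lets the amount at
  level 0 speak for all states whose level is divisible by n.\<close>

definition translation :: "nat \<Rightarrow> nat \<Rightarrow> nat \<Rightarrow> 'a word \<Rightarrow> (int \<Rightarrow> int) \<Rightarrow> bool"
  where "translation u v i w c \<longleftrightarrow> (\<forall>s. fold (edge_act u v i) w s = shift (c (level s)) s) \<and>
    (\<forall>j k. int n dvd j - k \<longrightarrow> c j = c k)"

lemma translationD: "translation u v i w c \<Longrightarrow> fold (edge_act u v i) w s = shift (c (level s)) s"
  unfolding translation_def by blast

lemma translation_periodic: "translation u v i w c \<Longrightarrow> int n dvd j - k \<Longrightarrow> c j = c k"
  unfolding translation_def by blast

lemma translationI:
  "(\<And>s. fold (edge_act u v i) w s = shift (c (level s)) s) \<Longrightarrow> (\<And>j k. int n dvd j - k \<Longrightarrow> c j = c k) \<Longrightarrow>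
    translation u v i w c"
  unfolding translation_def by blast

lemma delta_cong: "int n dvd j - k \<Longrightarrow> delta j = delta k"
  using dvd_add_right_iff[of "int n" "j - k" k] by (simp add: delta_def)

lemma trivial_translation:
  assumes "adj u v" "G.cl w = \<one>\<^bsub>G.Q\<^esub>" "w \<in> words_over V"
  shows "\<exists>c. translation u v i w c"
  using assms(2,3)
proof (induction rule: G.trivial_word_induct)
  case (reduce w)
  then show ?case using fold_reduce[OF letter_action_edge] by (simp add: translation_def)
next
  case Nil
  show ?case by (rule exI[of _ "\<lambda>_. 0"]) (simp add: translation_def)
next
  case (append w w')
  then obtain c c' where c: "translation u v i w c" "translation u v i w' c'" by blast
  have "translation u v i (w @ w') (\<lambda>k. c k + c' k)"
  proof (rule translationI)
    show "fold (edge_act u v i) (w @ w') s = shift (c (level s) + c' (level s)) s" for s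
      by (simp add: translationD[OF c(1)] translationD[OF c(2)] fold_shift)
    show "c j + c' j = c k + c' k" if "int n dvd j - k" for j k
      using translation_periodic[OF c(1) that] translation_periodic[OF c(2) that] by simp
  qed
  then show ?case by blast
next
  case (relator g r)
  then obtain x y where r: "r = commutator_word x y" "adjacent K x y" by blast
  \<comment> \<open>The relator is met only after g, hence at a level raised by the exponent sum of
    g.\<close>
  let ?c = "\<lambda>k. edge_sign u v x y * delta (int i - (k + exponent_sum g))"
  have "translation u v i (g @ r @ inv_word g) ?c"
  proof (rule translationI)
    fix s
    show "fold (edge_act u v i) (g @ r @ inv_word g) s = shift (?c (level s)) s"
      using fold_inv_word[OF letter_action_edge relator(1), of s]
      by (simp add: r fold_commutator[OF assms(1) r(2)] fold_shift level_fold)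
    fix j k :: int assume "int n dvd j - k"
    then have "int n dvd (int i - (j + exponent_sum g)) - (int i - (k + exponent_sum g))"
      by (simp add: dvd_diff_commute)
    from delta_cong[OF this] show "?c j = ?c k" by simp
  qed
  then show ?case by blast
next
  case (inverse w)
  then obtain c where c: "translation u v i w c" by blast
  have "translation u v i (inv_word w) (\<lambda>k. - c k)"
  proof (rule translationI)
    fix s
    have "fold (edge_act u v i) w (shift (- c (level s)) s) = s"
      by (simp add: translationD[OF c] fold_shift)
    moreover have "fold (edge_act u v i) (inv_word w) (fold (edge_act u v i) w (shift (- c (level s)) s)) =
        shift (- c (level s)) s"
      by (rule fold_inv_word[OF letter_action_edge inverse(1)]) simp
    ultimately show "fold (edge_act u v i) (inv_word w) s = shift (- c (level s)) s" by simp
  qed (use translation_periodic[OF c] in simp)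
  then show ?case by blast
qed

text \<open>The word is in the generators of the subgroup and is expanded first. It is enough to
  start at level 0, because expanded words change the level by multiples of n.\<close>

definition corner :: "nat \<Rightarrow> nat \<Rightarrow> nat \<Rightarrow> nat word \<Rightarrow> int"
  where "corner u v i w = snd (snd (snd (fold (edge_act u v i) (subst w) (0, 0, \<lambda>_. 0, 0))))"

lemma level_subst: "int n dvd exponent_sum (subst w)"
  using state_subst[of w] by (simp add: state_0_iff)

lemma corner_translation:
  assumes "translation u v i (subst w) c"
  shows "corner u v i w = c 0" "int n dvd level s \<Longrightarrow> fold (edge_act u v i) (subst w) s = shift (corner u v i w) s"
proof -
  show 1: "corner u v i w = c 0"
    by (simp add: corner_def translationD[OF assms]) (simp add: shift_def level_def)
  assume "int n dvd level s"
  then have "c (level s) = c 0" using translation_periodic[OF assms, of "level s" 0] by simp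
  then show "fold (edge_act u v i) (subst w) s = shift (corner u v i w) s"
    by (simp add: translationD[OF assms] 1)
qed

lemma corner_shift:
  assumes "adj u v" "w \<in> words_over X" "P.cl w = \<one>\<^bsub>P.Q\<^esub>" "int n dvd level s"
  shows "fold (edge_act u v i) (subst w) s = shift (corner u v i w) s"
proof -
  have "G.cl (subst w) = \<one>\<^bsub>G.Q\<^esub>" using assms cl_subst_iff by blast
  then obtain c where "translation u v i (subst w) c" using trivial_translation[OF assms(1), of "subst w" i] assms(2) by auto
  from corner_translation(2)[OF this assms(4)] show ?thesis .
qed

lemma corner_eqI: "fold (edge_act u v i) (subst w) (0, 0, \<lambda>_. 0, 0) = shift t (0, 0, \<lambda>_. 0, 0) \<Longrightarrow> corner u v i w = t"
  by (simp add: corner_def shift_def)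

lemma level_origin [simp]: "level (0, 0, p, m) = 0"
  by (simp add: level_def)

lemma corner_append:
  assumes "adj u v" "w \<in> words_over X" "P.cl w = \<one>\<^bsub>P.Q\<^esub>" "w' \<in> words_over X" "P.cl w' = \<one>\<^bsub>P.Q\<^esub>"
  shows "corner u v i (w @ w') = corner u v i w + corner u v i w'"
  by (rule corner_eqI) (use assms in \<open>simp add: corner_shift fold_shift add.commute\<close>)

text \<open>The conjugator is also expanded, so it returns to a level divisible by n, where the
  trivial word translates by the same amount.\<close>

lemma corner_conj:
  assumes "adj u v" "w \<in> words_over X" "P.cl w = \<one>\<^bsub>P.Q\<^esub>" "g \<in> words_over X"
  shows "corner u v i (g @ w @ inv_word g) = corner u v i w"
proof (rule corner_eqI)
  let ?s = "(0, 0, \<lambda>_. 0, 0) :: edge_state"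
  have "int n dvd level (fold (edge_act u v i) (subst g) ?s)" by (simp add: level_fold level_subst)
  then show "fold (edge_act u v i) (subst (g @ w @ inv_word g)) ?s = shift (corner u v i w) ?s"
    using assms fold_inv_word[OF letter_action_edge, of "subst g" ?s]
    by (simp add: corner_shift fold_shift subst_inv_word)
qed

text \<open>Each generator is made to act through its expansion, so reduction in the surviving
  generators can be compared without reducing the expanded words.\<close>

lemma corner_reduce:
  assumes "w \<in> words_over X"
  shows "corner u v i (reduce w) = corner u v i w"
proof -
  have la: "letter_action X (\<lambda>l. fold (edge_act u v i) (gen_word l)) UNIV"
    unfolding letter_action_def
    by (auto simp: gen_word_inv fold_inv_word[OF letter_action_edge] simp del: split_paired_All)
  have "fold (edge_act u v i) (subst w) s = fold (\<lambda>l. fold (edge_act u v i) (gen_word l)) w s" for w s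
    by (induction w arbitrary: s) auto
  then show ?thesis using fold_reduce[OF la assms UNIV_I] by (simp add: corner_def)
qed

text \<open>By \<open>fold_subst_tau\<close> the relator acts as a commutator framed by powers of
  the root and met at level i'. It sees the failure of commutation exactly when edge and level are
  the same.\<close>

lemma corner_rel:
  assumes J: "((u, v), i) \<in> set Jl" "((u', v'), i') \<in> set Jl"
  shows "corner u v i (rel u' v' i') = of_bool (u = u' \<and> v = v' \<and> i = i')"
proof (rule corner_eqI)
  let ?s = "(0, 0, \<lambda>_. 0, 0) :: edge_state"
  let ?c = "commutator_word (\<mu> u') (\<mu> v')"
  have uv: "adj u v" "i < n" "adj u' v'" "i' < n" using J_adj[OF J(1)] J_adj[OF J(2)] by blast+
  then have lt: "u < N" "v < N" "u' < N" "v' < N" and a': "adjacent K (\<mu> u') (\<mu> v')" by (auto simp: index_adj_def)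
  have c: "?c \<in> words_over V" using a' G.relators_over by blast
  have sign: "edge_sign u v (\<mu> u') (\<mu> v') * delta (int i - int i') = of_bool (u = u' \<and> v = v' \<and> i = i')"
  proof -
    have "int n dvd int i - int i' \<longleftrightarrow> i = i'"
      using mod_eq_dvd_iff[of "int i" "int n" "int i'"] uv(2,4) by simp
    moreover have "edge_sign u v (\<mu> u') (\<mu> v') = of_bool (u' = u \<and> v' = v)"
    proof -
      \<comment> \<open>Only one orientation of an edge is listed, which excludes the sign
        -1.\<close>
      have "((v, u), i') \<notin> set Jl" using J_asym[OF J(1)] .
      then have ne: "(u' = v \<and> v' = u) = False" using J(2) by (cases "u' = v"; cases "v' = u") simp_all
      show ?thesis
        unfolding edge_sign_def mu_eq_iff[OF lt(3,1)] mu_eq_iff[OF lt(4,2)] mu_eq_iff[OF lt(3,2)] mu_eq_iff[OF lt(4,1)] ne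
        by (rule trans[OF _ diff_0_right]) (simp only: of_bool_eq)
    qed
    ultimately show ?thesis by (cases "u' = u"; cases "v' = v"; cases "i = i'") (simp_all add: delta_def)
  qed
  have "fold (edge_act u v i) (subst (rel u' v' i')) ?s = fold (edge_act u v i) (subst (\<tau> i' ?c)) ?s"
    using lt uv by (simp add: tau_commutator)
  also have "\<dots> = fold (edge_act u v i) (pw i' @ ?c @ inv_word (pw (state i' ?c))) ?s"
  proof (rule fold_subst_tau[OF graded_edge_act _ c uv(4)])
    fix p d s assume pd: "(p, d) \<in> set L" and g: "Suc (grade s) < n"
    have adj: "adj p d" using tree_list_edge[OF tree pd] .
    then have a: "adjacent K (\<mu> p) (\<mu> d)" "p < N" "d < N" by (auto simp: index_adj_def)
    \<comment> \<open>If {u, v} is itself a tree edge, then i is n - 1, whereas rewriting calls for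
      commutation only at grades below n - 1; the monomial obstructing it has coefficient zero
      there.\<close>
    have zero: "edge_sign u v (\<mu> p) (\<mu> d) * delta (int i - level s) = 0"
    proof (cases "edge_sign u v (\<mu> p) (\<mu> d) = 0")
      case False
      then have "(u, v) \<in> set L \<or> (v, u) \<in> set L"
        using pd lt a by (auto simp: edge_sign_def mu_eq_iff of_bool_def split: if_splits)
      then have i: "i = n - 1" using J_tree[OF J(1)] by blast
      have "\<not> int n dvd int i - level s"
      proof
        assume "int n dvd int i - level s"
        then have "int i mod int n = level s mod int n" by (simp add: mod_eq_dvd_iff)
        also have "\<dots> = int (grade s)" using n_pos by (simp add: grade_def)
        finally have "i = grade s" using uv(2) by simp
        then show False using i g by simp
      qed
      then show ?thesis by (simp add: delta_def)
    qed simp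
    show "edge_act u v i (\<mu> d, False) (edge_act u v i (\<mu> p, False) s) = edge_act u v i (\<mu> p, False) (edge_act u v i (\<mu> d, False) s)"
      using edge_act_swap[OF uv(1) a(1), of i s] unfolding zero shift_0 .
  qed (simp_all add: grade_def)
  also have "\<dots> = shift (edge_sign u v (\<mu> u') (\<mu> v') * delta (int i - int i')) ?s"
  proof -
    have "exponent_sum (pw i') = int i'" by (simp add: pw_def exponent_sum_def sum_list_replicate)
    then show ?thesis
      using fold_inv_word[OF letter_action_edge, of "pw i'" ?s] uv
      by (simp add: state_commutator fold_commutator[OF uv(1) a'] fold_shift level_fold)
  qed
  finally show "fold (edge_act u v i) (subst (rel u' v' i')) ?s = shift (of_bool (u = u' \<and> v = v' \<and> i = i')) ?s"
    unfolding sign .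
qed

definition rho :: "nat word \<Rightarrow> (nat \<Rightarrow>\<^sub>0 int)"
  where "rho w = int_comb (\<lambda>j. case Jl ! j of ((u, v), i) \<Rightarrow> corner u v i w) frag_of {..<length Jl}"

lemma rho_eqI:
  assumes "\<And>u v i. ((u, v), i) \<in> set Jl \<Longrightarrow> corner u v i w = corner u v i w'"
  shows "rho w = rho w'"
  unfolding rho_def
proof (rule int_comb_cong)
  fix j assume "j \<in> {..<length Jl}"
  then have mem: "Jl ! j \<in> set Jl" by simp
  obtain u v i where j: "Jl ! j = ((u, v), i)" by (metis surj_pair)
  show "(case Jl ! j of ((u, v), i) \<Rightarrow> corner u v i w) = (case Jl ! j of ((u, v), i) \<Rightarrow> corner u v i w')"
    using assms[of u v i] mem by (simp add: j)
qed simp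

lemma independent: "independent_presentation N rels (Gamma K n) (\<lambda>w. G.cl (subst w)) rho"
proof -
  have h_one: "G.cl (subst w) = \<one>\<^bsub>Gamma K n\<^esub> \<longleftrightarrow> P.cl w = \<one>\<^bsub>P.Q\<^esub>" if "w \<in> words_over X" for w
    using cl_subst_iff[OF that] by (simp add: Gamma_simps)
  have len: "length rels = length Jl" by (simp add: rels_def)
  show ?thesis
  proof (intro independent_presentation.intro independent_presentation_axioms.intro)
    show "presented X (set rels)" by (rule P.presented_axioms)
    show "group (Gamma K n)" by (rule group_Gamma)
    show "(\<lambda>w. G.cl (subst w)) ` words_over X = carrier (Gamma K n)" by (rule subst_onto)
    show "G.cl (subst w) = \<one>\<^bsub>Gamma K n\<^esub> \<longleftrightarrow> P.cl w = \<one>\<^bsub>P.Q\<^esub>" if "w \<in> words_over X" for w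
      using h_one[OF that] .
    show "G.cl (subst (u @ v)) = G.cl (subst u) \<otimes>\<^bsub>Gamma K n\<^esub> G.cl (subst v)"
      if "u \<in> words_over X" "v \<in> words_over X" for u v
      using that by (simp add: G.cl_append Gamma_simps)
    show "rho (reduce w) = rho w" if "w \<in> words_over X" for w
      by (rule rho_eqI) (simp add: corner_reduce that)
    show "rho (w @ u @ inv_word w) = rho u"
      if "w \<in> words_over X" "u \<in> words_over X" "G.cl (subst u) = \<one>\<^bsub>Gamma K n\<^esub>" for w u
    proof (rule rho_eqI)
      fix x y i assume "((x, y), i) \<in> set Jl"
      then have "adj x y" using J_adj by blast
      then show "corner x y i (w @ u @ inv_word w) = corner x y i u"
        by (rule corner_conj) (use that h_one[of u] in auto)
    qed
    show "rho (w @ w') = rho w + rho w'"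
      if "w \<in> words_over X" "w' \<in> words_over X" "G.cl (subst w) = \<one>\<^bsub>Gamma K n\<^esub>" "G.cl (subst w') = \<one>\<^bsub>Gamma K n\<^esub>" for w w'
    proof (rule poly_mapping_eqI)
      fix j
      obtain u v i where j: "Jl ! j = ((u, v), i)" by (metis surj_pair)
      show "Poly_Mapping.lookup (rho (w @ w')) j = Poly_Mapping.lookup (rho w + rho w') j"
      proof (cases "j < length Jl")
        case True
        then have "((u, v), i) \<in> set Jl" using nth_mem[of j Jl] j by simp
        then have "adj u v" using J_adj by blast
        then have "corner u v i (w @ w') = corner u v i w + corner u v i w'"
          by (rule corner_append) (use that h_one[of w] h_one[of w'] in auto)
        then show ?thesis using True j by (simp add: rho_def int_comb_units lookup_add)
      qed (simp add: rho_def int_comb_units lookup_add)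
    qed
    show "rho (rels ! j) = frag_of j" if "j < length rels" for j
    proof (rule poly_mapping_eqI)
      fix k
      obtain u v i where j: "Jl ! j = ((u, v), i)" by (metis surj_pair)
      obtain u' v' i' where k: "Jl ! k = ((u', v'), i')" by (metis surj_pair)
      have jl: "j < length Jl" using that len by simp
      have r: "rels ! j = rel u v i" using jl j by (simp add: rels_def)
      show "Poly_Mapping.lookup (rho (rels ! j)) k = Poly_Mapping.lookup (frag_of j) k"
      proof (cases "k < length Jl")
        case True
        have "corner u' v' i' (rel u v i) = of_bool (u' = u \<and> v' = v \<and> i' = i)"
          by (rule corner_rel) (use j k nth_mem[OF jl] nth_mem[OF True] in simp_all)
        moreover have "(u' = u \<and> v' = v \<and> i' = i) \<longleftrightarrow> j = k"
          using nth_eq_iff_index_eq[OF J_distinct jl True] j k by auto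
        ultimately show ?thesis using True k by (simp add: rho_def int_comb_units r)
      next
        case False
        then show ?thesis using jl by (auto simp: rho_def int_comb_units)
      qed
    qed
  qed
qed

theorem efficient_Gamma: "efficient (Presentation N rels) (Gamma K n)"
  using presents_Gamma independent_presentation.deficiency_homology[OF independent]
  by (simp add: efficient_def deficiency_def)

end

section \<open>A calculus of computable functions on coded data\<close>

section \<open>Recursive functions on encoded data\<close>

text \<open>The formal notion fixes a function on argument lists of every length, but only length k
  is meaningful. This version is closed under agreement on such lists.\<close>

definition recf :: "nat \<Rightarrow> (nat list \<Rightarrow> nat) \<Rightarrow> bool"
  where "recf k f \<longleftrightarrow> (\<exists>F. recursive_fun k F \<and> (\<forall>xs. length xs = k \<longrightarrow> F xs = f xs))"

lemma recf_cong: "recf k f \<Longrightarrow> (\<And>xs. length xs = k \<Longrightarrow> f xs = g xs) \<Longrightarrow> recf k g"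
  by (auto simp: recf_def)

lemma recf_nth: "i < k \<Longrightarrow> recf k (\<lambda>xs. xs ! i)"
  using recursive_fun.proj by (auto simp: recf_def)

lemma recf_comp:
  assumes "recf (length gs) f" "\<And>g. g \<in> set gs \<Longrightarrow> recf k g"
  shows "recf k (\<lambda>xs. f (map (\<lambda>g. g xs) gs))"
proof -
  obtain F where F: "recursive_fun (length gs) F" "\<And>xs. length xs = length gs \<Longrightarrow> F xs = f xs"
    using assms(1) by (auto simp: recf_def)
  \<comment> \<open>A formally recursive representative is chosen for each argument function, to be
    used in the composition rule.\<close>
  define c where "c g = (SOME G. recursive_fun k G \<and> (\<forall>xs. length xs = k \<longrightarrow> G xs = g xs))" for g
  have c: "recursive_fun k (c g) \<and> (\<forall>xs. length xs = k \<longrightarrow> c g xs = g xs)" if "g \<in> set gs" for g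
    using someI_ex[OF assms(2)[OF that, unfolded recf_def]] unfolding c_def .
  have "recursive_fun k (\<lambda>xs. F (map (\<lambda>g. g xs) (map c gs)))"
    by (rule recursive_fun.comp) (use F c in auto)
  moreover have "F (map (\<lambda>g. g xs) (map c gs)) = f (map (\<lambda>g. g xs) gs)" if "length xs = k" for xs
  proof -
    have "map (\<lambda>g. g xs) (map c gs) = map (\<lambda>g. g xs) gs" using c that by simp
    then show ?thesis using F(2) by (metis length_map)
  qed
  ultimately show ?thesis by (auto simp: recf_def)
qed

lemma recf_1: "recf 1 f \<Longrightarrow> recf k g \<Longrightarrow> recf k (\<lambda>xs. f [g xs])"
  using recf_comp[of "[g]" f k] by simp

lemma recf_Suc: "recf k g \<Longrightarrow> recf k (\<lambda>xs. Suc (g xs))"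
proof -
  have "recf 1 (\<lambda>xs. Suc (xs ! 0))" using recursive_fun.succ by (auto simp: recf_def)
  from recf_1[OF this] show "recf k g \<Longrightarrow> recf k (\<lambda>xs. Suc (g xs))" by simp
qed

lemma recf_const: "recf k (\<lambda>_. c)"
proof (induction c)
  case 0 then show ?case using recursive_fun.zero by (auto simp: recf_def)
next
  case (Suc c) then show ?case by (rule recf_Suc)
qed

text \<open>The formal scheme recurses on the first argument. Composition with all projections
  allows the bound to be any recursive function of the arguments.\<close>

lemma recf_rec:
  assumes "recf k f" "recf (Suc (Suc k)) (\<lambda>zs. g (zs ! 0) (zs ! 1) (tl (tl zs)))" "recf k h"
  shows "recf k (\<lambda>xs. rec_nat (f xs) (\<lambda>y r. g y r xs) (h xs))"
proof -
  obtain F where F: "recursive_fun k F" "\<And>xs. length xs = k \<Longrightarrow> F xs = f xs"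
    using assms(1) by (auto simp: recf_def)
  obtain H where H: "recursive_fun (Suc (Suc k)) H"
    "\<And>zs. length zs = Suc (Suc k) \<Longrightarrow> H zs = g (zs ! 0) (zs ! 1) (tl (tl zs))"
    using assms(2) by (auto simp: recf_def)
  let ?R = "\<lambda>zs. rec_nat (f (tl zs)) (\<lambda>y r. g y r (tl zs)) (hd zs)"
  have R: "rec_nat (F xs) (\<lambda>y r. H (y # r # xs)) m = rec_nat (f xs) (\<lambda>y r. g y r xs) m" if "length xs = k" for xs m
    using that by (induction m) (auto simp: F H)
  have "recf (Suc k) ?R"
    unfolding recf_def
    by (rule exI, rule conjI, rule recursive_fun.prim_rec[OF F(1) H(1)]) (simp add: R)
  moreover have "recf (Suc k) ?R \<Longrightarrow> recf k (\<lambda>xs. ?R (map (\<lambda>g. g xs) (h # map (\<lambda>i xs. xs ! i) [0..<k])))"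
    by (rule recf_comp) (use assms(3) recf_nth in auto)
  ultimately have "recf k (\<lambda>xs. ?R (map (\<lambda>g. g xs) (h # map (\<lambda>i xs. xs ! i) [0..<k])))" by blast
  then show ?thesis
  proof (rule recf_cong)
    fix xs :: "nat list" assume "length xs = k"
    then have "map (\<lambda>g. g xs) (h # map (\<lambda>i xs. xs ! i) [0..<k]) = h xs # xs"
      using map_nth[of xs] by (simp add: comp_def)
    then show "?R (map (\<lambda>g. g xs) (h # map (\<lambda>i xs. xs ! i) [0..<k])) = rec_nat (f xs) (\<lambda>y r. g y r xs) (h xs)"
      by simp
  qed
qed

lemma recf_add: "recf k f \<Longrightarrow> recf k g \<Longrightarrow> recf k (\<lambda>xs. f xs + g xs)"
proof -
  assume f: "recf k f" and g: "recf k g"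
  have "recf k (\<lambda>xs. rec_nat (g xs) (\<lambda>y r. Suc r) (f xs))"
    by (rule recf_rec[OF g _ f]) (intro recf_Suc recf_nth, simp)
  moreover have "rec_nat b (\<lambda>y r. Suc r) a = a + b" for a b by (induction a) auto
  ultimately show ?thesis by simp
qed

lemma recf_pred: "recf k f \<Longrightarrow> recf k (\<lambda>xs. f xs - 1)"
proof -
  assume f: "recf k f"
  have "recf k (\<lambda>xs. rec_nat 0 (\<lambda>y r. y) (f xs))"
    by (rule recf_rec[OF recf_const _ f]) (intro recf_nth, simp)
  moreover have "rec_nat 0 (\<lambda>y r. y) a = a - 1" for a by (cases a) auto
  ultimately show ?thesis by simp
qed

lemma recf_diff: "recf k f \<Longrightarrow> recf k g \<Longrightarrow> recf k (\<lambda>xs. f xs - g xs)"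
proof -
  assume f: "recf k f" and g: "recf k g"
  have "recf k (\<lambda>xs. rec_nat (f xs) (\<lambda>y r. r - 1) (g xs))"
    by (rule recf_rec[OF f _ g]) (intro recf_pred recf_nth, simp)
  moreover have "rec_nat a (\<lambda>y r. r - 1) b = a - b" for a b :: nat by (induction b) auto
  ultimately show ?thesis by simp
qed

text \<open>A case distinction is a recursion whose step discards the previous value. For this, f
  has to be lifted over two additional arguments.\<close>

lemma recf_cond: "recf k b \<Longrightarrow> recf k f \<Longrightarrow> recf k g \<Longrightarrow> recf k (\<lambda>xs. if b xs = 0 then g xs else f xs)"
proof -
  assume b: "recf k b" and f: "recf k f" and g: "recf k g"
  have "recf (Suc (Suc k)) (\<lambda>zs. f (map (\<lambda>h. h zs) (map (\<lambda>i zs. zs ! (i + 2)) [0..<k])))"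
    by (rule recf_comp) (use f recf_nth in auto)
  then have f2: "recf (Suc (Suc k)) (\<lambda>zs. f (tl (tl zs)))"
  proof (rule recf_cong)
    fix zs :: "nat list" assume "length zs = Suc (Suc k)"
    then have "map (\<lambda>h. h zs) (map (\<lambda>i zs. zs ! (i + 2)) [0..<k]) = tl (tl zs)"
      by (intro nth_equalityI) (auto simp: nth_tl)
    then show "f (map (\<lambda>h. h zs) (map (\<lambda>i zs. zs ! (i + 2)) [0..<k])) = f (tl (tl zs))" by simp
  qed
  have "recf k (\<lambda>xs. rec_nat (g xs) (\<lambda>y r. f xs) (b xs))"
    by (rule recf_rec[OF g f2 b])
  moreover have "rec_nat u (\<lambda>y r. v) n = (if n = 0 then u else v)" for u v n :: nat by (cases n) auto
  ultimately show ?thesis by (simp only:)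
qed

lemma recf_triangle: "recf k f \<Longrightarrow> recf k (\<lambda>xs. triangle (f xs))"
proof -
  assume f: "recf k f"
  have "recf k (\<lambda>xs. rec_nat 0 (\<lambda>y r. r + Suc y) (f xs))"
    by (rule recf_rec[OF recf_const _ f]) (intro recf_add recf_Suc recf_nth, simp_all)
  moreover have "rec_nat 0 (\<lambda>y r. r + Suc y) a = triangle a" for a by (induction a) auto
  ultimately show ?thesis by simp
qed

lemma recf_prod_encode: "recf k f \<Longrightarrow> recf k g \<Longrightarrow> recf k (\<lambda>xs. prod_encode (f xs, g xs))"
  by (simp add: prod_encode_def recf_add recf_triangle)

text \<open>The largest r whose triangular number is at most m, found by counting up. Equality is
  tested with two truncated differences, which are already known to be recursive.\<close>

definition triangle_root :: "nat \<Rightarrow> nat"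
  where "triangle_root = rec_nat 0 (\<lambda>y r. if Suc y - triangle (Suc r) = 0 \<and> triangle (Suc r) - Suc y = 0 then Suc r else r)"

lemma recf_triangle_root: "recf k f \<Longrightarrow> recf k (\<lambda>xs. triangle_root (f xs))"
proof -
  assume f: "recf k f"
  let ?t = "\<lambda>y r. (Suc y - triangle (Suc r)) + (triangle (Suc r) - Suc y)"
  have "recf k (\<lambda>xs. rec_nat 0 (\<lambda>y r. if ?t y r = 0 then Suc r else r) (f xs))"
    by (rule recf_rec[OF recf_const _ f]) (intro recf_cond recf_add recf_diff recf_triangle recf_Suc recf_nth; simp)
  then show ?thesis by (simp add: triangle_root_def)
qed

lemma triangle_root: "triangle (triangle_root m) \<le> m \<and> m < triangle (Suc (triangle_root m))"
proof (induction m)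
  case (Suc m)
  have "triangle_root (Suc m) = (if Suc m = triangle (Suc (triangle_root m)) then Suc (triangle_root m) else triangle_root m)"
    by (auto simp: triangle_root_def simp del: triangle_Suc)
  with Suc show ?case by (auto split: if_splits)
qed (simp add: triangle_root_def)

lemma triangle_mono: "a \<le> b \<Longrightarrow> triangle a \<le> triangle b"
  by (induction b rule: nat_induct) (auto simp: le_Suc_eq)

lemma triangle_root_prod_encode: "triangle_root (prod_encode (a, b)) = a + b"
proof (rule ccontr)
  let ?m = "prod_encode (a, b)"
  have m: "triangle (a + b) \<le> ?m" "?m < triangle (Suc (a + b))" by (auto simp: prod_encode_def)
  assume "triangle_root ?m \<noteq> a + b"
  then consider "Suc (triangle_root ?m) \<le> a + b" | "Suc (a + b) \<le> triangle_root ?m" by linarith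
  then show False
  proof cases
    case 1
    from triangle_mono[OF 1] show False using m triangle_root[of ?m] by linarith
  next
    case 2
    from triangle_mono[OF 2] show False using m triangle_root[of ?m] by linarith
  qed
qed

text \<open>Since \<open>prod_encode (a, b)\<close> is \<open>triangle (a + b) + a\<close>, the
  triangular root of a code is a + b, and both components follow by subtraction.\<close>

definition code_fst :: "nat \<Rightarrow> nat" where "code_fst m = m - triangle (triangle_root m)"
definition code_snd :: "nat \<Rightarrow> nat" where "code_snd m = triangle_root m - code_fst m"

lemma code_fst_snd [simp]: "code_fst (prod_encode (a, b)) = a" "code_snd (prod_encode (a, b)) = b"
  by (simp_all add: code_fst_def code_snd_def triangle_root_prod_encode) (simp_all add: prod_encode_def)

lemma recf_code_fst: "recf k f \<Longrightarrow> recf k (\<lambda>xs. code_fst (f xs))"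
  unfolding code_fst_def by (intro recf_diff recf_triangle recf_triangle_root)

lemma recf_code_snd: "recf k f \<Longrightarrow> recf k (\<lambda>xs. code_snd (f xs))"
  unfolding code_snd_def by (intro recf_diff recf_code_fst recf_triangle_root)

text \<open>Codes for whole types, compatible with \<open>prod_encode\<close> and
  \<open>list_encode\<close>. They allow the algorithm to be written as ordinary functions on pairs
  and lists and proved recursive by rules that follow its syntax.\<close>

class encodable =
  fixes encode :: "'a \<Rightarrow> nat"

instantiation nat :: encodable begin
definition "encode_nat = (\<lambda>n :: nat. n)"
instance ..
end

instantiation bool :: encodable begin
definition "encode_bool = (of_bool :: bool \<Rightarrow> nat)"
instance ..
end

instantiation prod :: (encodable, encodable) encodable begin
definition "encode_prod p = prod_encode (encode (fst p), encode (snd p))"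
instance ..
end

instantiation list :: (encodable) encodable begin
definition "encode_list xs = list_encode (map encode xs)"
instance ..
end

text \<open>The recursive function has to track f on codes; its values on other numbers are left
  open.\<close>

definition codes :: "(nat \<Rightarrow> nat) \<Rightarrow> ('a :: encodable \<Rightarrow> 'b :: encodable) \<Rightarrow> bool"
  where "codes F f \<longleftrightarrow> recf 1 (\<lambda>xs. F (xs ! 0)) \<and> (\<forall>x. F (encode x) = encode (f x))"

definition computable :: "('a :: encodable \<Rightarrow> 'b :: encodable) \<Rightarrow> bool"
  where "computable f \<longleftrightarrow> (\<exists>F. codes F f)"

named_theorems computable_intros

lemma computableI: "recf 1 (\<lambda>xs. F (xs ! 0)) \<Longrightarrow> (\<And>x. F (encode x) = encode (f x)) \<Longrightarrow> computable f"
  by (auto simp: computable_def codes_def)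

lemma computableE: "computable f \<Longrightarrow> (\<And>F. codes F f \<Longrightarrow> thesis) \<Longrightarrow> thesis"
  by (auto simp: computable_def)

lemma codes_recf: "codes F f \<Longrightarrow> recf k g \<Longrightarrow> recf k (\<lambda>xs. F (g xs))"
  using recf_1[of "\<lambda>xs. F (xs ! 0)" k g] by (simp add: codes_def)

lemma codes_eq: "codes F f \<Longrightarrow> F (encode x) = encode (f x)"
  by (simp add: codes_def)

lemma computable_id [computable_intros]: "computable (\<lambda>x. x)"
  by (rule computableI[of "\<lambda>c. c"]) (auto intro: recf_nth)

lemma computable_const [computable_intros]: "computable (\<lambda>_. c)"
  by (rule computableI[of "\<lambda>_. encode c"]) (auto intro: recf_const)

lemma computable_compose: "computable f \<Longrightarrow> computable g \<Longrightarrow> computable (\<lambda>x. f (g x))"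
proof -
  assume f: "computable f" and g: "computable g"
  from f obtain F where "codes F (\<lambda>x. f x)" by (rule computableE)
  note F = codes_recf[OF this] codes_eq[OF this]
  from g obtain H where "codes H (\<lambda>x. g x)" by (rule computableE)
  note H = codes_recf[OF this] codes_eq[OF this]
  show ?thesis
    by (rule computableI[of "\<lambda>c. F (H c)"]) (auto intro!: F(1) H(1) recf_nth simp: F(2) H(2))
qed

lemma computable_Pair [computable_intros]: "computable f \<Longrightarrow> computable g \<Longrightarrow> computable (\<lambda>x. (f x, g x))"
proof -
  assume f: "computable f" and g: "computable g"
  from f obtain F where "codes F (\<lambda>x. f x)" by (rule computableE)
  note F = codes_recf[OF this] codes_eq[OF this]
  from g obtain H where "codes H (\<lambda>x. g x)" by (rule computableE)
  note H = codes_recf[OF this] codes_eq[OF this]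
  show ?thesis
    by (rule computableI[of "\<lambda>c. prod_encode (F c, H c)"])
       (auto intro!: recf_prod_encode F(1) H(1) recf_nth simp: F(2) H(2) encode_prod_def)
qed

lemma computable_fst [computable_intros]: "computable f \<Longrightarrow> computable (\<lambda>x. fst (f x))"
proof (rule computable_compose[of fst])
  show "computable (fst :: 'b \<times> 'c \<Rightarrow> 'b)"
    by (rule computableI[of code_fst]) (auto intro: recf_code_fst recf_nth simp: encode_prod_def)
qed

lemma computable_snd [computable_intros]: "computable f \<Longrightarrow> computable (\<lambda>x. snd (f x))"
proof (rule computable_compose[of snd])
  show "computable (snd :: 'b \<times> 'c \<Rightarrow> 'c)"
    by (rule computableI[of code_snd]) (auto intro: recf_code_snd recf_nth simp: encode_prod_def)
qed

lemma computable_Suc [computable_intros]: "computable f \<Longrightarrow> computable (\<lambda>x. Suc (f x))"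
  by (rule computable_compose[of Suc])
     (rule computableI[of Suc], auto intro: recf_Suc recf_nth simp: encode_nat_def)

text \<open>The step may depend on the outer argument, so the code of that argument is passed
  through every stage of the recursion.\<close>

lemma computable_rec_nat [computable_intros]:
  assumes f: "computable f" and g: "computable (\<lambda>p. g (fst p) (fst (snd p)) (snd (snd p)))" and h: "computable h"
  shows "computable (\<lambda>x. rec_nat (f x) (g x) (h x))"
proof -
  from f obtain F where "codes F (\<lambda>x. f x)" by (rule computableE)
  note F = codes_recf[OF this] codes_eq[OF this]
  from g obtain E where "codes E (\<lambda>p. g (fst p) (fst (snd p)) (snd (snd p)))" by (rule computableE)
  note E = codes_recf[OF this] codes_eq[OF this]
  from h obtain H where "codes H (\<lambda>x. h x)" by (rule computableE)
  note H = codes_recf[OF this] codes_eq[OF this]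
  have E': "E (prod_encode (encode x, prod_encode (n, encode r))) = encode (g x n r)" for x n r
    using E(2)[of "(x, n, r)"] by (simp add: encode_prod_def encode_nat_def)
  let ?G = "\<lambda>y r (xs :: nat list). E (prod_encode (xs ! 0, prod_encode (y, r)))"
  have E2: "recf (Suc (Suc 1)) (\<lambda>zs. ?G (zs ! 0) (zs ! 1) (tl (tl zs)))"
  proof (rule recf_cong)
    show "recf (Suc (Suc 1)) (\<lambda>zs. E (prod_encode (zs ! 2, prod_encode (zs ! 0, zs ! 1))))"
      by (intro E(1) recf_prod_encode recf_nth) simp_all
  qed (simp add: nth_tl numeral_2_eq_2)
  have "recf 1 (\<lambda>xs. rec_nat (F (xs ! 0)) (\<lambda>y r. ?G y r xs) (H (xs ! 0)))"
    by (rule recf_rec[OF _ E2]) (auto intro!: F(1) H(1) recf_nth)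
  then have "recf 1 (\<lambda>xs. (\<lambda>c. rec_nat (F c) (\<lambda>y r. E (prod_encode (c, prod_encode (y, r)))) (H c)) (xs ! 0))" .
  then show ?thesis
  proof (rule computableI)
    fix x
    have "rec_nat (encode (f x)) (\<lambda>y r. E (prod_encode (encode x, prod_encode (y, r)))) n = encode (rec_nat (f x) (g x) n)" for n
      by (induction n) (auto simp: E')
    then show "rec_nat (F (encode x)) (\<lambda>y r. E (prod_encode (encode x, prod_encode (y, r)))) (H (encode x)) = encode (rec_nat (f x) (g x) (h x))"
      by (simp add: F(2) H(2)) (simp add: encode_nat_def)
  qed
qed

lemma computable_if [computable_intros]:
  assumes b: "computable b" and f: "computable f" and g: "computable g"
  shows "computable (\<lambda>x. if b x then f x else g x)"
proof -
  from f obtain F where "codes F (\<lambda>x. f x)" by (rule computableE)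
  note F = codes_recf[OF this] codes_eq[OF this]
  from g obtain H where "codes H (\<lambda>x. g x)" by (rule computableE)
  note H = codes_recf[OF this] codes_eq[OF this]
  from b obtain E where "codes E (\<lambda>x. b x)" by (rule computableE)
  note E = codes_recf[OF this] codes_eq[OF this]
  have "recf 1 (\<lambda>xs. (\<lambda>c. if E c = 0 then H c else F c) (xs ! 0))"
    by (intro recf_cond E(1) F(1) H(1) recf_nth) simp_all
  then show ?thesis
    by (rule computableI) (auto simp: E(2) F(2) H(2) encode_bool_def)
qed

text \<open>The empty list has code 0, and the predecessor of any other list code is already the
  code of the pair of head and tail.\<close>

lemma computable_case_list [computable_intros]:
  assumes f: "computable f" and g: "computable (\<lambda>p. g (fst p) (fst (snd p)) (snd (snd p)))" and l: "computable l"
  shows "computable (\<lambda>x. case l x of [] \<Rightarrow> f x | y # ys \<Rightarrow> g x y ys)"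
proof -
  from f obtain F where "codes F (\<lambda>x. f x)" by (rule computableE)
  note F = codes_recf[OF this] codes_eq[OF this]
  from g obtain E where "codes E (\<lambda>p. g (fst p) (fst (snd p)) (snd (snd p)))" by (rule computableE)
  note E = codes_recf[OF this] codes_eq[OF this]
  from l obtain H where "codes H (\<lambda>x. l x)" by (rule computableE)
  note H = codes_recf[OF this] codes_eq[OF this]
  have "recf 1 (\<lambda>xs. (\<lambda>c. if H c = 0 then F c else E (prod_encode (c, H c - 1))) (xs ! 0))"
    by (intro recf_cond E(1) F(1) H(1) recf_nth recf_prod_encode recf_pred) simp_all
  then show ?thesis
  proof (rule computableI)
    fix x
    show "(if H (encode x) = 0 then F (encode x) else E (prod_encode (encode x, H (encode x) - 1)))
      = encode (case l x of [] \<Rightarrow> f x | y # ys \<Rightarrow> g x y ys)"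
    proof (cases "l x")
      case Nil then show ?thesis by (simp add: H(2) F(2) encode_list_def)
    next
      case (Cons y ys)
      then show ?thesis using E(2)[of "(x, y, ys)"] by (simp add: H(2) encode_list_def encode_prod_def)
    qed
  qed
qed

lemma computable_Cons [computable_intros]:
  assumes "computable f" "computable g"
  shows "computable (\<lambda>x. f x # g x)"
proof -
  from assms(1) obtain F where "codes F (\<lambda>x. f x)" by (rule computableE)
  note F = codes_recf[OF this] codes_eq[OF this]
  from assms(2) obtain H where "codes H (\<lambda>x. g x)" by (rule computableE)
  note H = codes_recf[OF this] codes_eq[OF this]
  have "recf 1 (\<lambda>xs. (\<lambda>c. Suc (prod_encode (F c, H c))) (xs ! 0))"
    by (intro recf_Suc recf_prod_encode F(1) H(1) recf_nth) simp_all
  then show ?thesis by (rule computableI) (simp add: F(2) H(2) encode_list_def)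
qed

subsection \<open>Arithmetic and lists\<close>

lemma computable_not [computable_intros]: "computable b \<Longrightarrow> computable (\<lambda>x. \<not> b x)"
proof -
  have "(\<lambda>x. \<not> b x) = (\<lambda>x. if b x then False else True)" by auto
  then show "computable b \<Longrightarrow> ?thesis" by (simp only: computable_if computable_const)
qed

lemma computable_conj [computable_intros]: "computable b \<Longrightarrow> computable c \<Longrightarrow> computable (\<lambda>x. b x \<and> c x)"
proof -
  have "(\<lambda>x. b x \<and> c x) = (\<lambda>x. if b x then c x else False)" by auto
  then show "computable b \<Longrightarrow> computable c \<Longrightarrow> ?thesis" by (simp only: computable_if computable_const)
qed

lemma computable_disj [computable_intros]: "computable b \<Longrightarrow> computable c \<Longrightarrow> computable (\<lambda>x. b x \<or> c x)"
proof -
  have "(\<lambda>x. b x \<or> c x) = (\<lambda>x. if b x then True else c x)" by auto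
  then show "computable b \<Longrightarrow> computable c \<Longrightarrow> ?thesis" by (simp only: computable_if computable_const)
qed

lemma computable_add [computable_intros]:
  "computable f \<Longrightarrow> computable g \<Longrightarrow> computable (\<lambda>x. f x + g x :: nat)"
proof -
  assume *: "computable f" "computable g"
  have "rec_nat b (\<lambda>_ r. Suc r) a = a + b" for a b by (induction a) auto
  moreover have "computable (\<lambda>x. rec_nat (g x) (\<lambda>_ r. Suc r) (f x))"
    by (intro computable_intros *)
  ultimately show ?thesis by simp
qed

lemma computable_diff [computable_intros]:
  "computable f \<Longrightarrow> computable g \<Longrightarrow> computable (\<lambda>x. f x - g x :: nat)"
proof -
  assume *: "computable f" "computable g"
  have 1: "rec_nat 0 (\<lambda>y r. y) a = a - 1" for a by (cases a) auto
  have 2: "rec_nat a (\<lambda>_ r. r - 1) b = a - b" for a b :: nat by (induction b) auto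
  have "computable (\<lambda>x. rec_nat (f x) (\<lambda>_ r. rec_nat 0 (\<lambda>y r. y) r) (g x))"
    by (intro computable_intros *)
  then show ?thesis by (simp only: 1 2)
qed

lemma computable_eq_0: "computable f \<Longrightarrow> computable (\<lambda>x. f x = (0 :: nat))"
proof -
  assume *: "computable f"
  have "rec_nat True (\<lambda>_ _. False) a = (a = 0)" for a by (cases a) auto
  moreover have "computable (\<lambda>x. rec_nat True (\<lambda>_ _. False) (f x))" by (intro computable_intros *)
  ultimately show ?thesis by simp
qed

lemma computable_le [computable_intros]: "computable f \<Longrightarrow> computable g \<Longrightarrow> computable (\<lambda>x. f x \<le> (g x :: nat))"
  using computable_eq_0[OF computable_diff[of f g]] by simp

lemma computable_less [computable_intros]: "computable f \<Longrightarrow> computable g \<Longrightarrow> computable (\<lambda>x. f x < (g x :: nat))"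
  using computable_le[OF computable_Suc[of f], of g] by (simp add: Suc_le_eq)

lemma computable_eq [computable_intros]: "computable f \<Longrightarrow> computable g \<Longrightarrow> computable (\<lambda>x. f x = (g x :: nat))"
  using computable_conj[OF computable_le[of f g] computable_le[of g f]] by (simp add: eq_iff)

lemma computable_power_2 [computable_intros]: "computable f \<Longrightarrow> computable (\<lambda>x. 2 ^ f x :: nat)"
proof -
  assume *: "computable f"
  have "rec_nat (Suc 0) (\<lambda>_ r. r + r) a = 2 ^ a" for a by (induction a) auto
  moreover have "computable (\<lambda>x. rec_nat (Suc 0) (\<lambda>_ r. r + r) (f x))" by (intro computable_intros *)
  ultimately show ?thesis by simp
qed

text \<open>Quotient and parity are counted together: the parity flips at each step and the quotient
  grows at every second one.\<close>

lemma computable_halve: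
  assumes "computable f"
  shows "computable (\<lambda>x. (f x div 2 :: nat, odd (f x)))"
proof -
  let ?step = "\<lambda>p :: nat \<times> bool. (if snd p then (Suc (fst p), False) else (fst p, True))"
  have "rec_nat (0, False) (\<lambda>_. ?step) a = (a div 2, odd a)" for a
    by (induction a) (auto elim!: oddE evenE)
  moreover have "computable (\<lambda>x. rec_nat (0, False) (\<lambda>_. ?step) (f x))"
    by (intro computable_intros assms)
  ultimately show ?thesis by simp
qed

lemma computable_odd [computable_intros]: "computable f \<Longrightarrow> computable (\<lambda>x. odd (f x :: nat))"
  using computable_snd[OF computable_halve[of f]] by simp

lemma computable_even [computable_intros]: "computable f \<Longrightarrow> computable (\<lambda>x. even (f x :: nat))"
  using computable_not[OF computable_odd[of f]] by simp

lemma computable_div_2: "computable f \<Longrightarrow> computable (\<lambda>x. f x div 2 :: nat)"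
  using computable_fst[OF computable_halve[of f]] by simp

lemma computable_set_decode [computable_intros]:
  assumes "computable f" "computable g"
  shows "computable (\<lambda>x. f x \<in> set_decode (g x))"
proof -
  have "rec_nat b (\<lambda>_ r. r div 2) a = b div 2 ^ a" for a b :: nat
    by (induction a) (auto simp: power_Suc2 div_mult2_eq simp del: power_Suc)
  moreover have "computable (\<lambda>x. odd (rec_nat (g x) (\<lambda>_ r. r div 2) (f x)))"
    by (intro computable_intros computable_div_2 assms)
  ultimately show ?thesis by (simp add: set_decode_def)
qed

text \<open>The code of a list thus serves as fuel for recursions over the list.\<close>

lemma length_le_encode: "length xs \<le> encode xs"
proof (induction xs)
  case (Cons x xs)
  have "list_encode (map encode xs) \<le> prod_encode (encode x, list_encode (map encode xs))" by (rule le_prod_encode_2)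
  with Cons show ?case by (simp add: encode_list_def)
qed simp

lemma computable_encode: "computable (encode :: 'a :: encodable \<Rightarrow> nat)"
  by (rule computableI[of "\<lambda>c. c"]) (auto intro: recf_nth simp: encode_nat_def)

text \<open>The fold is simulated by consuming one element per step, for as many steps as the code
  of the list. Surplus steps meet an exhausted list and change nothing.\<close>

lemma computable_foldl [computable_intros]:
  assumes "computable a" "computable (\<lambda>p. g (fst p) (fst (snd p)) (snd (snd p)))" "computable l"
  shows "computable (\<lambda>x. foldl (g x) (a x) (l x))"
proof -
  let ?step = "\<lambda>x s. case snd s of [] \<Rightarrow> s | y # ys \<Rightarrow> (g x (fst s) y, ys)"
  have iter: "rec_nat (b, l) (\<lambda>_. ?step x) m = (foldl (g x) b (take m l), drop m l)" for x b l m
  proof (induction m)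
    case (Suc m)
    show ?case
    proof (cases "drop m l")
      case Nil
      then show ?thesis using Suc by simp
    next
      case (Cons y ys)
      then have "m < length l" by (metis drop_eq_Nil leI list.distinct(1))
      then show ?thesis using Suc Cons by (simp add: take_Suc_conv_app_nth Cons_nth_drop_Suc[symmetric])
    qed
  qed simp
  have G: "computable (\<lambda>p. g (fst (fst p)) (fst (snd (snd (fst p)))) (fst (snd p)))"
    using computable_compose[OF assms(2), of "\<lambda>p. (fst (fst p), fst (snd (snd (fst p))), fst (snd p))"]
    by (simp add: computable_intros)
  have "computable (\<lambda>x. fst (rec_nat (a x, l x) (\<lambda>_. ?step x) (encode (l x))))"
    by (intro computable_intros assms computable_compose[OF computable_encode] G)
  then show ?thesis by (simp add: iter length_le_encode)
qed

lemma computable_rev [computable_intros]: "computable l \<Longrightarrow> computable (\<lambda>x. rev (l x))"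
proof -
  assume *: "computable l"
  have "foldl (\<lambda>a y. y # a) b xs = rev xs @ b" for b xs :: "'b list" by (induction xs arbitrary: b) auto
  moreover have "computable (\<lambda>x. foldl (\<lambda>a y. y # a) [] (l x))" by (intro computable_intros *)
  ultimately show ?thesis by simp
qed

lemma computable_append [computable_intros]: "computable l \<Longrightarrow> computable m \<Longrightarrow> computable (\<lambda>x. l x @ m x)"
proof -
  assume *: "computable l" "computable m"
  have "foldl (\<lambda>a y. y # a) b xs = rev xs @ b" for b xs :: "'b list" by (induction xs arbitrary: b) auto
  moreover have "computable (\<lambda>x. foldl (\<lambda>a y. y # a) (m x) (rev (l x)))" by (intro computable_intros *)
  ultimately show ?thesis by simp
qed

lemma computable_map [computable_intros]:
  assumes "computable (\<lambda>p. f (fst p) (snd p))" "computable l"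
  shows "computable (\<lambda>x. map (f x) (l x))"
proof -
  have "foldl (\<lambda>a y. f x y # a) b xs = rev (map (f x) xs) @ b" for x b xs by (induction xs arbitrary: b) auto
  moreover have "computable (\<lambda>p. f (fst p) (snd (snd p)))"
    using computable_compose[OF assms(1), of "\<lambda>p. (fst p, snd (snd p))"] by (simp add: computable_intros)
  then have "computable (\<lambda>x. rev (foldl (\<lambda>a y. f x y # a) [] (l x)))" by (intro computable_intros assms(2))
  ultimately show ?thesis by simp
qed

lemma computable_filter [computable_intros]:
  assumes "computable (\<lambda>p. b (fst p) (snd p))" "computable l"
  shows "computable (\<lambda>x. filter (b x) (l x))"
proof -
  have "foldl (\<lambda>a y. if b x y then y # a else a) c xs = rev (filter (b x) xs) @ c" for x c xs
    by (induction xs arbitrary: c) auto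
  moreover have "computable (\<lambda>p. b (fst p) (snd (snd p)))"
    using computable_compose[OF assms(1), of "\<lambda>p. (fst p, snd (snd p))"] by (simp add: computable_intros)
  then have "computable (\<lambda>x. rev (foldl (\<lambda>a y. if b x y then y # a else a) [] (l x)))" by (intro computable_intros assms(2))
  ultimately show ?thesis by simp
qed

lemma computable_concat [computable_intros]: "computable l \<Longrightarrow> computable (\<lambda>x. concat (l x))"
proof -
  assume *: "computable l"
  have "foldl (\<lambda>a y. a @ y) b xs = b @ concat xs" for b and xs :: "'b list list" by (induction xs arbitrary: b) auto
  moreover have "computable (\<lambda>x. foldl (\<lambda>a y. a @ y) [] (l x))" by (intro computable_intros *)
  ultimately show ?thesis by simp
qed

lemma computable_upt [computable_intros]: "computable f \<Longrightarrow> computable (\<lambda>x. [0..<f x])"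
proof -
  assume *: "computable f"
  have "rec_nat [] (\<lambda>y r. r @ [y]) m = [0..<m]" for m by (induction m) auto
  moreover have "computable (\<lambda>x. rec_nat [] (\<lambda>y r. r @ [y]) (f x))" by (intro computable_intros *)
  ultimately show ?thesis by simp
qed

lemma computable_length [computable_intros]: "computable l \<Longrightarrow> computable (\<lambda>x. length (l x))"
proof -
  assume *: "computable l"
  have "foldl (\<lambda>a y. Suc a) b xs = length xs + b" for b and xs :: "'b list" by (induction xs arbitrary: b) auto
  moreover have "computable (\<lambda>x. foldl (\<lambda>a y. Suc a) 0 (l x))" by (intro computable_intros *)
  ultimately show ?thesis by simp
qed

lemma computable_mem [computable_intros]:
  "computable f \<Longrightarrow> computable l \<Longrightarrow> computable (\<lambda>x. (f x :: nat) \<in> set (l x))"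
proof -
  assume *: "computable f" "computable l"
  have "foldl (\<lambda>b y. b \<or> y = f x) c xs = (c \<or> f x \<in> set xs)" for x c xs by (induction xs arbitrary: c) auto
  moreover have "computable (\<lambda>x. foldl (\<lambda>b y. b \<or> y = f x) False (l x))"
    by (intro computable_intros * computable_compose[OF *(1)])
  ultimately show ?thesis by simp
qed

section \<open>Maximal trees and triangle-free complexes\<close>

section \<open>Graphs and spanning trees\<close>

lemma rtranclp_exits:
  assumes "R\<^sup>*\<^sup>* u v" "u \<in> U" "v \<notin> U"
  shows "\<exists>p c. p \<in> U \<and> c \<notin> U \<and> R p c"
  using assms by (induction rule: rtranclp_induct) blast+

lemma edge_cycle_nth:
  assumes "edge_cycle K vs" "i < length vs"
  shows "adjacent K (vs ! i) (vs ! (Suc i mod length vs))"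
proof (cases "Suc i = length vs")
  case True
  then have "i = length vs - 1" by simp
  moreover have ne: "vs \<noteq> []" using assms(2) by auto
  ultimately have "vs ! i = last vs" by (simp add: last_conv_nth)
  moreover have "vs ! (Suc i mod length vs) = hd vs" using True ne by (simp add: hd_conv_nth)
  ultimately show ?thesis using assms(1) by (simp add: edge_cycle_def)
next
  case False
  then show ?thesis using assms by (auto simp: edge_cycle_def successively_conv_nth)
qed

lemma adjacent_commute: "adjacent K u v \<longleftrightarrow> adjacent K v u"
  by (auto simp: adjacent_def insert_commute)

lemma adjacent_vertices: "adjacent K u v \<Longrightarrow> u \<in> vertices K \<and> v \<in> vertices K"
  by (auto simp: adjacent_def vertices_def)

text \<open>The predecessor and the successor of c on the cycle sit at different positions because
  the length is at least three, so they are two distinct neighbours.\<close>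

lemma edge_cycle_degree_2:
  assumes "edge_cycle K vs" "c \<in> set vs" "\<And>x. adjacent K c x \<Longrightarrow> x = p"
  shows False
proof -
  let ?k = "length vs"
  have k: "?k \<ge> 3" and d: "distinct vs" using assms(1) by (auto simp: edge_cycle_def)
  obtain i where i: "i < ?k" "vs ! i = c" using assms(2) by (auto simp: in_set_conv_nth)
  let ?j = "if i = 0 then ?k - 1 else i - 1"
  have j: "?j < ?k" "Suc ?j mod ?k = i" using i k by auto
  have "vs ! (Suc i mod ?k) = p" using edge_cycle_nth[OF assms(1) i(1)] i(2) assms(3) by simp
  moreover have "vs ! ?j = p"
    using edge_cycle_nth[OF assms(1) j(1)] assms(3) unfolding j(2) i(2) adjacent_commute[of _ _ c] by simp
  moreover have "Suc i mod ?k < ?k" by (rule mod_less_divisor) (use k in linarith)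
  ultimately have "Suc i mod ?k = ?j" using nth_eq_iff_index_eq[OF d _ j(1), of "Suc i mod ?k"] by simp
  then show False using i(1) k by (cases "Suc i = ?k") (auto split: if_splits)
qed

lemma simplicial_complex_subset:
  "simplicial_complex K \<Longrightarrow> s \<in> K \<Longrightarrow> t \<subseteq> s \<Longrightarrow> t \<noteq> {} \<Longrightarrow> t \<in> K"
  unfolding simplicial_complex_def by blast

text \<open>Otherwise a path that leaves the tree supplies an edge to a new vertex. The enlarged
  complex is still a tree: the new vertex has a single neighbour and so lies on no cycle.\<close>

lemma maximal_tree_spanning:
  assumes K: "simplicial_complex K" "connected_complex K" and T: "maximal_tree K T"
  shows "vertices T = vertices K"
proof (rule ccontr)
  assume ne: "vertices T \<noteq> vertices K"
  have TK: "T \<subseteq> K" and tree: "tree_complex T" using T by (auto simp: maximal_tree_def)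
  have sub: "vertices T \<subseteq> vertices K" using TK by (auto simp: vertices_def)
  obtain u where u: "u \<in> vertices T" using tree unfolding tree_complex_def connected_complex_def by blast
  obtain v where v: "v \<in> vertices K" "v \<notin> vertices T" using ne sub by blast
  have "(adjacent K)\<^sup>*\<^sup>* u v" using K(2) u v sub unfolding connected_complex_def by blast
  from rtranclp_exits[OF this u v(2)] obtain p c where pc: "p \<in> vertices T" "c \<notin> vertices T" "adjacent K p c" by blast
  have simpT: "\<And>s t. s \<in> T \<Longrightarrow> t \<subseteq> s \<Longrightarrow> t \<noteq> {} \<Longrightarrow> t \<in> T"
    using tree unfolding tree_complex_def simplicial_complex_def by blast
  have pT: "{p} \<in> T"
  proof -
    obtain s where "s \<in> T" "p \<in> s" using pc(1) unfolding vertices_def by blast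
    then show ?thesis using simpT[of s "{p}"] by simp
  qed
  have pcne: "p \<noteq> c" using pc by auto
  define T' where "T' = T \<union> {{c}, {p, c}}"
  have VT': "vertices T' = insert c (vertices T)" using pc(1) by (auto simp: T'_def vertices_def)
  have adjT': "adjacent T' x y \<longleftrightarrow> adjacent T x y \<or> (x = p \<and> y = c) \<or> (x = c \<and> y = p)" for x y
    using pcne by (auto simp: T'_def adjacent_def doubleton_eq_iff)
  have cT: "\<not> adjacent T c x" for x using adjacent_vertices[of T c x] pc(2) by blast
  have "tree_complex T'"
    unfolding tree_complex_def
  proof (intro conjI)
    show "simplicial_complex T'"
      unfolding simplicial_complex_def
    proof (intro ballI conjI allI impI)
      fix s assume s: "s \<in> T'"
      show "finite s" "s \<noteq> {}" using s tree by (auto simp: T'_def tree_complex_def simplicial_complex_def)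
      fix t assume t: "t \<subseteq> s \<and> t \<noteq> {}"
      consider "s \<in> T" | "s = {c}" | "s = {p, c}" using s by (auto simp: T'_def)
      then show "t \<in> T'"
      proof cases
        case 1 then show ?thesis using simpT t by (auto simp: T'_def)
      next
        case 2 then have "t = {c}" using t by auto
        then show ?thesis by (simp add: T'_def)
      next
        case 3
        then have "t = {p} \<or> t = {c} \<or> t = {p, c}" using t by blast
        then show ?thesis using pT by (elim disjE) (simp_all add: T'_def)
      qed
    qed
    show "\<forall>s\<in>T'. card s \<le> 2" using tree pcne by (auto simp: T'_def tree_complex_def)
    show "connected_complex T'"
      unfolding connected_complex_def
    proof (intro conjI ballI)
      show "vertices T' \<noteq> {}" by (simp add: VT')
      have mono: "(adjacent T')\<^sup>*\<^sup>* x y" if "(adjacent T)\<^sup>*\<^sup>* x y" for x y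
        using that
      proof (induction rule: rtranclp_induct)
        case (step y z)
        have "adjacent T' y z" using step.hyps by (simp add: adjT')
        with step.IH show ?case by (rule rtranclp.rtrancl_into_rtrancl)
      qed simp
      have toT: "(adjacent T')\<^sup>*\<^sup>* x y" if "x \<in> vertices T" "y \<in> vertices T" for x y
        using tree that unfolding tree_complex_def connected_complex_def by (intro mono) blast
      have "adjacent T' p c" "adjacent T' c p" by (auto simp: adjT')
      then have cp: "(adjacent T')\<^sup>*\<^sup>* p c" "(adjacent T')\<^sup>*\<^sup>* c p" by auto
      fix x y assume "x \<in> vertices T'" "y \<in> vertices T'"
      then show "(adjacent T')\<^sup>*\<^sup>* x y"
        using toT[of x y] rtranclp_trans[OF toT[of x p] cp(1)] rtranclp_trans[OF cp(2) toT[of p y]] pc(1)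
        unfolding VT' by (elim insertE) simp_all
    qed
    show "\<nexists>vs. edge_cycle T' vs"
    proof
      assume "\<exists>vs. edge_cycle T' vs"
      then obtain vs where vs: "edge_cycle T' vs" by blast
      have "c \<notin> set vs"
      proof
        assume "c \<in> set vs"
        from vs this show False
          by (rule edge_cycle_degree_2[of T' vs c p]) (use cT pcne in \<open>simp add: adjT'\<close>)
      qed
      then have "edge_cycle T vs"
      proof -
        have adj: "adjacent T x y" if "x \<in> set vs" "y \<in> set vs" "adjacent T' x y" for x y
          using that \<open>c \<notin> set vs\<close> unfolding adjT' by blast
        have len: "3 \<le> length vs" and "distinct vs" and succ: "successively (adjacent T') vs"
          and cyc: "adjacent T' (last vs) (hd vs)" using vs by (simp_all add: edge_cycle_def)
        moreover have "vs \<noteq> []" using len by auto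
        moreover have "successively (adjacent T) vs"
          using succ adj unfolding successively_conv_nth by simp
        ultimately show ?thesis using adj[OF last_in_set hd_in_set] by (simp add: edge_cycle_def)
      qed
      then show False using tree by (auto simp: tree_complex_def)
    qed
  qed
  moreover have "T' \<subseteq> K" 
  proof -
    have "{p, c} \<in> K" using pc(3) by (simp add: adjacent_def)
    moreover from this have "{c} \<in> K" using simplicial_complex_subset[OF K(1), of "{p, c}" "{c}"] by simp
    ultimately show ?thesis using TK by (auto simp: T'_def)
  qed
  moreover have "T \<subseteq> T'" by (simp add: T'_def subset_insertI2 Un_upper1)
  ultimately have "T' = T" using T unfolding maximal_tree_def by blast
  then show False using VT' pc(2) by blast
qed

text \<open>Any three vertices of a simplex are pairwise adjacent and would form a cycle of length
  three.\<close>

lemma triangle_free_simplices: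
  assumes "flag_complex K" "triangle_free K" "s \<in> K"
  shows "card s = 1 \<or> card s = 2"
proof (rule ccontr)
  assume n: "\<not> ?thesis"
  have fin: "finite s" "s \<noteq> {}" and sub: "\<And>t. t \<subseteq> s \<Longrightarrow> t \<noteq> {} \<Longrightarrow> t \<in> K"
    using assms(1,3) unfolding flag_complex_def simplicial_complex_def by blast+
  have "card s \<noteq> 0" using fin by simp
  then have "3 \<le> card s" using n by linarith
  then obtain t where t: "t \<subseteq> s" "card t = 3" by (rule obtain_subset_with_card_n)
  then obtain a b c where abc: "t = {a, b, c}" "a \<noteq> b" "b \<noteq> c" "a \<noteq> c" by (auto simp: card_3_iff)
  have "adjacent K a b" "adjacent K b c" "adjacent K c a"
    using abc t(1) sub[of "{a, b}"] sub[of "{b, c}"] sub[of "{c, a}"] by (simp_all add: adjacent_def)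
  then have "edge_cycle K [a, b, c]" using abc by (simp add: edge_cycle_def)
  moreover have "length [a, b, c] = 3" by simp
  ultimately show False using assms(2) unfolding triangle_free_def by blast
qed

lemma triangle_free_adjacent:
  assumes "triangle_free K" "adjacent K u v" "adjacent K u x"
  shows "\<not> adjacent K v x"
proof
  assume "adjacent K v x"
  then have "edge_cycle K [u, v, x]"
    using assms(2,3) adjacent_commute[of K x u] by (simp add: edge_cycle_def) (simp add: adjacent_def)
  moreover have "length [u, v, x] = 3" by simp
  ultimately show False using assms(1) unfolding triangle_free_def by blast
qed

lemma tree_list_properties:
  assumes "tree_list A L"
  shows "distinct L" "card (visited L) = Suc (length L)" "(p, c) \<in> set L \<Longrightarrow> p \<in> visited L \<and> c \<noteq> 0"
    "(p, c) \<in> set L \<Longrightarrow> (c, p) \<notin> set L"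
proof -
  have P: "fst ` set L \<subseteq> visited L \<and> 0 \<notin> snd ` set L \<and> distinct L \<and> card (visited L) = Suc (length L) \<and>
    (\<forall>p c. (p, c) \<in> set L \<longrightarrow> (c, p) \<notin> set L)"
    using assms
  proof (induction rule: tree_list.induct)
    case Nil then show ?case by (simp add: visited_def)
  next
    case (snoc L p c)
    have v: "visited (L @ [(p, c)]) = insert c (visited L)" by (auto simp: visited_def)
    have fin: "finite (visited L)" and sub: "snd ` set L \<subseteq> visited L" and c0: "c \<noteq> 0"
      using snoc.hyps(3) by (auto simp: visited_def)
    have c1: "c \<notin> fst ` set L" and c2: "c \<notin> snd ` set L" and pc: "p \<noteq> c"
      using snoc.IH snoc.hyps(2,3) sub by blast+
    have c: "(c, x) \<notin> set L" "(x, c) \<notin> set L" for x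
      using c1 c2 image_eqI[of c fst "(c, x)" "set L"] image_eqI[of c snd "(x, c)" "set L"] by auto
    show ?case
      unfolding v
    proof (intro conjI allI impI)
      show "fst ` set (L @ [(p, c)]) \<subseteq> insert c (visited L)" using snoc.IH snoc.hyps(2) by simp blast
      show "0 \<notin> snd ` set (L @ [(p, c)])" using snoc.IH c0 by simp
      show "distinct (L @ [(p, c)])" using snoc.IH c(2)[of p] by simp
      show "card (insert c (visited L)) = Suc (length (L @ [(p, c)]))" using snoc.IH snoc.hyps(3) fin by simp
      fix x y assume "(x, y) \<in> set (L @ [(p, c)])"
      then show "(y, x) \<notin> set (L @ [(p, c)])"
        using snoc.IH pc c(1)[of p] c(1)[of x] by (cases "(x, y) = (p, c)") auto
    qed
  qed
  show "distinct L" "card (visited L) = Suc (length L)" using P by blast+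
  show "(p, c) \<in> set L \<Longrightarrow> (c, p) \<notin> set L" using P by blast
  show "(p, c) \<in> set L \<Longrightarrow> p \<in> visited L \<and> c \<noteq> 0"
  proof -
    assume m: "(p, c) \<in> set L"
    have "p \<in> fst ` set L" by (rule image_eqI[OF _ m]) simp
    then have "p \<in> visited L" by (rule subsetD[OF conjunct1[OF P]])
    moreover have c: "c \<in> snd ` set L" by (rule image_eqI[OF _ m]) simp
    have "c \<noteq> 0"
    proof
      assume "c = 0"
      with c P show False by simp
    qed
    ultimately show "p \<in> visited L \<and> c \<noteq> 0" ..
  qed
qed

section \<open>The algorithm and its computability\<close>

section \<open>The algorithm\<close>

text \<open>The simplex {i, j} has code 2^i + 2^j. For i = j this number would be the code of the
  vertex i + 1, hence the inequality.\<close>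

definition edge_bit :: "nat \<Rightarrow> nat \<Rightarrow> nat \<Rightarrow> bool"
  where "edge_bit e i j \<longleftrightarrow> i \<noteq> j \<and> 2 ^ i + 2 ^ j \<in> set_decode e"

text \<open>The search bound is safe: if 2^i belongs to the set coded by e, then i < 2^i <
  e.\<close>

definition num_vertices :: "nat \<Rightarrow> nat"
  where "num_vertices e = length (filter (\<lambda>i. 2 ^ i \<in> set_decode e) [0..<e])"

definition pairs :: "nat \<Rightarrow> (nat \<times> nat) list"
  where "pairs N = concat (map (\<lambda>i. map (\<lambda>j. (i, j)) [0..<N]) [0..<N])"

text \<open>The first pair in a fixed order that leaves the visited set is appended. With t the code
  of the given tree, this lists the edges of that tree directed away from the root.\<close>

definition tree_step :: "nat \<Rightarrow> nat \<Rightarrow> (nat \<times> nat) list \<Rightarrow> (nat \<times> nat) list"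
  where "tree_step t N L = (case filter (\<lambda>q. fst q \<in> set (0 # map snd L) \<and> snd q \<notin> set (0 # map snd L) \<and>
      edge_bit t (fst q) (snd q)) (pairs N) of [] \<Rightarrow> L | q # _ \<Rightarrow> L @ [q])"

definition tree_edges :: "nat \<Rightarrow> nat \<Rightarrow> (nat \<times> nat) list"
  where "tree_edges t N = rec_nat [] (\<lambda>_. tree_step t N) (N - 1)"

text \<open>Each remaining edge appears once, smaller index first. Membership of a pair in
  \<open>L\<close> is tested by comparing components, as computable equality is established for
  numbers.\<close>

definition other_edges :: "nat \<Rightarrow> nat \<Rightarrow> (nat \<times> nat) list \<Rightarrow> (nat \<times> nat) list"
  where "other_edges e N L = filter (\<lambda>q. fst q < snd q \<and> edge_bit e (fst q) (snd q) \<and>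
      filter (\<lambda>r. fst r = fst q \<and> snd r = snd q \<or> fst r = snd q \<and> snd r = fst q) L = []) (pairs N)"

text \<open>A row is an association list that maps each vertex \<open>v\<close> to the word \<open>Y i v\<close>.\<close>

definition look :: "(nat \<times> nat word) list \<Rightarrow> nat \<Rightarrow> nat word"
  where "look r v = (case filter (\<lambda>q. fst q = v) r of [] \<Rightarrow> [] | q # _ \<Rightarrow> snd q)"

text \<open>For n = 1 level 0 is also the top level n - 1, at which the root contributes its
  generator.\<close>

definition first_row :: "nat \<Rightarrow> nat \<Rightarrow> (nat \<times> nat word) list"
  where "first_row n N = map (\<lambda>v. (v, if v = 0 then if n = 1 then [(0, False)] else [] else [(v, False)])) [0..<N]"

text \<open>The row of level i + 1 grows along the tree, so the new word of the parent is already in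
  s. The test \<open>Suc (Suc i) = n\<close> says that this new level is n - 1.\<close>

definition next_row :: "nat \<Rightarrow> nat \<Rightarrow> (nat \<times> nat) list \<Rightarrow> (nat \<times> nat word) list \<Rightarrow> (nat \<times> nat word) list"
  where "next_row n i L r = foldl (\<lambda>s q. (snd q, inv_word (look r (fst q)) @ look r (snd q) @ look s (fst q)) # s)
    [(0, if Suc (Suc i) = n then [(0, False)] else [])] L"

definition row :: "nat \<Rightarrow> nat \<Rightarrow> (nat \<times> nat) list \<Rightarrow> nat \<Rightarrow> (nat \<times> nat word) list"
  where "row n N L i = rec_nat (first_row n N) (\<lambda>i. next_row n i L) i"

definition relator_index :: "nat \<Rightarrow> nat \<Rightarrow> nat \<Rightarrow> (nat \<times> nat) list \<Rightarrow> ((nat \<times> nat) \<times> nat) list"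
  where "relator_index e n N L =
    map (\<lambda>q. (q, n - 1)) L @ concat (map (\<lambda>q. map (\<lambda>i. (q, i)) [0..<n]) (other_edges e N L))"

text \<open>The successor modulo n is written as a conditional, which the computability rules
  cover.\<close>

definition relator_word :: "nat \<Rightarrow> nat \<Rightarrow> (nat \<times> nat) list \<Rightarrow> (nat \<times> nat) \<times> nat \<Rightarrow> nat word"
  where "relator_word n N L k = look (row n N L (snd k)) (fst (fst k)) @
    look (row n N L (if Suc (snd k) = n then 0 else Suc (snd k))) (snd (fst k)) @
    inv_word (look (row n N L (if Suc (snd k) = n then 0 else Suc (snd k))) (fst (fst k))) @
    inv_word (look (row n N L (snd k)) (snd (fst k)))"

definition cover_relators :: "nat \<Rightarrow> nat \<Rightarrow> nat \<Rightarrow> nat word list"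
  where "cover_relators e t n = map (relator_word n (num_vertices e) (tree_edges t (num_vertices e)))
    (relator_index e n (num_vertices e) (tree_edges t (num_vertices e)))"

text \<open>Doubling by addition reproduces the letter code of \<open>encode_word\<close>.\<close>

definition coded_presentation :: "nat \<times> nat \<times> nat \<Rightarrow> nat \<times> nat list list"
  where "coded_presentation x = (num_vertices (fst x),
    map (map (\<lambda>l. fst l + fst l + (if snd l then 1 else 0))) (cover_relators (fst x) (fst (snd x)) (snd (snd x))))"

subsection \<open>Computability\<close>

text \<open>Functions of several arguments are brought to functions of one tuple, the form to which
  the rules apply.\<close>

lemma computable_2:
  "computable (\<lambda>p. f (fst p) (snd p)) \<Longrightarrow> computable a \<Longrightarrow> computable b \<Longrightarrow> computable (\<lambda>x. f (a x) (b x))"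
  using computable_compose[of "\<lambda>p. f (fst p) (snd p)" "\<lambda>x. (a x, b x)"] by (simp add: computable_Pair)

lemma computable_3:
  "computable (\<lambda>p. f (fst p) (fst (snd p)) (snd (snd p))) \<Longrightarrow> computable a \<Longrightarrow> computable b \<Longrightarrow> computable c \<Longrightarrow>
    computable (\<lambda>x. f (a x) (b x) (c x))"
  using computable_compose[of "\<lambda>p. f (fst p) (fst (snd p)) (snd (snd p))" "\<lambda>x. (a x, b x, c x)"]
  by (simp add: computable_Pair)

lemma computable_4:
  "computable (\<lambda>p. f (fst p) (fst (snd p)) (fst (snd (snd p))) (snd (snd (snd p)))) \<Longrightarrow>
    computable a \<Longrightarrow> computable b \<Longrightarrow> computable c \<Longrightarrow> computable d \<Longrightarrow> computable (\<lambda>x. f (a x) (b x) (c x) (d x))"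
  using computable_compose[of "\<lambda>p. f (fst p) (fst (snd p)) (fst (snd (snd p))) (snd (snd (snd p)))" "\<lambda>x. (a x, b x, c x, d x)"]
  by (simp add: computable_Pair)

lemma computable_is_Nil [computable_intros]:
  fixes l :: "'a :: encodable \<Rightarrow> 'b :: encodable list"
  shows "computable l \<Longrightarrow> computable (\<lambda>x. l x = [])"
proof -
  assume *: "computable l"
  have "computable (\<lambda>x. case l x of [] \<Rightarrow> True | y # ys \<Rightarrow> False)" by (intro computable_intros *)
  moreover have "(case l of [] \<Rightarrow> True | y # ys \<Rightarrow> False) = (l = [])" for l :: "'b list" by (cases l) auto
  ultimately show ?thesis by simp
qed

lemma computable_edge_bit [computable_intros]:
  "computable a \<Longrightarrow> computable b \<Longrightarrow> computable c \<Longrightarrow> computable (\<lambda>x. edge_bit (a x) (b x) (c x))"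
  by (rule computable_3[of edge_bit]) (unfold edge_bit_def, intro computable_intros)

lemma computable_num_vertices [computable_intros]: "computable a \<Longrightarrow> computable (\<lambda>x. num_vertices (a x))"
  by (rule computable_compose[of num_vertices]) (unfold num_vertices_def, intro computable_intros)

lemma computable_pairs [computable_intros]: "computable a \<Longrightarrow> computable (\<lambda>x. pairs (a x))"
  by (rule computable_compose[of pairs]) (unfold pairs_def, intro computable_intros)

lemma computable_tree_step [computable_intros]:
  "computable a \<Longrightarrow> computable b \<Longrightarrow> computable c \<Longrightarrow> computable (\<lambda>x. tree_step (a x) (b x) (c x))"
  by (rule computable_3[of tree_step]) (unfold tree_step_def, intro computable_intros)

lemma computable_tree_edges [computable_intros]:
  "computable a \<Longrightarrow> computable b \<Longrightarrow> computable (\<lambda>x. tree_edges (a x) (b x))"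
  by (rule computable_2[of tree_edges]) (unfold tree_edges_def, intro computable_intros)

lemma computable_other_edges [computable_intros]:
  "computable a \<Longrightarrow> computable b \<Longrightarrow> computable c \<Longrightarrow> computable (\<lambda>x. other_edges (a x) (b x) (c x))"
  by (rule computable_3[of other_edges]) (unfold other_edges_def, intro computable_intros)

lemma computable_look [computable_intros]:
  "computable a \<Longrightarrow> computable b \<Longrightarrow> computable (\<lambda>x. look (a x) (b x))"
  by (rule computable_2[of look]) (unfold look_def, intro computable_intros)

lemma computable_inv_word [computable_intros]:
  fixes w :: "'a :: encodable \<Rightarrow> nat word"
  shows "computable w \<Longrightarrow> computable (\<lambda>x. inv_word (w x))"
  by (rule computable_compose[of inv_word]) (unfold inv_word_def inv_letter_def, intro computable_intros)

lemma computable_first_row [computable_intros]: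
  "computable a \<Longrightarrow> computable b \<Longrightarrow> computable (\<lambda>x. first_row (a x) (b x))"
  by (rule computable_2[of first_row]) (unfold first_row_def, intro computable_intros)

lemma computable_next_row [computable_intros]:
  "computable a \<Longrightarrow> computable b \<Longrightarrow> computable c \<Longrightarrow> computable d \<Longrightarrow> computable (\<lambda>x. next_row (a x) (b x) (c x) (d x))"
  by (rule computable_4[of next_row]) (unfold next_row_def, intro computable_intros)

lemma computable_row [computable_intros]:
  "computable a \<Longrightarrow> computable b \<Longrightarrow> computable c \<Longrightarrow> computable d \<Longrightarrow> computable (\<lambda>x. row (a x) (b x) (c x) (d x))"
  by (rule computable_4[of row]) (unfold row_def, intro computable_intros)

lemma computable_relator_index [computable_intros]:
  "computable a \<Longrightarrow> computable b \<Longrightarrow> computable c \<Longrightarrow> computable d \<Longrightarrow> computable (\<lambda>x. relator_index (a x) (b x) (c x) (d x))"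
  by (rule computable_4[of relator_index]) (unfold relator_index_def, intro computable_intros)

lemma computable_relator_word [computable_intros]:
  "computable a \<Longrightarrow> computable b \<Longrightarrow> computable c \<Longrightarrow> computable d \<Longrightarrow> computable (\<lambda>x. relator_word (a x) (b x) (c x) (d x))"
  by (rule computable_4[of relator_word]) (unfold relator_word_def, intro computable_intros)

lemma computable_cover_relators [computable_intros]:
  "computable a \<Longrightarrow> computable b \<Longrightarrow> computable c \<Longrightarrow> computable (\<lambda>x. cover_relators (a x) (b x) (c x))"
  by (rule computable_3[of cover_relators]) (unfold cover_relators_def, intro computable_intros)

lemma computable_coded_presentation: "computable coded_presentation"
  unfolding coded_presentation_def[abs_def] by (intro computable_intros)

lemma recursive_coded_presentation:
  "\<exists>f. recursive_fun 3 f \<and> (\<forall>e t n. f [e, t, n] = encode (coded_presentation (e, t, n)))"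
proof -
  obtain F where "codes F coded_presentation" using computable_coded_presentation by (rule computableE)
  note F = codes_recf[OF this] codes_eq[OF this]
  have "recf 3 (\<lambda>xs. F (prod_encode (xs ! 0, prod_encode (xs ! 1, xs ! 2))))"
    by (intro F(1) recf_prod_encode recf_nth) simp_all
  then obtain f where f: "recursive_fun 3 f"
    "\<And>xs. length xs = 3 \<Longrightarrow> f xs = F (prod_encode (xs ! 0, prod_encode (xs ! 1, xs ! 2)))"
    by (auto simp: recf_def)
  have "f [e, t, n] = encode (coded_presentation (e, t, n))" for e t n
    using f(2)[of "[e, t, n]"] F(2)[of "(e, t, n)"] by (simp add: encode_prod_def encode_nat_def)
  with f(1) show ?thesis by blast
qed

section \<open>Correctness of the algorithm and the counts\<close>

subsection \<open>Correctness\<close>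

lemma simplicial_complex_finite: "simplicial_complex K \<Longrightarrow> s \<in> K \<Longrightarrow> finite s"
  unfolding simplicial_complex_def by blast

lemma mem_encode_complex:
  assumes "finite K" "simplicial_complex K" "finite X"
  shows "set_encode X \<in> set_decode (encode_complex \<nu> K) \<longleftrightarrow> (\<exists>s\<in>K. \<nu> ` s = X)"
proof -
  have dec: "set_decode (encode_complex \<nu> K) = (\<lambda>s. set_encode (\<nu> ` s)) ` K"
    unfolding encode_complex_def by (rule set_encode_inverse) (use assms(1) in simp)
  have eq: "set_encode X = set_encode (\<nu> ` s) \<longleftrightarrow> X = \<nu> ` s" if "s \<in> K" for s
    by (rule set_encode_eq[OF assms(3)]) (use simplicial_complex_finite[OF assms(2) that] in simp)
  show ?thesis unfolding dec image_iff using eq by blast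
qed

lemma vertex_bit_iff:
  assumes "finite K" "simplicial_complex K"
  shows "2 ^ i \<in> set_decode (encode_complex \<nu> K) \<longleftrightarrow> i \<in> \<nu> ` vertices K"
proof -
  have code: "set_encode {i} = 2 ^ i" by (simp add: set_encode_def)
  have "2 ^ i \<in> set_decode (encode_complex \<nu> K) \<longleftrightarrow> (\<exists>s\<in>K. \<nu> ` s = {i})"
    using mem_encode_complex[OF assms, of "{i}" \<nu>] unfolding code by simp
  also have "\<dots> \<longleftrightarrow> i \<in> \<nu> ` vertices K"
  proof
    assume "\<exists>s\<in>K. \<nu> ` s = {i}"
    then obtain s where s: "s \<in> K" "\<nu> ` s = {i}" by blast
    then obtain x where "x \<in> s" "\<nu> x = i" by blast
    with s show "i \<in> \<nu> ` vertices K" by (auto simp: vertices_def)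
  next
    assume "i \<in> \<nu> ` vertices K"
    then obtain x s where x: "s \<in> K" "x \<in> s" "\<nu> x = i" by (auto simp: vertices_def)
    then have "{x} \<in> K" using simplicial_complex_subset[OF assms(2), of s "{x}"] by simp
    then show "\<exists>s\<in>K. \<nu> ` s = {i}" using x(3) by (intro bexI[of _ "{x}"]) auto
  qed
  finally show ?thesis .
qed

lemma edge_bit_iff:
  assumes "finite K" "simplicial_complex K" "inj_on \<nu> (vertices K)"
  shows "edge_bit (encode_complex \<nu> K) i j \<longleftrightarrow> (\<exists>u v. adjacent K u v \<and> \<nu> u = i \<and> \<nu> v = j)"
proof
  assume e: "edge_bit (encode_complex \<nu> K) i j"
  then have ij: "i \<noteq> j" by (simp add: edge_bit_def)
  then have code: "set_encode {i, j} = 2 ^ i + 2 ^ j" by (simp add: set_encode_def)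
  have "2 ^ i + 2 ^ j \<in> set_decode (encode_complex \<nu> K)" using e by (simp add: edge_bit_def)
  then obtain s where s: "s \<in> K" "\<nu> ` s = {i, j}"
    using mem_encode_complex[OF assms(1,2), of "{i, j}" \<nu>] unfolding code by blast
  have "i \<in> \<nu> ` s" "j \<in> \<nu> ` s" unfolding s(2) by simp_all
  then obtain u v where uv: "u \<in> s" "\<nu> u = i" "v \<in> s" "\<nu> v = j" by blast
  then have "{u, v} \<in> K" using simplicial_complex_subset[OF assms(2) s(1), of "{u, v}"] by simp
  moreover have "u \<noteq> v" using uv ij by blast
  ultimately have "adjacent K u v" by (simp add: adjacent_def)
  with uv show "\<exists>u v. adjacent K u v \<and> \<nu> u = i \<and> \<nu> v = j" by blast
next
  assume "\<exists>u v. adjacent K u v \<and> \<nu> u = i \<and> \<nu> v = j"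
  then obtain u v where uv: "adjacent K u v" "\<nu> u = i" "\<nu> v = j" by blast
  then have "u \<noteq> v" "{u, v} \<in> K" "u \<in> vertices K" "v \<in> vertices K"
    using adjacent_vertices[OF uv(1)] by (simp_all add: adjacent_def)
  moreover from this have ij: "i \<noteq> j" using uv inj_on_eq_iff[OF assms(3), of u v] by simp
  moreover have "\<exists>s\<in>K. \<nu> ` s = {i, j}" by (rule bexI[of _ "{u, v}"]) (use uv calculation in simp_all)
  ultimately have "set_encode {i, j} \<in> set_decode (encode_complex \<nu> K)"
    using mem_encode_complex[OF assms(1,2), of "{i, j}" \<nu>] by blast
  then show "edge_bit (encode_complex \<nu> K) i j" using ij by (simp add: edge_bit_def set_encode_def)
qed

lemma set_decode_less: "i \<in> set_decode x \<Longrightarrow> i < x"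
proof -
  assume "i \<in> set_decode x"
  then have "odd (x div 2 ^ i)" by (simp add: set_decode_def)
  then have "x div 2 ^ i \<noteq> 0" by (rule contrapos_nn) simp
  then have "2 ^ i \<le> x" by (simp add: div_eq_0_iff)
  then show ?thesis using less_exp[of i] by linarith
qed

lemma num_vertices_eq:
  assumes "finite K" "simplicial_complex K" "\<nu> ` vertices K = {..<N}"
  shows "num_vertices (encode_complex \<nu> K) = N"
proof -
  let ?e = "encode_complex \<nu> K"
  have iff: "2 ^ i \<in> set_decode ?e \<longleftrightarrow> i < N" for i using vertex_bit_iff[OF assms(1,2), of i \<nu>] assms(3) by simp
  have lt: "i < ?e" if "i < N" for i
    using set_decode_less[of "2 ^ i" ?e] iff[of i] that less_exp[of i] by linarith
  have "num_vertices ?e = card (set (filter (\<lambda>i. 2 ^ i \<in> set_decode ?e) [0..<?e]))"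
    unfolding num_vertices_def by (rule distinct_card[symmetric]) simp
  also have "set (filter (\<lambda>i. 2 ^ i \<in> set_decode ?e) [0..<?e]) = {..<N}"
    using lt by (auto simp: iff)
  finally show ?thesis by simp
qed

lemma pairs_product: "pairs N = List.product [0..<N] [0..<N]"
  by (simp add: pairs_def product_concat_map)

text \<open>Each of the N - 1 steps succeeds: while fewer than N vertices are visited, the
  connectedness hypothesis provides an edge that leaves them.\<close>

lemma tree_edges_correct:
  assumes N: "0 < N"
    and conn: "\<And>U. 0 \<in> U \<Longrightarrow> U \<subseteq> {..<N} \<Longrightarrow> U \<noteq> {..<N} \<Longrightarrow> \<exists>p\<in>U. \<exists>c\<in>{..<N} - U. edge_bit t p c"
    and A: "\<And>p c. edge_bit t p c \<Longrightarrow> p < N \<Longrightarrow> c < N \<Longrightarrow> A p c"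
  shows "tree_list A (tree_edges t N) \<and> visited (tree_edges t N) = {..<N}"
proof -
  let ?L = "\<lambda>k. rec_nat [] (\<lambda>_. tree_step t N) k"
  have *: "tree_list A (?L k) \<and> length (?L k) = k \<and> visited (?L k) \<subseteq> {..<N}" if "k < N" for k
    using that
  proof (induction k)
    case 0
    have "tree_list A [] \<and> length [] = 0 \<and> visited [] \<subseteq> {..<N}"
      using N by (intro conjI tree_list.Nil) (simp_all add: visited_def)
    then show ?case by (simp only: nat.rec list.size)
  next
    case (Suc k)
    define M where "M = ?L k"
    let ?F = "filter (\<lambda>q. fst q \<in> set (0 # map snd M) \<and> snd q \<notin> set (0 # map snd M) \<and> edge_bit t (fst q) (snd q)) (pairs N)"
    have "tree_list A M \<and> length M = k \<and> visited M \<subseteq> {..<N}"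
      unfolding M_def by (rule Suc.IH[OF Suc_lessD[OF Suc.prems]])
    then have M: "tree_list A M" "length M = k" "visited M \<subseteq> {..<N}" by simp_all
    have vis: "set (0 # map snd M) = visited M" by (simp add: visited_def)
    have "card (visited M) = Suc k" using tree_list_properties(2)[OF M(1)] M(2) by simp
    then have "visited M \<noteq> {..<N}" using Suc.prems card_lessThan[of N] by force
    moreover have "0 \<in> visited M" by (simp add: visited_def)
    ultimately obtain p c where pc: "p \<in> visited M" "c \<in> {..<N} - visited M" "edge_bit t p c"
      using conn[of "visited M"] M(3) by blast
    have memF: "q \<in> set ?F \<longleftrightarrow> fst q \<in> visited M \<and> snd q \<notin> visited M \<and> edge_bit t (fst q) (snd q) \<and> fst q < N \<and> snd q < N" for q
      unfolding set_filter vis pairs_product by (cases q) auto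
    have "(p, c) \<in> set ?F" unfolding memF using pc M(3) by auto
    then have "?F \<noteq> []" by (metis empty_iff list.set(1))
    then obtain q F where F: "?F = q # F" by (meson neq_Nil_conv)
    then have "q \<in> set ?F" by (metis list.set_intros(1))
    then have q: "fst q \<in> visited M" "snd q \<notin> visited M" "edge_bit t (fst q) (snd q)" "fst q < N" "snd q < N"
      unfolding memF by blast+
    have "?L (Suc k) = tree_step t N M" by (simp add: M_def)
    also have "\<dots> = M @ [(fst q, snd q)]" unfolding tree_step_def F by simp
    finally have step: "?L (Suc k) = M @ [(fst q, snd q)]" .
    have "visited (?L (Suc k)) = insert (snd q) (visited M)" unfolding step by (simp add: visited_def insert_commute)
    moreover have "tree_list A (?L (Suc k))"
      unfolding step by (rule tree_list.snoc[OF M(1) q(1,2) A[OF q(3,4,5)]])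
    moreover have "length (?L (Suc k)) = Suc k" unfolding step using M(2) by simp
    ultimately show ?case using M(3) q(5) by (simp only: insert_subset lessThan_iff simp_thms)
  qed
  have L: "tree_list A (tree_edges t N)" "length (tree_edges t N) = N - 1" "visited (tree_edges t N) \<subseteq> {..<N}"
    using *[of "N - 1"] N unfolding tree_edges_def by simp_all
  have "card (visited (tree_edges t N)) = N" using tree_list_properties(2)[OF L(1)] L(2) N by simp
  then have "visited (tree_edges t N) = {..<N}" using L(3) by (intro card_subset_eq) auto
  with L(1) show ?thesis by (rule_tac conjI)
qed

lemma look_Cons: "look (q # r) v = (if fst q = v then snd q else look r v)"
  by (simp add: look_def)

lemma look_first_row: "v < N \<Longrightarrow> look (first_row n N) v = (if v = 0 then if n = 1 then [(0, False)] else [] else [(v, False)])"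
proof -
  have "v \<in> set vs \<Longrightarrow> look (map (\<lambda>v. (v, f v)) vs) v = f v" for f vs
    by (induction vs) (auto simp: look_Cons)
  then show "v < N \<Longrightarrow> ?thesis" by (simp add: first_row_def)
qed

lemma next_row_snoc:
  "next_row n i (L @ [q]) r = (snd q, inv_word (look r (fst q)) @ look r (snd q) @ look (next_row n i L r) (fst q)) # next_row n i L r"
  by (simp add: next_row_def)

text \<open>Entries are prepended, yet none is ever shadowed, because a child is new at the moment
  its edge is processed.\<close>

lemma look_next_row:
  assumes "tree_list A L"
  shows "look (next_row n i L r) 0 = (if Suc (Suc i) = n then [(0, False)] else []) \<and>
    (\<forall>p c. (p, c) \<in> set L \<longrightarrow> look (next_row n i L r) c = inv_word (look r p) @ look r c @ look (next_row n i L r) p)"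
  using assms
proof (induction rule: tree_list.induct)
  case Nil
  then show ?case by (simp add: next_row_def look_Cons)
next
  case (snoc L p c)
  have ne: "x \<noteq> c" if "x \<in> visited L" for x using that snoc.hyps(3) by blast
  have same: "look (next_row n i (L @ [(p, c)]) r) x = look (next_row n i L r) x" if "x \<in> visited L" for x
    using ne[OF that] by (simp add: next_row_snoc look_Cons)
  have new: "look (next_row n i (L @ [(p, c)]) r) c = inv_word (look r p) @ look r c @ look (next_row n i (L @ [(p, c)]) r) p"
    using same[OF snoc.hyps(2)] by (simp add: next_row_snoc look_Cons)
  have zero: "0 \<in> visited L" by (simp add: visited_def)
  show ?case
  proof (intro conjI allI impI)
    show "look (next_row n i (L @ [(p, c)]) r) 0 = (if Suc (Suc i) = n then [(0, False)] else [])"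
      unfolding same[OF zero] using snoc.IH by simp
    fix x y assume xy: "(x, y) \<in> set (L @ [(p, c)])"
    show "look (next_row n i (L @ [(p, c)]) r) y = inv_word (look r x) @ look r y @ look (next_row n i (L @ [(p, c)]) r) x"
    proof (cases "(x, y) \<in> set L")
      case True
      have "y \<in> snd ` set L" by (rule image_eqI[OF _ True]) simp
      then have "y \<in> visited L" by (simp add: visited_def)
      moreover have "x \<in> visited L" using tree_list_properties(3)[OF snoc.hyps(1) True] by simp
      ultimately show ?thesis using snoc.IH True by (simp add: same)
    next
      case False
      then show ?thesis using xy new by simp
    qed
  qed
qed

lemma set_other_edges:
  "(i, j) \<in> set (other_edges e N L) \<longleftrightarrow> i < j \<and> j < N \<and> edge_bit e i j \<and> (i, j) \<notin> set L \<and> (j, i) \<notin> set L"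
proof -
  have "filter (\<lambda>r. fst r = i \<and> snd r = j \<or> fst r = j \<and> snd r = i) L = [] \<longleftrightarrow> (i, j) \<notin> set L \<and> (j, i) \<notin> set L"
    unfolding filter_empty_conv by force
  then show ?thesis unfolding other_edges_def pairs_product by auto
qed

lemma distinct_other_edges: "distinct (other_edges e N L)"
  by (simp add: other_edges_def pairs_product distinct_product)

lemma relator_index_product:
  "relator_index e n N L = map (\<lambda>q. (q, n - 1)) L @ List.product (other_edges e N L) [0..<n]"
  by (simp add: relator_index_def product_concat_map)

lemma set_relator_index:
  "((u, v), i) \<in> set (relator_index e n N L) \<longleftrightarrow>
    (u, v) \<in> set L \<and> i = n - 1 \<or> (u, v) \<in> set (other_edges e N L) \<and> i < n"
  unfolding relator_index_product by auto

lemma distinct_relator_index: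
  assumes "distinct L"
  shows "distinct (relator_index e n N L)"
proof -
  have "distinct (map (\<lambda>q. (q, n - 1)) L)" using assms by (simp add: distinct_map inj_on_def)
  moreover have "distinct (List.product (other_edges e N L) [0..<n])"
    by (simp add: distinct_product distinct_other_edges)
  moreover have "set (map (\<lambda>q. (q, n - 1)) L) \<inter> set (List.product (other_edges e N L) [0..<n]) = {}"
    using set_other_edges[of _ _ e N L] by auto
  ultimately show ?thesis by (simp only: relator_index_product distinct_append)
qed

lemma euler_char_graph:
  assumes "finite K" "flag_complex K" "triangle_free K"
  shows "euler_char K = int (card (vertices K)) - int (card {s \<in> K. card s = 2})"
proof -
  have simplicial: "simplicial_complex K" using assms(2) by (simp add: flag_complex_def)
  have dim: "card s = 1 \<or> card s = 2" if "s \<in> K" for s using triangle_free_simplices[OF assms(2,3) that] .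
  let ?V = "{s \<in> K. card s = 1}" and ?E = "{s \<in> K. card s = 2}"
  have union: "?V \<union> ?E = K" using dim by blast
  have "euler_char K = (\<Sum>s\<in>?V \<union> ?E. (-1) ^ (card s - 1))" by (simp only: union euler_char_def)
  also have "\<dots> = (\<Sum>s\<in>?V. (-1) ^ (card s - 1)) + (\<Sum>s\<in>?E. (-1) ^ (card s - 1))"
  proof (rule sum.union_disjoint)
    show "finite ?V" "finite ?E" by (rule finite_subset[OF _ assms(1)], blast)+
    show "?V \<inter> ?E = {}" by (simp add: disjoint_iff)
  qed
  finally have sum: "euler_char K = (\<Sum>s\<in>?V. (-1) ^ (card s - 1)) + (\<Sum>s\<in>?E. (-1) ^ (card s - 1))" .
  have V: "(\<Sum>s\<in>?V. (-1) ^ (card s - 1)) = (\<Sum>s\<in>?V. 1 :: int)" by (rule sum.cong) auto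
  have E: "(\<Sum>s\<in>?E. (-1) ^ (card s - 1)) = (\<Sum>s\<in>?E. - 1 :: int)" by (rule sum.cong) auto
  have "euler_char K = int (card ?V) - int (card ?E)" unfolding sum V E by simp
  moreover have img: "(\<lambda>v. {v}) ` vertices K = ?V"
  proof (intro equalityI subsetI)
    fix s assume "s \<in> ?V"
    then have s: "s \<in> K" "card s = 1" by blast+
    obtain v where v: "s = {v}" by (rule card_1_singletonE[OF s(2)])
    then have "v \<in> vertices K" using s(1) unfolding vertices_def by blast
    with v show "s \<in> (\<lambda>v. {v}) ` vertices K" by blast
  next
    fix s assume "s \<in> (\<lambda>v. {v}) ` vertices K"
    then obtain v t where v: "s = {v}" "v \<in> t" "t \<in> K" unfolding vertices_def by blast
    have "{v} \<in> K" by (rule simplicial_complex_subset[OF simplicial v(3)]) (use v(2) in auto)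
    then show "s \<in> ?V" unfolding v(1) by simp
  qed
  have "card ?V = card (vertices K)" unfolding img[symmetric] by (rule card_image) simp
  ultimately show ?thesis by simp
qed

lemma edge_bit_commute: "edge_bit e i j \<longleftrightarrow> edge_bit e j i"
  by (simp add: edge_bit_def add.commute eq_commute)

text \<open>Sorting endpoints sends tree edges into the increasing pairs; it is injective because a
  tree edge is never listed in both orientations.\<close>

lemma length_other_edges:
  assumes tree: "tree_list A L" and vis: "visited L = {..<N}" and edge: "\<And>p c. (p, c) \<in> set L \<Longrightarrow> edge_bit e p c"
  shows "length (other_edges e N L) + (N - 1) = card {(i, j). i < j \<and> j < N \<and> edge_bit e i j}"
proof -
  let ?E = "{(i, j). i < j \<and> j < N \<and> edge_bit e i j}"
  define srt :: "nat \<times> nat \<Rightarrow> nat \<times> nat" where "srt q = (if fst q < snd q then q else (snd q, fst q))" for q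
  have lt: "p < N \<and> c < N \<and> p \<noteq> c \<and> edge_bit e p c" if "(p, c) \<in> set L" for p c
  proof -
    have "c \<in> snd ` set L" by (rule image_eqI[OF _ that]) simp
    then have "c \<in> visited L" by (simp add: visited_def)
    moreover have "p \<in> visited L" using tree_list_properties(3)[OF tree that] by simp
    ultimately show ?thesis using vis edge[OF that] by (simp add: edge_bit_def)
  qed
  have finE: "finite ?E" by (rule finite_subset[of _ "{..<N} \<times> {..<N}"]) auto
  have sub: "srt ` set L \<subseteq> ?E"
  proof
    fix q assume "q \<in> srt ` set L"
    then obtain p c where pc: "(p, c) \<in> set L" "q = srt (p, c)" by (metis imageE surj_pair)
    then show "q \<in> ?E" using lt[OF pc(1)] edge_bit_commute[of e p c] by (auto simp: srt_def)
  qed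
  have mem: "(i, j) \<in> srt ` set L \<longleftrightarrow> (i, j) \<in> set L \<or> (j, i) \<in> set L" if "i < j" for i j
  proof
    assume "(i, j) \<in> srt ` set L"
    then obtain p c where "(p, c) \<in> set L" "(i, j) = srt (p, c)" by (metis imageE surj_pair)
    then show "(i, j) \<in> set L \<or> (j, i) \<in> set L" by (simp add: srt_def split: if_splits)
  next
    assume "(i, j) \<in> set L \<or> (j, i) \<in> set L"
    then show "(i, j) \<in> srt ` set L"
    proof
      assume "(i, j) \<in> set L" then show ?thesis using that by (intro image_eqI[of _ _ "(i, j)"]) (simp_all add: srt_def)
    next
      assume "(j, i) \<in> set L" then show ?thesis using that by (intro image_eqI[of _ _ "(j, i)"]) (simp_all add: srt_def)
    qed
  qed
  have "set (other_edges e N L) = ?E - srt ` set L"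
  proof (rule Set.set_eqI)
    fix q :: "nat \<times> nat"
    obtain i j where q: "q = (i, j)" by (cases q)
    show "q \<in> set (other_edges e N L) \<longleftrightarrow> q \<in> ?E - srt ` set L"
      unfolding q set_other_edges using mem[of i j] by blast
  qed
  then have "length (other_edges e N L) = card (?E - srt ` set L)"
    using distinct_card[OF distinct_other_edges[of e N L]] by simp
  also have "\<dots> = card ?E - card (srt ` set L)"
    by (rule card_Diff_subset) (use sub in simp_all)
  finally have diff: "length (other_edges e N L) = card ?E - card (srt ` set L)" .
  have cardS: "card (srt ` set L) = length L"
  proof -
    have "inj_on srt (set L)"
    proof (rule inj_onI)
      fix q r assume q: "q \<in> set L" and r: "r \<in> set L" and eq: "srt q = srt r"
      obtain a b where qa: "q = (a, b)" by (cases q)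
      obtain c d where rc: "r = (c, d)" by (cases r)
      have "(b, a) \<notin> set L" using tree_list_properties(4)[OF tree] q qa by blast
      then show "q = r" using eq r unfolding qa rc by (auto simp: srt_def split: if_splits)
    qed
    then show ?thesis using distinct_card[OF tree_list_properties(1)[OF tree]] by (simp add: card_image)
  qed
  have "length L = N - 1" using tree_list_properties(2)[OF tree] vis by simp
  then show ?thesis using diff cardS card_mono[OF finE sub] by linarith
qed

lemma edge_bit_index:
  assumes "finite K" "simplicial_complex K" "bij_betw \<nu> (vertices K) {..<N}"
  shows "edge_bit (encode_complex \<nu> K) i j \<longleftrightarrow> index_adj K (inv_into (vertices K) \<nu>) N i j"
proof -
  let ?\<mu> = "inv_into (vertices K) \<nu>"
  have inj: "inj_on \<nu> (vertices K)" and im: "\<nu> ` vertices K = {..<N}" using assms(3) by (auto simp: bij_betw_def)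
  have \<nu>\<mu>: "\<nu> (?\<mu> k) = k" if "k < N" for k using f_inv_into_f[of k \<nu> "vertices K"] im that by simp
  show ?thesis
    unfolding edge_bit_iff[OF assms(1,2) inj] index_adj_def
  proof
    assume "\<exists>u v. adjacent K u v \<and> \<nu> u = i \<and> \<nu> v = j"
    then obtain u v where uv: "adjacent K u v" "\<nu> u = i" "\<nu> v = j" by blast
    have V: "u \<in> vertices K" "v \<in> vertices K" using adjacent_vertices[OF uv(1)] by simp_all
    then have "i \<in> {..<N}" "j \<in> {..<N}" unfolding im[symmetric] using uv by blast+
    moreover have "?\<mu> i = u" "?\<mu> j = v" using inv_into_f_f[OF inj] V uv by auto
    ultimately show "i < N \<and> j < N \<and> adjacent K (?\<mu> i) (?\<mu> j)" using uv(1) by simp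
  next
    assume "i < N \<and> j < N \<and> adjacent K (?\<mu> i) (?\<mu> j)"
    then show "\<exists>u v. adjacent K u v \<and> \<nu> u = i \<and> \<nu> v = j" using \<nu>\<mu> by blast
  qed
qed

lemma card_edges:
  assumes bij: "bij_betw \<mu> {..<N} (vertices K)"
  shows "card {(i, j). i < j \<and> j < N \<and> index_adj K \<mu> N i j} = card {s \<in> K. card s = 2}"
proof (rule bij_betw_same_card[of "\<lambda>q. {\<mu> (fst q), \<mu> (snd q)}"], rule bij_betw_imageI)
  have inj: "\<mu> i = \<mu> j \<longleftrightarrow> i = j" if "i < N" "j < N" for i j
    using inj_on_eq_iff[OF bij_betw_imp_inj_on[OF bij]] that by simp
  let ?E = "{(i, j). i < j \<and> j < N \<and> index_adj K \<mu> N i j}"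
  show "inj_on (\<lambda>q. {\<mu> (fst q), \<mu> (snd q)}) ?E"
  proof (rule inj_onI)
    fix q r assume q: "q \<in> ?E" and r: "r \<in> ?E" and eq: "{\<mu> (fst q), \<mu> (snd q)} = {\<mu> (fst r), \<mu> (snd r)}"
    obtain a b where qa: "q = (a, b)" by (cases q)
    obtain c d where rc: "r = (c, d)" by (cases r)
    have lt: "a < b" "b < N" "c < d" "d < N" using q r by (simp_all add: qa rc)
    have "a = c \<and> b = d \<or> a = d \<and> b = c"
      using eq lt inj[of a c] inj[of b d] inj[of a d] inj[of b c] by (simp add: qa rc doubleton_eq_iff)
    then show "q = r" using lt by (auto simp: qa rc)
  qed
  show "(\<lambda>q. {\<mu> (fst q), \<mu> (snd q)}) ` ?E = {s \<in> K. card s = 2}"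
  proof (intro equalityI subsetI)
    fix s assume "s \<in> (\<lambda>q. {\<mu> (fst q), \<mu> (snd q)}) ` ?E"
    then obtain i j where "index_adj K \<mu> N i j" "s = {\<mu> i, \<mu> j}" by auto
    then show "s \<in> {s \<in> K. card s = 2}" by (auto simp: index_adj_def adjacent_def)
  next
    fix s assume "s \<in> {s \<in> K. card s = 2}"
    then obtain u v where s: "s \<in> K" "s = {u, v}" "u \<noteq> v" by (auto simp: card_2_iff)
    then have "u \<in> vertices K" "v \<in> vertices K" by (auto simp: vertices_def)
    then obtain i j where ij: "i < N" "u = \<mu> i" "j < N" "v = \<mu> j"
      unfolding bij_betw_imp_surj_on[OF bij, symmetric] by auto
    then have ne: "i \<noteq> j" using s by blast
    have a: "index_adj K \<mu> N i j" "index_adj K \<mu> N j i"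
      using s ij by (simp_all add: index_adj_def adjacent_def insert_commute)
    show "s \<in> (\<lambda>q. {\<mu> (fst q), \<mu> (snd q)}) ` ?E"
    proof (cases "i < j")
      case True
      then show ?thesis using a ij s by (intro image_eqI[of _ _ "(i, j)"]) simp_all
    next
      case False
      then show ?thesis using a ij s ne by (intro image_eqI[of _ _ "(j, i)"]) (simp_all add: insert_commute)
    qed
  qed
qed

text \<open>The count is stated additively to avoid truncated subtraction: N - 1 tree relators, and
  n for each of the |E| - (N - 1) other edges.\<close>

lemma cyclic_cover_algorithm:
  fixes \<Sigma> T :: "'a set set" and \<nu> :: "'a \<Rightarrow> nat" and N n :: nat
  assumes \<Sigma>: "finite \<Sigma>" "flag_complex \<Sigma>" "connected_complex \<Sigma>" "triangle_free \<Sigma>"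
    and \<nu>: "bij_betw \<nu> (vertices \<Sigma>) {..<N}" and T: "maximal_tree \<Sigma> T" and n: "1 \<le> n"
  defines "\<mu> \<equiv> inv_into (vertices \<Sigma>) \<nu>" and "e \<equiv> encode_complex \<nu> \<Sigma>" and "L \<equiv> tree_edges (encode_complex \<nu> T) N"
  shows "cyclic_cover \<Sigma> \<mu> N n L (relator_index e n N L) (\<lambda>i. look (row n N L i))"
    and "length (relator_index e n N L) + n * (N - 1) = N - 1 + n * card {s \<in> \<Sigma>. card s = 2}"
proof -
  have simp\<Sigma>: "simplicial_complex \<Sigma>" using \<Sigma>(2) by (simp add: flag_complex_def)
  have simpT: "simplicial_complex T" and connT: "connected_complex T" and sub: "T \<subseteq> \<Sigma>"
    using T unfolding maximal_tree_def tree_complex_def by blast+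
  have finT: "finite T" using finite_subset[OF sub \<Sigma>(1)] .
  \<comment> \<open>Since a maximal tree spans, the numbering of the vertices of the complex also
    numbers those of the tree.\<close>
  have VT: "vertices T = vertices \<Sigma>" by (rule maximal_tree_spanning[OF simp\<Sigma> \<Sigma>(3) T])
  have \<mu>: "bij_betw \<mu> {..<N} (vertices \<Sigma>)" unfolding \<mu>_def by (rule bij_betw_inv_into[OF \<nu>])
  have e: "edge_bit e i j \<longleftrightarrow> index_adj \<Sigma> \<mu> N i j" for i j
    unfolding e_def \<mu>_def by (rule edge_bit_index[OF \<Sigma>(1) simp\<Sigma> \<nu>])
  have t: "edge_bit (encode_complex \<nu> T) i j \<longleftrightarrow> index_adj T \<mu> N i j" for i j
    using edge_bit_index[OF finT simpT, of \<nu> N i j] \<nu> unfolding VT \<mu>_def by blast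
  have te: "index_adj \<Sigma> \<mu> N i j" if "index_adj T \<mu> N i j" for i j
    using that sub unfolding index_adj_def adjacent_def by blast
  have N: "0 < N"
  proof -
    have "vertices \<Sigma> \<noteq> {}" using \<Sigma>(3) by (simp add: connected_complex_def)
    then show ?thesis using bij_betw_imp_surj_on[OF \<mu>] by (cases N) auto
  qed
  have \<mu>V: "\<mu> k \<in> vertices \<Sigma>" if "k < N" for k using bij_betw_apply[OF \<mu>, of k] that by simp
  have conn: "\<exists>p\<in>U. \<exists>c\<in>{..<N} - U. edge_bit (encode_complex \<nu> T) p c"
    if U: "0 \<in> U" "U \<subseteq> {..<N}" "U \<noteq> {..<N}" for U
  proof -
    have "\<not> {..<N} \<subseteq> U"
    proof
      assume "{..<N} \<subseteq> U"
      with U(2) have "U = {..<N}" by (rule subset_antisym)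
      with U(3) show False by (rule notE)
    qed
    then obtain k where k: "k < N" "k \<notin> U" by blast
    have inj: "inj_on \<mu> {..<N}" by (rule bij_betw_imp_inj_on[OF \<mu>])
    have all: "\<forall>u\<in>vertices \<Sigma>. \<forall>v\<in>vertices \<Sigma>. (adjacent T)\<^sup>*\<^sup>* u v"
      using connT unfolding connected_complex_def VT by (rule conjunct2)
    have path: "(adjacent T)\<^sup>*\<^sup>* (\<mu> 0) (\<mu> k)"
      by (rule bspec[OF bspec[OF all \<mu>V[OF N]] \<mu>V[OF k(1)]])
    have inU: "\<mu> 0 \<in> \<mu> ` U" using U(1) by (rule imageI)
    have notU: "\<mu> k \<notin> \<mu> ` U"
      using inj_on_image_mem_iff[OF inj, of k U] k U(2) by simp
    obtain x y where xy: "x \<in> \<mu> ` U" "y \<notin> \<mu> ` U" "adjacent T x y"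
      using rtranclp_exits[OF path inU notU] by (elim exE conjE)
    from xy(1) obtain p where p: "x = \<mu> p" "p \<in> U" by (rule imageE)
    have "y \<in> vertices \<Sigma>" using adjacent_vertices[OF xy(3)] VT by simp
    then have "y \<in> \<mu> ` {..<N}" by (simp only: bij_betw_imp_surj_on[OF \<mu>])
    then obtain c where c: "y = \<mu> c" "c \<in> {..<N}" by (rule imageE)
    have "c \<notin> U" using xy(2) unfolding c(1) by (rule contrapos_nn) (rule imageI)
    moreover have "index_adj T \<mu> N p c"
      using xy(3) subsetD[OF U(2) p(2)] c(2) by (simp add: index_adj_def p(1) c(1))
    then have "edge_bit (encode_complex \<nu> T) p c" by (simp only: t)
    ultimately show ?thesis using p(2) c(2) by (intro bexI[of _ p] bexI[of _ c]) simp_all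
  qed
  have L: "tree_list (index_adj \<Sigma> \<mu> N) L \<and> visited L = {..<N}"
    unfolding L_def
  proof (rule tree_edges_correct[OF N])
    show "\<exists>p\<in>U. \<exists>c\<in>{..<N} - U. edge_bit (encode_complex \<nu> T) p c"
      if "0 \<in> U" "U \<subseteq> {..<N}" "U \<noteq> {..<N}" for U using that by (rule conn)
    show "index_adj \<Sigma> \<mu> N p c" if "edge_bit (encode_complex \<nu> T) p c" for p c
      using that unfolding t by (rule te)
  qed
  then have tree: "tree_list (index_adj \<Sigma> \<mu> N) L" and vis: "visited L = {..<N}" by simp_all
  have edgeL: "edge_bit e p c" if "(p, c) \<in> set L" for p c using tree_list_edge[OF tree that] e by simp
  note asymL = tree_list_properties(4)[OF tree]
  have lenL: "length L = N - 1" using tree_list_properties(2)[OF tree] vis by simp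
  show "length (relator_index e n N L) + n * (N - 1) = N - 1 + n * card {s \<in> \<Sigma>. card s = 2}"
  proof -
    have "length (other_edges e N L) + (N - 1) = card {s \<in> \<Sigma>. card s = 2}"
      using length_other_edges[OF tree vis edgeL] card_edges[OF \<mu>] unfolding e by simp
    then have "n * (length (other_edges e N L) + (N - 1)) = n * card {s \<in> \<Sigma>. card s = 2}" by simp
    then show ?thesis by (simp add: relator_index_product lenL algebra_simps)
  qed
  show "cyclic_cover \<Sigma> \<mu> N n L (relator_index e n N L) (\<lambda>i. look (row n N L i))"
  proof (rule cyclic_cover.intro)
    show "bij_betw \<mu> {..<N} (vertices \<Sigma>)" by (rule \<mu>)
    show "0 < N" by (rule N)
    show "tree_list (index_adj \<Sigma> \<mu> N) L" by (rule tree)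
    show "visited L = {..<N}" by (rule vis)
    show "0 < n" using n by simp
    show "\<not> index_adj \<Sigma> \<mu> N v x" if "index_adj \<Sigma> \<mu> N u v" "index_adj \<Sigma> \<mu> N u x" for u v x
      using triangle_free_adjacent[OF \<Sigma>(4)] that unfolding index_adj_def by blast
    show "distinct (relator_index e n N L)"
      by (rule distinct_relator_index[OF tree_list_properties(1)[OF tree]])
    show "index_adj \<Sigma> \<mu> N u v \<and> i < n" if "((u, v), i) \<in> set (relator_index e n N L)" for u v i
    proof -
      have "edge_bit e u v" "i < n"
        using that edgeL[of u v] n unfolding set_relator_index set_other_edges by auto
      then show ?thesis using e by simp
    qed
    show "i = n - 1" if "((u, v), i) \<in> set (relator_index e n N L)" "(u, v) \<in> set L \<or> (v, u) \<in> set L" for u v i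
      using that unfolding set_relator_index set_other_edges by blast
    show "((v, u), j) \<notin> set (relator_index e n N L)" if "((u, v), i) \<in> set (relator_index e n N L)" for u v i j
      using that asymL[of u v] asymL[of v u] less_asym[of u v] unfolding set_relator_index set_other_edges by blast
    show "((u, v), i) \<in> set (relator_index e n N L) \<or> ((v, u), i) \<in> set (relator_index e n N L) \<or>
      ((u, v) \<in> set L \<or> (v, u) \<in> set L) \<and> Suc i < n" if uv: "index_adj \<Sigma> \<mu> N u v" and i: "i < n" for u v i
    proof (cases "(u, v) \<in> set L \<or> (v, u) \<in> set L")
      case True
      have "i = n - 1 \<or> Suc i < n" using i by linarith
      then show ?thesis using True unfolding set_relator_index by blast
    next
      case False
      have uv': "edge_bit e u v" "edge_bit e v u" "u < N" "v < N"
        using uv e edge_bit_commute[of e u v] by (simp_all add: index_adj_def)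
      then have "u < v \<or> v < u" by (auto simp: edge_bit_def)
      then show ?thesis using False uv' i unfolding set_relator_index set_other_edges by blast
    qed
    show "look (row n N L 0) v = [(v, False)]" if "0 < v" "v < N" for v
      using that by (simp add: row_def look_first_row)
    show "look (row n N L i) 0 = (if i = n - 1 then [(0, False)] else [])" if "i < n" for i
    proof (cases i)
      case 0
      then show ?thesis using that N by (simp add: row_def look_first_row)
    next
      case (Suc k)
      have "look (row n N L i) 0 = (if Suc (Suc k) = n then [(0, False)] else [])"
        using look_next_row[OF tree, of n k "row n N L k"] by (simp add: Suc row_def)
      then show ?thesis using that Suc by auto
    qed
    show "look (row n N L (Suc i)) c = inv_word (look (row n N L i) p) @ look (row n N L i) c @ look (row n N L (Suc i)) p"
      if "(p, c) \<in> set L" "Suc i < n" for p c i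
      using look_next_row[OF tree, of n i "row n N L i"] that(1) by (simp add: row_def)
  qed
qed

theorem theoremB:
  shows "\<exists>f. recursive_fun 3 f \<and>
    (\<forall>(\<Sigma> :: 'a set set) (T :: 'a set set) (\<nu> :: 'a \<Rightarrow> nat) (N :: nat) (n :: nat).
      finite \<Sigma> \<and> flag_complex \<Sigma> \<and> connected_complex \<Sigma> \<and> triangle_free \<Sigma> \<and>
      N = card (vertices \<Sigma>) \<and> bij_betw \<nu> (vertices \<Sigma>) {..<N} \<and>
      maximal_tree \<Sigma> T \<and> n \<ge> 1 \<longrightarrow>
      (\<exists>P. f [encode_complex \<nu> \<Sigma>, encode_complex \<nu> T, n] = encode_presentation P \<and>
        presents P (Gamma \<Sigma> n) \<and>
        num_gens P = N \<and>
        int (length (relators P)) = int N - 1 + int n * (1 - euler_char \<Sigma>) \<and>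
        efficient P (Gamma \<Sigma> n)))"
proof -
  obtain f where f: "recursive_fun 3 f" "\<And>e t n. f [e, t, n] = encode (coded_presentation (e, t, n))"
    using recursive_coded_presentation by blast
  show ?thesis
  proof (rule exI[of _ f], intro conjI allI impI, rule f(1), elim conjE)
    fix \<Sigma> T :: "'a set set" and \<nu> :: "'a \<Rightarrow> nat" and N n :: nat
    assume \<Sigma>: "finite \<Sigma>" "flag_complex \<Sigma>" "connected_complex \<Sigma>" "triangle_free \<Sigma>"
      and N: "N = card (vertices \<Sigma>)" and \<nu>: "bij_betw \<nu> (vertices \<Sigma>) {..<N}"
      and T: "maximal_tree \<Sigma> T" and n: "1 \<le> n"
    define e where "e = encode_complex \<nu> \<Sigma>"
    define t where "t = encode_complex \<nu> T"
    define L where "L = tree_edges t N"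
    define J where "J = relator_index e n N L"
    have cover: "cyclic_cover \<Sigma> (inv_into (vertices \<Sigma>) \<nu>) N n L J (\<lambda>i. look (row n N L i))"
      and len: "length J + n * (N - 1) = N - 1 + n * card {s \<in> \<Sigma>. card s = 2}"
      using cyclic_cover_algorithm[OF \<Sigma> \<nu> T n] unfolding J_def L_def e_def t_def by blast+
    define R where "R = cyclic_cover.rels n J (\<lambda>i. look (row n N L i))"
    let ?P = "Presentation N R"
    have simp: "simplicial_complex \<Sigma>" using \<Sigma>(2) by (simp add: flag_complex_def)
    have Ne: "num_vertices e = N"
      unfolding e_def by (rule num_vertices_eq[OF \<Sigma>(1) simp bij_betw_imp_surj_on[OF \<nu>]])
    have R: "R = cover_relators e t n"
    proof -
      have "R = map (relator_word n N L) J"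
        unfolding R_def cyclic_cover.rels_def[OF cover]
      proof (rule map_cong[OF refl], goal_cases)
        case (1 k)
        obtain u v i where uvi: "k = ((u, v), i)" by (metis surj_pair)
        have "i < n" using cyclic_cover.J_adj[OF cover] 1 unfolding uvi by blast
        then have "Suc i mod n = (if Suc i = n then 0 else Suc i)" by simp
        then show ?case by (simp add: uvi cyclic_cover.rel_def[OF cover] relator_word_def)
      qed
      then show ?thesis by (simp add: cover_relators_def Ne L_def J_def)
    qed
    have code: "f [e, t, n] = encode_presentation ?P"
    proof -
      have letter: "(\<lambda>l :: nat \<times> bool. fst l + fst l + (if snd l then 1 else 0)) = (\<lambda>(i, b). 2 * i + of_bool b)"
        by (auto simp: fun_eq_iff)
      have "encode (map (\<lambda>(i, b). 2 * i + of_bool b :: nat) w) = encode_word w" for w :: "nat word"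
        by (simp add: encode_list_def encode_nat_def encode_word_def)
      then have "encode (map (map (\<lambda>(i, b). 2 * i + of_bool b :: nat)) R) = list_encode (map encode_word R)"
        unfolding encode_list_def[of "map (map _) R"] by (simp add: comp_def)
      then show ?thesis
        unfolding f(2) coded_presentation_def fst_conv snd_conv R[symmetric] letter Ne
        by (simp add: encode_prod_def encode_presentation_def encode_nat_def)
    qed
    have "vertices \<Sigma> \<noteq> {}" using \<Sigma>(3) by (simp add: connected_complex_def)
    then have "0 < N" using \<nu> by (cases N) (auto simp: bij_betw_def)
    then have N1: "int (N - 1) = int N - 1" by simp
    have \<chi>: "int (card {s \<in> \<Sigma>. card s = 2}) = int N - euler_char \<Sigma>"
      using euler_char_graph[OF \<Sigma>(1,2,4)] unfolding N by simp
    have "length R = length J" unfolding R_def cyclic_cover.rels_def[OF cover] by simp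
    \<comment> \<open>The number of edges is N minus the Euler characteristic; after cancelling n (N
      - 1), each level contributes one minus the Euler characteristic.\<close>
    moreover have "int (length J) + int n * (int N - 1) = int N - 1 + int n * (int N - euler_char \<Sigma>)"
      using arg_cong[OF len, of int] unfolding of_nat_add of_nat_mult N1 \<chi> .
    ultimately have "int (length R) = int N - 1 + int n * (1 - euler_char \<Sigma>)"
      by (simp add: algebra_simps)
    then show "\<exists>P. f [encode_complex \<nu> \<Sigma>, encode_complex \<nu> T, n] = encode_presentation P \<and>
        presents P (Gamma \<Sigma> n) \<and> num_gens P = N \<and>
        int (length (relators P)) = int N - 1 + int n * (1 - euler_char \<Sigma>) \<and> efficient P (Gamma \<Sigma> n)"
      using code cyclic_cover.presents_Gamma[OF cover] cyclic_cover.efficient_Gamma[OF cover]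
      unfolding e_def[symmetric] t_def[symmetric] R_def[symmetric] by (intro exI[of _ ?P]) simp
  qed
qed

end
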